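(* Let $0<t_n<\infty$, let $x_n\in\mathbb{R}^m$, and let $\{B(t):0\le t\le t_n\}$ be a Gaussian process of dimension $m\times1$ with $$E[B(t)]=t\,t_n^{-1}x_n\quad\text{for }0\le t\le t_n$$ and $$E\big[(B(t)-E[B(t)])(B(s)-E[B(s)])^T\big]=\begin{cases}(I-t\,t_n^{-1}I)\,s\alpha, & 0\le s\le t\le t_n,\\ t\alpha\,(I-s\,t_n^{-1}I), & 0\le t<s\le t_n,\end{cases}$$ where $\alpha$ is symmetric positive definite. If samples $B(t_i)=x_i$ are known for $0<t_1<t_2<\dots<t_{n-1}<t_n$ ($n\ge2$), then $$\hat\alpha=\frac1{n-1}\sum_{i=1}^{n-1}\frac{(t_{i+1}x_i-t_ix_{i+1})(t_{i+1}x_i-t_ix_{i+1})^T}{t_it_{i+1}(t_{i+1}-t_i)}$$ is both a sufficient estimator and the unique maximum likelihood estimator of $\alpha$.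
   Context: $I$ is the $m\times m$ identity matrix. Sufficiency and maximum likelihood are with respect to the joint density of $(B(t_1),\dots,B(t_{n-1}))$ at $(x_1,\dots,x_{n-1})$, as a function of the parameter $\alpha$, with $x_n$ and $t_1,\dots,t_n$ known constants.
   Formalization: The unique-MLE claim fails when α̂ is singular (always if n−1<m), as no maximizer then exists; proved instead: for every sample the set of MLEs is {α̂} if α̂ is positive definite and empty otherwise, and if n−1≥m then α̂ is almost surely the unique MLE. *)

theory Defs
  imports "HOL-Probability.Probability"
begin

text \<open>Normal laws may be degenerate (\<^term>\<open>\<sigma> = 0\<close>): a bridge is constant at its end points.\<close>

definition normal_rv :: "'a measure \<Rightarrow> ('a \<Rightarrow> real) \<Rightarrow> bool" where
  "normal_rv M Y \<longleftrightarrow> Y \<in> borel_measurable M \<and>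
     (\<exists>\<mu> \<sigma>. 0 \<le> \<sigma> \<and>
        distr M borel Y =
          (if \<sigma> = 0 then return borel \<mu>
           else density lborel (\<lambda>y. ennreal (normal_density \<mu> \<sigma> y))))"

definition gaussian_process ::
    "'a measure \<Rightarrow> 't set \<Rightarrow> ('t \<Rightarrow> 'a \<Rightarrow> 'b::euclidean_space) \<Rightarrow> bool" where
  "gaussian_process M I B \<longleftrightarrow>
     prob_space M \<and>
     (\<forall>t\<in>I. B t \<in> borel_measurable M) \<and>
     (\<forall>F c. finite F \<and> F \<subseteq> I \<longrightarrow> normal_rv M (\<lambda>\<omega>. \<Sum>t\<in>F. c t \<bullet> B t \<omega>))"

definition outer :: "real^'m \<Rightarrow> real^'m \<Rightarrow> real^'m^'m" where
  "outer v w = (\<chi> i j. v $ i * w $ j)"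

definition sym_pos_def :: "real^'m^'m \<Rightarrow> bool" where
  "sym_pos_def A \<longleftrightarrow> transpose A = A \<and> (\<forall>v. v \<noteq> 0 \<longrightarrow> 0 < v \<bullet> (A *v v))"

text \<open>A sample \<open>(x\<^sub>1, \<dots>, x\<^sub>n\<^sub>-\<^sub>1)\<close> is an extensional function on \<^term>\<open>{1..<n}\<close>.\<close>

definition sample_space :: "nat \<Rightarrow> (nat \<Rightarrow> 'b::euclidean_space) measure" where
  "sample_space n = (\<Pi>\<^sub>M i\<in>{1..<n}. lborel)"

definition sample ::
    "nat \<Rightarrow> (nat \<Rightarrow> real) \<Rightarrow> (real \<Rightarrow> 'a \<Rightarrow> 'b) \<Rightarrow> 'a \<Rightarrow> nat \<Rightarrow> 'b" where
  "sample n t B \<omega> = (\<lambda>i\<in>{1..<n}. B (t i) \<omega>)"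

definition sample_law ::
    "'a measure \<Rightarrow> nat \<Rightarrow> (nat \<Rightarrow> real) \<Rightarrow> (real \<Rightarrow> 'a \<Rightarrow> 'b::euclidean_space) \<Rightarrow> (nat \<Rightarrow> 'b) measure"
  where
  "sample_law M n t B = distr M (sample_space n) (sample n t B)"

text \<open>A density is determined only almost everywhere, whereas the likelihood is evaluated
  pointwise. The version meant is the continuous one; continuity determines its values on the
  whole sample space, and \<open>SOME\<close> only leaves open the values outside it.\<close>

definition joint_density ::
    "'a measure \<Rightarrow> nat \<Rightarrow> (nat \<Rightarrow> real) \<Rightarrow> (real \<Rightarrow> 'a \<Rightarrow> 'b::euclidean_space) \<Rightarrow> (nat \<Rightarrow> 'b) \<Rightarrow> real"
  where
  "joint_density M n t B =
     (SOME f. continuous_on (space (sample_space n)) f \<and>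
        (\<forall>x\<in>space (sample_space n). 0 \<le> f x) \<and>
        distributed M (sample_space n) (sample n t B) (\<lambda>x. ennreal (f x)))"

text \<open>Sufficiency: the conditional probability of every event given \<^term>\<open>T\<close> has a version that
  does not depend on the parameter.\<close>

definition sufficient_statistic ::
    "'p set \<Rightarrow> ('p \<Rightarrow> 'x measure) \<Rightarrow> 'x measure \<Rightarrow> 'y measure \<Rightarrow> ('x \<Rightarrow> 'y) \<Rightarrow> bool" where
  "sufficient_statistic \<Theta> P S N T \<longleftrightarrow>
     T \<in> measurable S N \<and>
     (\<forall>A\<in>sets S. \<exists>g \<in> borel_measurable (vimage_algebra (space S) T N).
        \<forall>\<theta>\<in>\<Theta>. AE x in P \<theta>.
          real_cond_exp (P \<theta>) (vimage_algebra (space S) T N) (indicator A) x = g x)"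

definition ml_estimates :: "'p set \<Rightarrow> ('p \<Rightarrow> 'x \<Rightarrow> real) \<Rightarrow> 'x \<Rightarrow> 'p set" where
  "ml_estimates \<Theta> L x = {\<theta>\<in>\<Theta>. \<forall>\<theta>'\<in>\<Theta>. L \<theta>' x \<le> L \<theta> x}"

definition alpha_hat :: "nat \<Rightarrow> (nat \<Rightarrow> real) \<Rightarrow> (nat \<Rightarrow> real^'m) \<Rightarrow> real^'m^'m" where
  "alpha_hat n t x =
     (1 / (real n - 1)) *\<^sub>R
       (\<Sum>i=1..n-1. (1 / (t i * t (i+1) * (t (i+1) - t i))) *\<^sub>R
          outer (t (i+1) *\<^sub>R x i - t i *\<^sub>R x (i+1)) (t (i+1) *\<^sub>R x i - t i *\<^sub>R x (i+1)))"

end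

theory Submission
  imports Defs
begin

text \<open>The residuals \<open>y\<^sub>i = x\<^sub>i - (t\<^sub>i / t\<^sub>i\<^sub>+\<^sub>1) x\<^sub>i\<^sub>+\<^sub>1\<close> of a bridge sample (with \<open>x\<^sub>n\<close> known) are uncorrelated with
  covariances \<open>s\<^sub>i\<^sup>2 \<alpha>\<close>, where \<open>s\<^sub>i\<^sup>2 = t\<^sub>i (t\<^sub>i\<^sub>+\<^sub>1 - t\<^sub>i) / t\<^sub>i\<^sub>+\<^sub>1\<close>. If \<open>Q \<alpha> Q\<^sup>T = I\<close>, the vectors \<open>Q y\<^sub>i / s\<^sub>i\<close> are
  therefore independent and standard Gaussian, and since they depend on the sample through an affine
  triangular map, the sample has the density \<open>K \<bar>det Q\<bar>\<^sup>n\<^sup>-\<^sup>1 exp (- tr (Q S Q\<^sup>T) / 2)\<close> with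
  \<open>S = (\<Sum>i. y\<^sub>i y\<^sub>i\<^sup>T / s\<^sub>i\<^sup>2)\<close>, which is \<open>n - 1\<close> times the estimator. So the density is a function of the
  estimator, which gives sufficiency.

  For the maximum, choose \<open>Q\<close> such that \<open>Q S Q\<^sup>T\<close> is also diagonal, with entries \<open>d\<^sub>k\<close>. Rescaling the rows
  of \<open>Q\<close> leads to other parameters, and the comparison of likelihoods reduces to
  \<open>u exp (1 - u) \<le> 1\<close> for \<open>u = d\<^sub>k / (n - 1)\<close>, with equality only for \<open>u = 1\<close>. If some \<open>d\<^sub>k\<close> vanishes, then
  \<open>S\<close> is singular and the likelihood is unbounded. This does not happen almost surely when \<open>n - 1\<close> is at
  least the dimension, because the residuals then span the whole space.\<close>

section \<open>Uniqueness of characteristic functions in several dimensions\<close>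

text \<open>Gaussianity is assumed only of scalar combinations of the process, so the joint law has
  to be recovered from characteristic functions. A combination of whitened residuals is one normal
  variable, known from its mean and variance; uniqueness, lifted from the line to finite families of
  vectors, turns this knowledge into a product law. The covariance matrix of the whole sample is
  never inverted.

  The residuals come from reading the process backwards in time: given B(t_{i+1}), a bridge that
  starts at 0 has at t_i the mean (t_i / t_{i+1}) B(t_{i+1}) and the covariance s_i^2 alpha. In this
  direction the recursion starts from the known vector x_n.

  A likelihood is evaluated at points, whereas a law fixes its density only almost everywhere;
  uniqueness of continuous densities bridges the gap.\<close>

text \<open>The factor \<open>m\<close> makes the notion applicable to laws that are weighted by a bounded function,
  whose total mass is arbitrary.\<close>

definition char_determined :: "'b::euclidean_space measure \<Rightarrow> ('b \<Rightarrow> real) \<Rightarrow> bool" where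
  "char_determined \<gamma> \<phi> \<longleftrightarrow>
     (\<forall>N m. finite_measure N \<and> sets N = sets borel \<and>
        (\<forall>c. (CLINT x|N. cis (c \<bullet> x)) = complex_of_real (m * \<phi> c)) \<longrightarrow>
        (\<forall>A\<in>sets borel. measure N A = m * measure \<gamma> A))"

text \<open>Division by the total mass \<open>m\<close>, the value of the characteristic function at
  0, reduces the claim to Levy's uniqueness theorem on the line. For \<open>m = 0\<close> there is
  nothing to normalise and both sides vanish.\<close>

lemma char_determined_std_normal:
  "char_determined std_normal_distribution (\<lambda>c. exp (- (norm c)\<^sup>2 / 2))"
  unfolding char_determined_def
proof (intro allI impI ballI, elim conjE)
  fix N :: "real measure" and m :: real and A :: "real set"
  assume fin: "finite_measure N" and sN [measurable_cong]: "sets N = sets borel"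
    and ch: "\<forall>c. (CLINT x|N. cis (c \<bullet> x)) = complex_of_real (m * exp (- (norm c)\<^sup>2 / 2))"
    and A: "A \<in> sets borel"
  interpret finite_measure N by fact
  have space_N: "space N = UNIV" using sN sets_eq_imp_space_eq by fastforce
  have m: "m = measure N UNIV"
  proof -
    have "complex_of_real (measure N UNIV) = complex_of_real m"
      using ch[rule_format, of 0] by (simp add: space_N scaleR_conv_of_real)
    then show ?thesis by (simp only: of_real_eq_iff)
  qed
  show "measure N A = m * measure std_normal_distribution A"
  proof (cases "m = 0")
    case True
    have "measure N A \<le> measure N UNIV"
      by (rule finite_measure_mono) (auto simp: sN)
    then have "measure N A = 0" using True m by (intro order_antisym) simp_all
    then show ?thesis using True by simp
  next
    case False
    then have pos: "m > 0" using m measure_nonneg[of N UNIV] by linarith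
    define N' where "N' = density N (\<lambda>_. ennreal (1 / m))"
    have sN' [simp]: "sets N' = sets borel" by (simp add: N'_def sN)
    have eN': "emeasure N' B = ennreal (measure N B / m)" if "B \<in> sets borel" for B
      using that pos by (simp add: N'_def emeasure_density_const sN emeasure_eq_measure
          ennreal_mult'[symmetric])
    have "prob_space N'"
    proof
      show "emeasure N' (space N') = 1"
        using eN'[of UNIV] pos m by (simp add: N'_def space_N)
    qed
    then have rd: "real_distribution N'"
      by (simp add: real_distribution_def real_distribution_axioms_def)
    have "char N' = char std_normal_distribution"
    proof
      fix c
      have "char N' c = (CLINT x|N. (1 / m) *\<^sub>R iexp (c * x))"
        unfolding char_def N'_def using pos by (subst integral_density) auto
      also have "\<dots> = (1 / m) *\<^sub>R (CLINT x|N. cis (c \<bullet> x))"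
        by (simp add: cis_conv_exp)
      also have "\<dots> = complex_of_real (exp (- (c\<^sup>2) / 2))"
        using pos ch by (simp add: scaleR_conv_of_real)
      also have "\<dots> = char std_normal_distribution c"
        by (simp add: char_std_normal_distribution)
      finally show "char N' c = char std_normal_distribution c" .
    qed
    then have "N' = std_normal_distribution"
      using Levy_uniqueness rd real_dist_normal_dist by blast
    then have "measure std_normal_distribution A = measure N A / m"
      using eN'[OF A] pos by (simp add: measure_def)
    then show ?thesis using pos by simp
  qed
qed

lemma integrable_bounded_weight:
  fixes f :: "'a \<Rightarrow> 'c::{banach, second_countable_topology}"
  assumes "finite_measure M" and [measurable]: "w \<in> borel_measurable M" "f \<in> borel_measurable M"
    and "\<And>x. \<bar>w x\<bar> \<le> C" "\<And>x. norm (f x) \<le> 1"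
  shows "integrable M (\<lambda>x. w x *\<^sub>R f x)"
proof -
  interpret finite_measure M by fact
  have "norm (w x *\<^sub>R f x) \<le> C" for x
    using assms(4)[of x] assms(5)[of x] mult_mono[of "\<bar>w x\<bar>" C "norm (f x)" 1]
    by (smt (verit) norm_ge_zero norm_scaleR mult_cancel_left1 abs_ge_zero)
  then show ?thesis by (intro integrable_const_bound[of _ C]) auto
qed

text \<open>The image under \<open>X\<close> of the measure with density \<open>w\<close> is finite,
  as \<open>w\<close> is bounded, and its characteristic function is \<open>m\<close> times \<phi>.
  So it is determined.\<close>

lemma char_determined_weighted:
  fixes X :: "'a \<Rightarrow> 'b::euclidean_space"
  assumes det: "char_determined \<gamma> \<phi>" and fin: "finite_measure M"
    and [measurable]: "X \<in> borel_measurable M" "w \<in> borel_measurable M"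
    and w: "\<And>\<omega>. 0 \<le> w \<omega>" "\<And>\<omega>. w \<omega> \<le> C"
    and ch: "\<And>a. (CLINT \<omega>|M. w \<omega> *\<^sub>R cis (a \<bullet> X \<omega>)) = complex_of_real (m * \<phi> a)"
    and A [measurable]: "A \<in> sets borel"
  shows "(LINT \<omega>|M. w \<omega> * indicator A (X \<omega>)) = m * measure \<gamma> A"
proof -
  interpret finite_measure M by fact
  define D where "D = density M (\<lambda>\<omega>. ennreal (w \<omega>))"
  have [measurable_cong]: "sets D = sets M" by (simp add: D_def)
  have int: "integrable M w"
    using integrable_bounded_weight[OF fin, of w "\<lambda>_. 1::real" C] w by (simp add: abs_le_iff)
  have "finite_measure D"
  proof
    have "emeasure D (space D) = (\<integral>\<^sup>+\<omega>. ennreal (w \<omega>) \<partial>M)"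
      by (simp add: D_def emeasure_density cong: nn_integral_cong)
    also have "\<dots> < \<infinity>" using int w by (simp add: nn_integral_eq_integral)
    finally show "emeasure D (space D) \<noteq> \<infinity>" by simp
  qed
  then have "finite_measure (distr D borel X)"
    by (rule finite_measure.finite_measure_distr) simp
  moreover have "(CLINT x|distr D borel X. cis (a \<bullet> x)) = complex_of_real (m * \<phi> a)" for a
    unfolding ch[symmetric]
    by (subst integral_distr, simp, simp add: cis_conv_exp)
      (simp add: D_def integral_density w cis_conv_exp)
  ultimately have law: "measure (distr D borel X) A = m * measure \<gamma> A"
    using det A unfolding char_determined_def by (metis sets_distr)
  have "m * measure \<gamma> A = (LINT x|distr D borel X. indicator A x)"
    by (simp add: law)
  also have "\<dots> = (LINT \<omega>|M. w \<omega> * indicator A (X \<omega>))"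
    by (subst integral_distr, simp, simp) (simp add: D_def integral_density w)
  finally show ?thesis ..
qed

text \<open>Indicators replace the exponentials one variable at a time. The weights \<open>g\<close>, \<open>g (1 + cos \<theta>)\<close> and
  \<open>g (1 + sin \<theta>)\<close> are nonnegative, so that uniqueness for finite measures applies to each of them.\<close>

lemma char_determined_joint:
  fixes X :: "'k \<Rightarrow> 'a \<Rightarrow> 'b::euclidean_space" and m :: real
  assumes det: "char_determined \<gamma> \<phi>" and \<phi>0: "\<phi> 0 = 1" and even: "\<And>c. \<phi> (- c) = \<phi> c"
    and fin: "finite_measure M"
    and X [measurable]: "\<And>k. X k \<in> borel_measurable M"
    and A [measurable]: "\<And>k. A k \<in> sets borel"
    and J: "finite J"
  shows "finite L \<Longrightarrow> L \<inter> J = {} \<Longrightarrow>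
    (\<And>c. (CLINT \<omega>|M. cis (\<Sum>k\<in>J \<union> L. c k \<bullet> X k \<omega>)) = complex_of_real (m * (\<Prod>k\<in>J \<union> L. \<phi> (c k)))) \<Longrightarrow>
    (CLINT \<omega>|M. (\<Prod>k\<in>J. indicator (A k) (X k \<omega>)) *\<^sub>R cis (\<Sum>k\<in>L. c k \<bullet> X k \<omega>)) =
      complex_of_real (m * (\<Prod>k\<in>J. measure \<gamma> (A k)) * (\<Prod>k\<in>L. \<phi> (c k)))"
  using J
proof (induction J arbitrary: L c rule: finite_induct)
  case empty
  then show ?case by simp
next
  case (insert j J)
  define g where "g \<omega> = (\<Prod>k\<in>J. indicator (A k) (X k \<omega>) :: real)" for \<omega>
  define \<theta> where "\<theta> \<omega> = (\<Sum>k\<in>L. c k \<bullet> X k \<omega>)" for \<omega>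
  define p where "p = (\<Prod>k\<in>J. measure \<gamma> (A k))"
  define q where "q = (\<Prod>k\<in>L. \<phi> (c k))"
  have [measurable]: "g \<in> borel_measurable M" "\<theta> \<in> borel_measurable M"
    unfolding g_def \<theta>_def by measurable
  have g: "0 \<le> g \<omega>" "g \<omega> \<le> 1" for \<omega>
    unfolding g_def by (auto intro!: prod_nonneg prod_le_1 simp: indicator_def)
  have jL: "j \<notin> L" "j \<notin> J" "finite L" using insert by auto
  have IH: "(CLINT \<omega>|M. g \<omega> *\<^sub>R cis (\<Sum>k\<in>insert j L. c' k \<bullet> X k \<omega>)) =
      complex_of_real (m * p * (\<Prod>k\<in>insert j L. \<phi> (c' k)))" for c'
    unfolding g_def p_def
    by (rule insert.IH) (use insert in \<open>auto simp: Un_insert_right\<close>)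
  \<comment> \<open>The factor \<open>s\<close> scales all remaining frequencies at once. The values
    0, 1 and -1 give the integrals with phase a X, a X + \<theta> and a X - \<theta>; the last two
    agree because \<phi> is even.\<close>
  have IHs: "(CLINT \<omega>|M. g \<omega> *\<^sub>R cis (a \<bullet> X j \<omega> + s * \<theta> \<omega>)) =
      complex_of_real (m * p * (\<phi> a * (\<Prod>k\<in>L. \<phi> (s *\<^sub>R c k))))" for a s
  proof -
    have "(\<Sum>k\<in>L. (if k = j then a else s *\<^sub>R c k) \<bullet> X k \<omega>) = s * \<theta> \<omega>" for \<omega>
      unfolding \<theta>_def sum_distrib_left using jL by (intro sum.cong) auto
    moreover have "(\<Prod>k\<in>L. \<phi> (if k = j then a else s *\<^sub>R c k)) = (\<Prod>k\<in>L. \<phi> (s *\<^sub>R c k))"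
      using jL by (intro prod.cong) auto
    ultimately show ?thesis
      using IH[of "\<lambda>k. if k = j then a else s *\<^sub>R c k"] jL by simp
  qed
  have I0: "(CLINT \<omega>|M. g \<omega> *\<^sub>R cis (a \<bullet> X j \<omega>)) = complex_of_real (m * p * \<phi> a)" for a
    using IHs[of a 0] \<phi>0 by simp
  have Ip: "(CLINT \<omega>|M. g \<omega> *\<^sub>R cis (a \<bullet> X j \<omega> + \<theta> \<omega>)) = complex_of_real (m * p * (\<phi> a * q))" for a
    using IHs[of a 1] by (simp add: q_def)
  have Im: "(CLINT \<omega>|M. g \<omega> *\<^sub>R cis (a \<bullet> X j \<omega> - \<theta> \<omega>)) = complex_of_real (m * p * (\<phi> a * q))" for a
    using IHs[of a "-1"] by (simp add: q_def even)
  have int: "integrable M (\<lambda>\<omega>. g \<omega> *\<^sub>R cis (h \<omega>))"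
    if [measurable]: "h \<in> borel_measurable M" for h
    by (rule integrable_bounded_weight[OF fin, of _ _ 1]) (use g in \<open>auto simp: cis_conv_exp\<close>)
  have lin_p: "(CLINT \<omega>|M. u \<omega> + (1/2) *\<^sub>R (v \<omega> + v' \<omega>)) =
      (CLINT \<omega>|M. u \<omega>) + (1/2) *\<^sub>R ((CLINT \<omega>|M. v \<omega>) + (CLINT \<omega>|M. v' \<omega>))"
    if "integrable M u" "integrable M v" "integrable M v'" for u v v' :: "'a \<Rightarrow> complex"
    using that by simp
  have lin_m: "(CLINT \<omega>|M. u \<omega> - (\<i>/2) * (v \<omega> - v' \<omega>)) =
      (CLINT \<omega>|M. u \<omega>) - (\<i>/2) * ((CLINT \<omega>|M. v \<omega>) - (CLINT \<omega>|M. v' \<omega>))"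
    if "integrable M u" "integrable M v" "integrable M v'" for u v v' :: "'a \<Rightarrow> complex"
    using that by simp
  have w0: "(LINT \<omega>|M. g \<omega> * indicator (A j) (X j \<omega>)) = m * p * measure \<gamma> (A j)"
    by (rule char_determined_weighted[OF det fin _ _ g(1) g(2)]) (use I0 in auto)
  have w1: "(LINT \<omega>|M. (g \<omega> * (1 + cos (\<theta> \<omega>))) * indicator (A j) (X j \<omega>)) = m * p * (1 + q) * measure \<gamma> (A j)"
  proof (rule char_determined_weighted[OF det fin, where C = 2])
    fix a
    have "(g \<omega> * (1 + cos (\<theta> \<omega>))) *\<^sub>R cis (a \<bullet> X j \<omega>) = g \<omega> *\<^sub>R cis (a \<bullet> X j \<omega>) +
       (1/2) *\<^sub>R (g \<omega> *\<^sub>R cis (a \<bullet> X j \<omega> + \<theta> \<omega>) + g \<omega> *\<^sub>R cis (a \<bullet> X j \<omega> - \<theta> \<omega>))" for \<omega>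
      by (simp add: complex_eq_iff cos_add sin_add cos_diff sin_diff algebra_simps)
    then show "(CLINT \<omega>|M. (g \<omega> * (1 + cos (\<theta> \<omega>))) *\<^sub>R cis (a \<bullet> X j \<omega>)) =
        complex_of_real (m * p * (1 + q) * \<phi> a)"
      by (simp only:, subst lin_p) (rule int, simp, rule int, simp, rule int, simp,
        simp only: I0 Ip Im, simp add: complex_eq_iff algebra_simps)
  next
    fix \<omega>
    have "-1 \<le> cos (\<theta> \<omega>)" "cos (\<theta> \<omega>) \<le> 1" by simp_all
    then have "0 \<le> 1 + cos (\<theta> \<omega>)" "1 + cos (\<theta> \<omega>) \<le> 2" by linarith+
    then show "0 \<le> g \<omega> * (1 + cos (\<theta> \<omega>))" "g \<omega> * (1 + cos (\<theta> \<omega>)) \<le> 2"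
      using mult_nonneg_nonneg[OF g(1)[of \<omega>], of "1 + cos (\<theta> \<omega>)"]
        mult_mono[OF g(2)[of \<omega>], of "1 + cos (\<theta> \<omega>)" 2] by simp_all
  qed auto
  \<comment> \<open>The two shifted exponentials now enter with opposite signs and equal integrals,
    so the weight 1 + sin \<theta> gives the same value as the weight 1, and the sine integral
    vanishes.\<close>
  have w2: "(LINT \<omega>|M. (g \<omega> * (1 + sin (\<theta> \<omega>))) * indicator (A j) (X j \<omega>)) = m * p * measure \<gamma> (A j)"
  proof (rule char_determined_weighted[OF det fin, where C = 2])
    fix a
    have "(g \<omega> * (1 + sin (\<theta> \<omega>))) *\<^sub>R cis (a \<bullet> X j \<omega>) = g \<omega> *\<^sub>R cis (a \<bullet> X j \<omega>) -
       (\<i>/2) * (g \<omega> *\<^sub>R cis (a \<bullet> X j \<omega> + \<theta> \<omega>) - g \<omega> *\<^sub>R cis (a \<bullet> X j \<omega> - \<theta> \<omega>))" for \<omega>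
      by (simp add: complex_eq_iff cos_add sin_add cos_diff sin_diff field_simps)
    then show "(CLINT \<omega>|M. (g \<omega> * (1 + sin (\<theta> \<omega>))) *\<^sub>R cis (a \<bullet> X j \<omega>)) =
        complex_of_real (m * p * \<phi> a)"
      by (simp only:, subst lin_m) (rule int, simp, rule int, simp, rule int, simp,
        simp only: I0 Ip Im, simp)
  next
    fix \<omega>
    have "-1 \<le> sin (\<theta> \<omega>)" "sin (\<theta> \<omega>) \<le> 1" by simp_all
    then have "0 \<le> 1 + sin (\<theta> \<omega>)" "1 + sin (\<theta> \<omega>) \<le> 2" by linarith+
    then show "0 \<le> g \<omega> * (1 + sin (\<theta> \<omega>))" "g \<omega> * (1 + sin (\<theta> \<omega>)) \<le> 2"
      using mult_nonneg_nonneg[OF g(1)[of \<omega>], of "1 + sin (\<theta> \<omega>)"]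
        mult_mono[OF g(2)[of \<omega>], of "1 + sin (\<theta> \<omega>)" 2] by simp_all
  qed auto
  have gA: "integrable M (\<lambda>\<omega>. g \<omega> * indicator (A j) (X j \<omega>) * h \<omega>)"
    if [measurable]: "h \<in> borel_measurable M" and "\<And>\<omega>. \<bar>h \<omega>\<bar> \<le> 1" for h :: "'a \<Rightarrow> real"
  proof -
    have "integrable M (\<lambda>\<omega>. g \<omega> *\<^sub>R (indicator (A j) (X j \<omega>) * h \<omega>))"
      by (rule integrable_bounded_weight[OF fin, of _ _ 1]) (use g that in \<open>auto simp: indicator_def\<close>)
    then show ?thesis by (simp add: mult.assoc)
  qed
  have gA1: "integrable M (\<lambda>\<omega>. g \<omega> * indicator (A j) (X j \<omega>))"
    using gA[of "\<lambda>_. 1"] by simp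
  have gAc: "integrable M (\<lambda>\<omega>. g \<omega> * indicator (A j) (X j \<omega>) * cos (\<theta> \<omega>))"
    and gAs: "integrable M (\<lambda>\<omega>. g \<omega> * indicator (A j) (X j \<omega>) * sin (\<theta> \<omega>))"
    by (rule gA; simp)+
  have c: "(LINT \<omega>|M. g \<omega> * indicator (A j) (X j \<omega>) * cos (\<theta> \<omega>)) = m * p * q * measure \<gamma> (A j)"
  proof -
    have "(LINT \<omega>|M. (g \<omega> * (1 + cos (\<theta> \<omega>))) * indicator (A j) (X j \<omega>)) =
        (LINT \<omega>|M. g \<omega> * indicator (A j) (X j \<omega>) + g \<omega> * indicator (A j) (X j \<omega>) * cos (\<theta> \<omega>))"
      by (intro Bochner_Integration.integral_cong refl) (simp add: algebra_simps)
    also have "\<dots> = (LINT \<omega>|M. g \<omega> * indicator (A j) (X j \<omega>)) +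
        (LINT \<omega>|M. g \<omega> * indicator (A j) (X j \<omega>) * cos (\<theta> \<omega>))"
      by (rule Bochner_Integration.integral_add[OF gA1 gAc])
    finally show ?thesis unfolding w1 w0 by (simp add: algebra_simps)
  qed
  have s: "(LINT \<omega>|M. g \<omega> * indicator (A j) (X j \<omega>) * sin (\<theta> \<omega>)) = 0"
  proof -
    have "(LINT \<omega>|M. (g \<omega> * (1 + sin (\<theta> \<omega>))) * indicator (A j) (X j \<omega>)) =
        (LINT \<omega>|M. g \<omega> * indicator (A j) (X j \<omega>) + g \<omega> * indicator (A j) (X j \<omega>) * sin (\<theta> \<omega>))"
      by (intro Bochner_Integration.integral_cong refl) (simp add: algebra_simps)
    also have "\<dots> = (LINT \<omega>|M. g \<omega> * indicator (A j) (X j \<omega>)) +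
        (LINT \<omega>|M. g \<omega> * indicator (A j) (X j \<omega>) * sin (\<theta> \<omega>))"
      by (rule Bochner_Integration.integral_add[OF gA1 gAs])
    finally show ?thesis unfolding w2 w0 by (simp add: algebra_simps)
  qed
  have "(CLINT \<omega>|M. (\<Prod>k\<in>insert j J. indicator (A k) (X k \<omega>)) *\<^sub>R cis (\<theta> \<omega>)) =
      (CLINT \<omega>|M. complex_of_real (g \<omega> * indicator (A j) (X j \<omega>) * cos (\<theta> \<omega>)) +
        \<i> * complex_of_real (g \<omega> * indicator (A j) (X j \<omega>) * sin (\<theta> \<omega>)))"
  proof (intro Bochner_Integration.integral_cong refl)
    fix \<omega>
    have "(\<Prod>k\<in>insert j J. indicator (A k) (X k \<omega>)) = g \<omega> * indicator (A j) (X j \<omega>)"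
      using jL insert.hyps by (simp add: g_def mult.commute)
    then show "(\<Prod>k\<in>insert j J. indicator (A k) (X k \<omega>)) *\<^sub>R cis (\<theta> \<omega>) =
        complex_of_real (g \<omega> * indicator (A j) (X j \<omega>) * cos (\<theta> \<omega>)) +
        \<i> * complex_of_real (g \<omega> * indicator (A j) (X j \<omega>) * sin (\<theta> \<omega>))"
      by (simp only:) (simp add: complex_eq_iff)
  qed
  also have "\<dots> = complex_of_real (m * p * q * measure \<gamma> (A j))"
    using gAc gAs c s
    by (subst Bochner_Integration.integral_add) (auto simp del: of_real_mult)
  finally show ?case
    using insert by (simp add: \<theta>_def p_def q_def mult.commute mult.left_commute)
qed

section \<open>Standard Gaussian laws on Euclidean spaces and their finite products\<close>

definition std_gauss :: "'b::euclidean_space measure" where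
  "std_gauss = density lborel (\<lambda>x. \<Prod>b\<in>Basis. ennreal (std_normal_density (x \<bullet> b)))"

lemma sets_std_gauss [simp, measurable_cong]: "sets std_gauss = sets borel"
  by (simp add: std_gauss_def)

lemma space_std_gauss [simp]: "space std_gauss = UNIV"
  by (simp add: std_gauss_def)

lemma prob_space_std_normal: "prob_space std_normal_distribution"
  using real_dist_normal_dist by (simp add: real_distribution_def)

lemma emeasure_std_gauss_box:
  assumes [measurable]: "\<And>b. A b \<in> sets borel"
  shows "emeasure (std_gauss :: 'b::euclidean_space measure) {x. \<forall>b\<in>Basis. x \<bullet> b \<in> A b} =
    ennreal (\<Prod>b\<in>(Basis::'b set). measure std_normal_distribution (A b))"
proof -
  have "emeasure (std_gauss :: 'b measure) {x. \<forall>b\<in>Basis. x \<bullet> b \<in> A b} =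
      (\<integral>\<^sup>+x. (\<Prod>b\<in>(Basis::'b set). ennreal (std_normal_density (x \<bullet> b)) * indicator (A b) (x \<bullet> b)) \<partial>lborel)"
    unfolding std_gauss_def
    by (subst emeasure_density) (auto intro!: nn_integral_cong simp: prod.distrib indicator_def)
  also have "\<dots> = (\<Prod>b\<in>(Basis::'b set). \<integral>\<^sup>+y. ennreal (std_normal_density y) * indicator (A b) y \<partial>lborel)"
    by (rule nn_integral_lborel_prod) auto
  also have "\<dots> = (\<Prod>b\<in>(Basis::'b set). emeasure std_normal_distribution (A b))"
    by (simp add: emeasure_density)
  also have "\<dots> = (\<Prod>b\<in>(Basis::'b set). ennreal (measure std_normal_distribution (A b)))"
    using prob_space_std_normal
    by (simp add: finite_measure.emeasure_eq_measure prob_space_def)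
  also have "\<dots> = ennreal (\<Prod>b\<in>(Basis::'b set). measure std_normal_distribution (A b))"
    by (simp add: prod_ennreal)
  finally show ?thesis .
qed

lemma prob_space_std_gauss: "prob_space (std_gauss :: 'b::euclidean_space measure)"
proof
  have "measure std_normal_distribution UNIV = 1"
    using prob_space.prob_space[OF prob_space_std_normal] by simp
  then show "emeasure (std_gauss :: 'b measure) (space std_gauss) = 1"
    using emeasure_std_gauss_box[where 'b='b, of "\<lambda>_. UNIV"] by simp
qed

interpretation std_gauss: prob_space std_gauss
  by (rule prob_space_std_gauss)

text \<open>Open boxes are stable under intersection and generate the Borel sets, and the centred
  cubes exhaust the space with finite measure.\<close>

lemma measure_scaleI_box:
  fixes N \<gamma> :: "'b::euclidean_space measure"
  assumes fN: "finite_measure N" and sN: "sets N = sets borel" and s\<gamma>: "sets \<gamma> = sets borel"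
    and m: "0 \<le> m"
    and box: "\<And>a b. emeasure N (box a b) = ennreal m * emeasure \<gamma> (box a b)"
    and A: "A \<in> sets borel"
  shows "emeasure N A = ennreal m * emeasure \<gamma> A"
proof -
  interpret finite_measure N by fact
  let ?E = "range (\<lambda>(a, b). box a b :: 'b set)"
  have eq: "emeasure (density \<gamma> (\<lambda>_. ennreal m)) B = ennreal m * emeasure \<gamma> B" if "B \<in> sets borel" for B
    using that by (simp add: emeasure_density_const s\<gamma>)
  have "N = density \<gamma> (\<lambda>_. ennreal m)"
  proof (rule measure_eqI_generator_eq)
    show "Int_stable ?E"
      by (auto simp: Int_stable_def box_Int_box)
    show "?E \<subseteq> Pow UNIV" by auto
    show "sets N = sigma_sets UNIV ?E" "sets (density \<gamma> (\<lambda>_. ennreal m)) = sigma_sets UNIV ?E"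
      by (simp_all add: borel_eq_box sN s\<gamma>)
    show "emeasure N X = emeasure (density \<gamma> (\<lambda>_. ennreal m)) X" if "X \<in> ?E" for X
      using that by (auto simp: eq box)
    show "range (\<lambda>n::nat. box (- (real n *\<^sub>R One)) (real n *\<^sub>R One) :: 'b set) \<subseteq> ?E" by auto
    show "(\<Union>n::nat. box (- (real n *\<^sub>R One)) (real n *\<^sub>R One) :: 'b set) = UNIV"
      by (rule UN_box_eq_UNIV)
    show "emeasure N (box (- (real n *\<^sub>R One)) (real n *\<^sub>R One)) \<noteq> \<infinity>" for n
      by simp
  qed
  then show ?thesis using eq[OF A] by simp
qed

text \<open>\<open>char_determined_joint\<close> is applied to the coordinates of a single vector,
  with no exponentials left over. The values it yields on products of coordinate sets cover the open
  boxes, which determine the measure.\<close>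

lemma char_determined_std_gauss:
  "char_determined (std_gauss :: 'b::euclidean_space measure) (\<lambda>c. exp (- (norm c)\<^sup>2 / 2))"
  unfolding char_determined_def
proof (intro allI impI ballI, elim conjE)
  fix N :: "'b measure" and m :: real and A :: "'b set"
  assume fin: "finite_measure N" and sN [measurable_cong]: "sets N = sets borel"
    and ch: "\<forall>c. (CLINT x|N. cis (c \<bullet> x)) = complex_of_real (m * exp (- (norm c)\<^sup>2 / 2))"
    and A: "A \<in> sets borel"
  interpret finite_measure N by fact
  have space_N: "space N = UNIV" using sN sets_eq_imp_space_eq by fastforce
  have m: "m = measure N UNIV"
  proof -
    have "complex_of_real (measure N UNIV) = complex_of_real m"
      using ch[rule_format, of 0] by (simp add: space_N scaleR_conv_of_real)
    then show ?thesis by (simp only: of_real_eq_iff)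
  qed
  then have m0: "0 \<le> m" by simp
  have coords: "measure N {x. \<forall>b\<in>Basis. x \<bullet> b \<in> D b} =
      m * (\<Prod>b\<in>(Basis::'b set). measure std_normal_distribution (D b))"
    if D [measurable]: "\<And>b. D b \<in> sets borel" for D :: "'b \<Rightarrow> real set"
  proof -
    have ch': "(CLINT x|N. cis (\<Sum>b\<in>Basis \<union> {}. c b \<bullet> (x \<bullet> b))) =
        complex_of_real (m * (\<Prod>b\<in>Basis \<union> {}. exp (- (norm (c b))\<^sup>2 / 2)))" for c :: "'b \<Rightarrow> real"
    proof -
      let ?c = "\<Sum>b\<in>Basis. c b *\<^sub>R b"
      have "(\<Sum>b\<in>Basis. c b \<bullet> (x \<bullet> b)) = ?c \<bullet> x" for x
        by (simp only: inner_sum_left inner_scaleR_left inner_real_def inner_commute[of x])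
      moreover have "(\<Prod>b\<in>Basis. exp (- (norm (c b))\<^sup>2 / 2)) = exp (- (norm ?c)\<^sup>2 / 2)"
        by (subst norm_eq_sqrt_inner, subst euclidean_inner)
          (simp add: exp_sum[symmetric] sum_nonneg power2_eq_square sum_negf sum_divide_distrib
            inner_sum_left_Basis)
      ultimately show ?thesis using ch by simp
    qed
    have "(CLINT x|N. (\<Prod>b\<in>(Basis::'b set). indicator (D b) (x \<bullet> b)) *\<^sub>R cis (\<Sum>b\<in>{}. 0 \<bullet> (x \<bullet> b))) =
      complex_of_real (m * (\<Prod>b\<in>(Basis::'b set). measure std_normal_distribution (D b)) *
        (\<Prod>b\<in>({}::'b set). exp (- (norm (0::real))\<^sup>2 / 2)))"
      by (rule char_determined_joint[where c = "\<lambda>_. 0" and L = "{}" and J = Basis and m = m and M = N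
            and X = "\<lambda>b x. x \<bullet> b" and A = D, OF char_determined_std_normal])
        (use fin ch' in simp_all)
    then have "(CLINT x|N. complex_of_real (\<Prod>b\<in>(Basis::'b set). indicator (D b) (x \<bullet> b))) =
        complex_of_real (m * (\<Prod>b\<in>(Basis::'b set). measure std_normal_distribution (D b)))"
      by (simp add: scaleR_conv_of_real)
    moreover have "(\<Prod>b\<in>(Basis::'b set). indicator (D b) (x \<bullet> b)) =
        (indicator {x. \<forall>b\<in>Basis. x \<bullet> b \<in> D b} x :: real)" for x :: 'b
      by (auto simp: indicator_def)
    ultimately have "complex_of_real (LINT x|N. indicator {x. \<forall>b\<in>Basis. x \<bullet> b \<in> D b} x) =
        complex_of_real (m * (\<Prod>b\<in>(Basis::'b set). measure std_normal_distribution (D b)))"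
      by (simp only: integral_complex_of_real)
    then show ?thesis by (simp only: of_real_eq_iff) (simp add: space_N)
  qed
  have "emeasure N (box a b) = ennreal m * emeasure std_gauss (box a b)" for a b
  proof -
    have eq: "box a b = {x. \<forall>i\<in>Basis. x \<bullet> i \<in> {a \<bullet> i <..< b \<bullet> i}}"
      by (auto simp: box_def)
    show ?thesis
      unfolding eq emeasure_eq_measure
      by (subst coords, simp, subst emeasure_std_gauss_box, simp) (simp add: ennreal_mult' m0)
  qed
  then have "emeasure N A = ennreal m * emeasure std_gauss A"
    by (intro measure_scaleI_box[OF fin sN _ m0 _ A]) auto
  then show "measure N A = m * measure std_gauss A"
    by (simp add: emeasure_eq_measure std_gauss.emeasure_eq_measure ennreal_mult'[symmetric] m0)
qed

text \<open>The second use of \<open>char_determined_joint\<close>, with vectors in place of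
  coordinates. Both uses are possible because that lemma takes an abstract pair of a law and a
  characteristic function.\<close>

theorem std_gauss_lawI:
  fixes W :: "'k \<Rightarrow> 'a \<Rightarrow> 'b::euclidean_space"
  assumes prob: "prob_space M" and I: "finite I" and W [measurable]: "\<And>k. k \<in> I \<Longrightarrow> W k \<in> borel_measurable M"
    and ch: "\<And>d. (CLINT \<omega>|M. cis (\<Sum>k\<in>I. d k \<bullet> W k \<omega>)) =
        complex_of_real (\<Prod>k\<in>I. exp (- (norm (d k))\<^sup>2 / 2))"
  shows "distr M (Pi\<^sub>M I (\<lambda>_. borel)) (\<lambda>\<omega>. \<lambda>k\<in>I. W k \<omega>) = Pi\<^sub>M I (\<lambda>_. std_gauss)"
proof -
  interpret prob_space M by fact
  interpret product_sigma_finite "\<lambda>_::'k. std_gauss :: 'b measure"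
    by standard
  \<comment> \<open>The joint lemma quantifies over all indices, so \<open>X\<close> and, below,
    \<open>D\<close> extend \<open>W\<close> and \<open>A\<close> measurably beyond
    \<open>I\<close>.\<close>
  define X where "X k = (if k \<in> I then W k else (\<lambda>_. 0))" for k
  have [measurable]: "X k \<in> borel_measurable M" for k by (simp add: X_def)
  show ?thesis
  proof (rule PiM_eqI)
    show "finite I" by fact
    show "sets (distr M (Pi\<^sub>M I (\<lambda>_. borel)) (\<lambda>\<omega>. \<lambda>k\<in>I. W k \<omega>)) = sets (Pi\<^sub>M I (\<lambda>_. std_gauss))"
      by (simp, rule sets_PiM_cong) auto
    fix A :: "'k \<Rightarrow> 'b set"
    assume "\<And>k. k \<in> I \<Longrightarrow> A k \<in> sets std_gauss"
    then have A [measurable]: "\<And>k. k \<in> I \<Longrightarrow> A k \<in> sets borel" by simp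
    define D where "D k = (if k \<in> I then A k else {})" for k
    have D [measurable]: "D k \<in> sets borel" for k by (simp add: D_def)
    have ch': "(CLINT \<omega>|M. cis (\<Sum>k\<in>I \<union> {}. c k \<bullet> X k \<omega>)) =
        complex_of_real (1 * (\<Prod>k\<in>I \<union> {}. exp (- (norm (c k))\<^sup>2 / 2)))" for c
      using ch[of c] by (simp add: X_def cong: sum.cong)
    have "(CLINT \<omega>|M. (\<Prod>k\<in>I. indicator (D k) (X k \<omega>)) *\<^sub>R cis (\<Sum>k\<in>{}. 0 \<bullet> X k \<omega>)) =
      complex_of_real (1 * (\<Prod>k\<in>I. measure std_gauss (D k)) * (\<Prod>k\<in>({}::'k set). exp (- (norm (0::'b))\<^sup>2 / 2)))"
      by (rule char_determined_joint[where c = "\<lambda>_. 0" and L = "{}" and J = I and m = 1 and M = M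
            and X = X and A = D, OF char_determined_std_gauss])
        (use ch' I finite_measure_axioms in simp_all)
    then have "(CLINT \<omega>|M. complex_of_real (\<Prod>k\<in>I. indicator (D k) (X k \<omega>))) =
        complex_of_real (\<Prod>k\<in>I. measure std_gauss (D k))"
      by (simp add: scaleR_conv_of_real)
    moreover have "(\<Prod>k\<in>I. indicator (D k) (X k \<omega>)) =
        (indicator {\<omega>. \<forall>k\<in>I. W k \<omega> \<in> A k} \<omega> :: real)" for \<omega>
      using I by (auto simp: indicator_def X_def D_def)
    ultimately have "complex_of_real (LINT \<omega>|M. indicator {\<omega>. \<forall>k\<in>I. W k \<omega> \<in> A k} \<omega>) =
        complex_of_real (\<Prod>k\<in>I. measure std_gauss (D k))"
      by (simp only: integral_complex_of_real)
    then have meas: "measure M ({\<omega>. \<forall>k\<in>I. W k \<omega> \<in> A k} \<inter> space M) = (\<Prod>k\<in>I. measure std_gauss (D k))"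
      by (simp only: of_real_eq_iff) simp
    have "(\<lambda>\<omega>. \<lambda>k\<in>I. W k \<omega>) -` Pi\<^sub>E I A \<inter> space M = {\<omega>. \<forall>k\<in>I. W k \<omega> \<in> A k} \<inter> space M"
      by (auto simp: PiE_iff)
    then have "emeasure (distr M (Pi\<^sub>M I (\<lambda>_. borel)) (\<lambda>\<omega>. \<lambda>k\<in>I. W k \<omega>)) (Pi\<^sub>E I A) =
        emeasure M ({\<omega>. \<forall>k\<in>I. W k \<omega> \<in> A k} \<inter> space M)"
      using I by (subst emeasure_distr) (auto intro!: measurable_restrict sets_PiM_I_finite)
    also have "\<dots> = ennreal (\<Prod>k\<in>I. measure std_gauss (A k))"
      by (simp add: emeasure_eq_measure meas D_def)
    also have "\<dots> = (\<Prod>k\<in>I. emeasure std_gauss (A k))"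
      by (simp add: std_gauss.emeasure_eq_measure prod_ennreal)
    finally show "emeasure (distr M (Pi\<^sub>M I (\<lambda>_. borel)) (\<lambda>\<omega>. \<lambda>k\<in>I. W k \<omega>)) (Pi\<^sub>E I A) =
        (\<Prod>k\<in>I. emeasure std_gauss (A k))" .
  qed
qed

section \<open>Linear changes of variables\<close>

lemma nn_integral_lborel_minus:
  fixes g :: "'b::euclidean_space \<Rightarrow> ennreal"
  assumes [measurable]: "g \<in> borel_measurable borel"
  shows "(\<integral>\<^sup>+y. g (y - a) \<partial>lborel) = (\<integral>\<^sup>+y. g y \<partial>lborel)"
  by (subst (2) lborel_distr_plus[of "- a", symmetric]) (simp add: nn_integral_distr)

lemma borel_measurable_matrix_vector_mult [measurable]:
  "(*v) (P :: real^'m^'k) \<in> borel_measurable borel"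
  by (intro borel_measurable_continuous_onI linear_continuous_on) simp

text \<open>By Fubini: with the coordinates other than \<open>b\<close> fixed, the shear translates
  coordinate \<open>b\<close> by an amount that does not involve it, because \<open>a\<close> and
  \<open>b\<close> differ.\<close>

lemma nn_integral_lborel_shear:
  fixes h :: "'b::euclidean_space \<Rightarrow> ennreal"
  assumes a: "a \<in> Basis" and b: "b \<in> Basis" and ab: "a \<noteq> b" and [measurable]: "h \<in> borel_measurable borel"
  shows "(\<integral>\<^sup>+v. h (v + (v \<bullet> a) *\<^sub>R b) \<partial>lborel) = (\<integral>\<^sup>+v. h v \<partial>lborel)"
proof -
  interpret product_sigma_finite "\<lambda>_::'b. lborel :: real measure"
    by standard
  define I where "I = Basis - {b}"
  have I: "finite I" "b \<notin> I" "a \<in> I" and ins: "(Basis :: 'b set) = insert b I"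
    using a b ab by (auto simp: I_def)
  have slice: "(\<integral>\<^sup>+v. g v \<partial>lborel) =
      (\<integral>\<^sup>+f. \<integral>\<^sup>+y. g ((\<Sum>c\<in>I. f c *\<^sub>R c) + y *\<^sub>R b) \<partial>lborel \<partial>(Pi\<^sub>M I (\<lambda>_. lborel)))"
    if [measurable]: "g \<in> borel_measurable borel" for g :: "'b \<Rightarrow> ennreal"
  proof -
    have "(\<integral>\<^sup>+v. g v \<partial>lborel) = (\<integral>\<^sup>+f. g (\<Sum>c\<in>insert b I. f c *\<^sub>R c) \<partial>(Pi\<^sub>M (insert b I) (\<lambda>_. lborel)))"
      by (subst lborel_eq) (simp add: nn_integral_distr ins)
    also have "\<dots> = (\<integral>\<^sup>+f. \<integral>\<^sup>+y. g (\<Sum>c\<in>insert b I. (f(b := y)) c *\<^sub>R c) \<partial>lborel \<partial>(Pi\<^sub>M I (\<lambda>_. lborel)))"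
      by (rule product_nn_integral_insert[OF I(1,2)]) simp
    also have "(\<lambda>f y. \<Sum>c\<in>insert b I. (f(b := y)) c *\<^sub>R c) = (\<lambda>f y. (\<Sum>c\<in>I. f c *\<^sub>R c) + y *\<^sub>R b)"
      using I by (intro ext) (auto simp: add.commute intro!: sum.cong)
    finally show ?thesis .
  qed
  have inner_a: "((\<Sum>c\<in>I. f c *\<^sub>R c) + y *\<^sub>R b) \<bullet> a = f a" for f y
    using a b ab I by (simp add: inner_add_left inner_sum_left inner_Basis I_def if_distrib cong: if_cong)
  have "(\<integral>\<^sup>+v. h (v + (v \<bullet> a) *\<^sub>R b) \<partial>lborel) =
      (\<integral>\<^sup>+f. \<integral>\<^sup>+y. h ((\<Sum>c\<in>I. f c *\<^sub>R c) + (y - (- f a)) *\<^sub>R b) \<partial>lborel \<partial>(Pi\<^sub>M I (\<lambda>_. lborel)))"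
    by (subst slice, simp, simp only: inner_a) (simp add: algebra_simps)
  also have "\<dots> = (\<integral>\<^sup>+f. \<integral>\<^sup>+y. h ((\<Sum>c\<in>I. f c *\<^sub>R c) + y *\<^sub>R b) \<partial>lborel \<partial>(Pi\<^sub>M I (\<lambda>_. lborel)))"
    by (intro nn_integral_cong nn_integral_lborel_minus) simp
  also have "\<dots> = (\<integral>\<^sup>+v. h v \<partial>lborel)"
    by (rule slice[symmetric]) simp
  finally show ?thesis .
qed

text \<open>Swapping two coordinates is a self-adjoint involution that permutes the basis, so it
  maps boxes to boxes of the same volume.\<close>

lemma nn_integral_lborel_transpose:
  fixes h :: "real^'m \<Rightarrow> ennreal"
  assumes [measurable]: "h \<in> borel_measurable borel"
  shows "(\<integral>\<^sup>+v. h (\<chi> i. v $ Transposition.transpose k l i) \<partial>lborel) = (\<integral>\<^sup>+v. h v \<partial>lborel)"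
proof -
  define T :: "real^'m \<Rightarrow> real^'m" where "T v = (\<chi> i. v $ Transposition.transpose k l i)" for v
  have TT: "T (T v) = v" for v by (simp add: T_def vec_eq_iff)
  have TB: "T b \<in> Basis" if b: "b \<in> Basis" for b
  proof -
    obtain i where i: "b = axis i 1" using b by (auto simp: Basis_vec_def)
    have "T b = axis (Transposition.transpose k l i) 1"
      by (auto simp: i T_def vec_eq_iff axis_def Transposition.transpose_def)
    then show ?thesis by (auto simp: Basis_vec_def)
  qed
  have adj: "T u \<bullet> v = u \<bullet> T v" for u v
    unfolding T_def inner_vec_def
    by (simp, rule sum.reindex_bij_witness[of _ "Transposition.transpose k l" "Transposition.transpose k l"]) auto
  have lin: "linear T" by (rule linearI) (auto simp: T_def vec_eq_iff)
  then have [measurable]: "T \<in> borel_measurable borel"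
    by (intro borel_measurable_continuous_onI linear_continuous_on) (simp add: linear_conv_bounded_linear)
  have "lborel = distr lborel borel T"
  proof (rule lborel_eqI)
    fix l u :: "real^'m"
    assume lu: "\<And>b. b \<in> Basis \<Longrightarrow> l \<bullet> b \<le> u \<bullet> b"
    have "T -` box l u = box (T l) (T u)"
    proof -
      have "(\<forall>b\<in>Basis. l \<bullet> b < T x \<bullet> b \<and> T x \<bullet> b < u \<bullet> b) \<longleftrightarrow>
          (\<forall>b\<in>Basis. T l \<bullet> b < x \<bullet> b \<and> x \<bullet> b < T u \<bullet> b)" for x
        unfolding adj by (metis TB TT)
      then show ?thesis by (auto simp: box_def)
    qed
    then have "emeasure (distr lborel borel T) (box l u) = emeasure lborel (box (T l) (T u))"
      by (simp add: emeasure_distr)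
    also have "\<dots> = (\<Prod>b\<in>Basis. (T u - T l) \<bullet> b)"
      using lu TB by (simp add: emeasure_lborel_box_eq adj inner_diff_left)
    also have "(\<Prod>b\<in>Basis. (T u - T l) \<bullet> b) = (\<Prod>b\<in>Basis. (u - l) \<bullet> b)"
      by (rule prod.reindex_bij_witness[of _ T T]) (auto simp: TT TB adj inner_diff_left)
    finally show "emeasure (distr lborel borel T) (box l u) = ennreal (\<Prod>b\<in>Basis. (u - l) \<bullet> b)" .
  qed simp
  then have "(\<integral>\<^sup>+v. h v \<partial>lborel) = (\<integral>\<^sup>+v. h v \<partial>(distr lborel borel T))" by simp
  then show ?thesis by (simp add: nn_integral_distr T_def)
qed

text \<open>\<^theory>\<open>HOL-Analysis.Change_Of_Vars\<close> has the linear change of variables only for index types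
  of class \<^class>\<open>wellorder\<close>.\<close>

theorem nn_integral_lborel_matrix:
  fixes P :: "real^'m^'m"
  shows "det P \<noteq> 0 \<Longrightarrow> h \<in> borel_measurable borel \<Longrightarrow>
    (\<integral>\<^sup>+y. ennreal \<bar>det P\<bar> * h (P *v y) \<partial>lborel) = (\<integral>\<^sup>+y. h y \<partial>lborel)"
proof (induction P arbitrary: h rule: induct_matrix_elementary_alt)
  case (1 A B)
  note [measurable] = 1(4)
  have A: "det A \<noteq> 0" and B: "det B \<noteq> 0" using 1(3) by (auto simp: det_mul)
  have "(\<integral>\<^sup>+y. ennreal \<bar>det (A ** B)\<bar> * h (A ** B *v y) \<partial>lborel) =
      (\<integral>\<^sup>+y. ennreal \<bar>det B\<bar> * (ennreal \<bar>det A\<bar> * h (A *v (B *v y))) \<partial>lborel)"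
    by (simp add: det_mul abs_mult ennreal_mult matrix_vector_mul_assoc mult_ac)
  also have "\<dots> = (\<integral>\<^sup>+y. ennreal \<bar>det A\<bar> * h (A *v y) \<partial>lborel)"
    by (rule 1(2)[OF B]) simp
  also have "\<dots> = (\<integral>\<^sup>+y. h y \<partial>lborel)"
    by (rule 1(1)[OF A]) simp
  finally show ?case .
next
  case (2 A i)
  then show ?case using det_zero_row(2)[of i A] by (simp add: row_def vec_eq_iff)
next
  case (3 A)
  note [measurable] = 3(3)
  have det: "det A = (\<Prod>i\<in>UNIV. A $ i $ i)" by (rule det_diagonal) (use 3(1) in auto)
  then have nz: "A $ i $ i \<noteq> 0" for i using 3(2) by simp
  \<comment> \<open>The diagonal entries, indexed by basis vectors as the affine substitution rule
    expects them.\<close>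
  define c :: "real^'m \<Rightarrow> real" where "c b = b \<bullet> (A *v b)" for b
  have c_axis: "c (axis i 1) = A $ i $ i" for i
    by (simp add: c_def inner_axis' matrix_vector_mult_basis column_def)
  have prodc: "(\<Prod>b\<in>Basis. \<bar>c b\<bar>) = \<bar>det A\<bar>"
  proof -
    have "(\<Prod>b\<in>Basis. \<bar>c b\<bar>) = (\<Prod>i\<in>UNIV. \<bar>c (axis i 1)\<bar>)"
      by (rule prod.reindex_cong[of "\<lambda>i. axis i 1"])
        (auto simp: Basis_vec_def inj_on_def axis_eq_axis)
    then show ?thesis by (simp add: det c_axis abs_prod)
  qed
  have T: "0 + (\<Sum>j\<in>Basis. (c j * (x \<bullet> j)) *\<^sub>R j) = A *v x" for x
  proof -
    have "(\<Sum>j\<in>Basis. (c j * (x \<bullet> j)) *\<^sub>R j) = (\<Sum>i\<in>UNIV. (c (axis i 1) * (x \<bullet> axis i 1)) *\<^sub>R axis i 1)"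
      by (rule sum.reindex_cong[of "\<lambda>i. axis i 1"])
        (auto simp: Basis_vec_def inj_on_def axis_eq_axis)
    also have "\<dots> = A *v x"
    proof (rule vec_eq_iff[THEN iffD2], rule allI)
      fix k
      have "(A *v x) $ k = (\<Sum>j\<in>UNIV. A $ k $ j * x $ j)"
        by (simp add: matrix_vector_mult_def)
      also have "\<dots> = (\<Sum>j\<in>UNIV. if j = k then A $ k $ k * x $ k else 0)"
        by (intro sum.cong) (use 3(1) in auto)
      finally show "(\<Sum>i\<in>UNIV. (c (axis i 1) * (x \<bullet> axis i 1)) *\<^sub>R axis i 1) $ k = (A *v x) $ k"
        by (simp add: c_axis inner_axis) (simp add: axis_def if_distrib cong: if_cong)
    qed
    finally show ?thesis by simp
  qed
  have "lborel = density (distr lborel borel (\<lambda>x. 0 + (\<Sum>j\<in>Basis. (c j * (x \<bullet> j)) *\<^sub>R j)))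
      (\<lambda>_. ennreal (\<Prod>j\<in>Basis. \<bar>c j\<bar>))"
    by (rule lborel_affine_euclidean) (use nz in \<open>auto simp: Basis_vec_def c_axis\<close>)
  then have eq: "lborel = density (distr lborel borel ((*v) A)) (\<lambda>_. ennreal \<bar>det A\<bar>)"
    unfolding T prodc .
  show ?case
    by (subst (2) eq) (simp add: nn_integral_density nn_integral_distr)
next
  case (4 k l)
  let ?P = "\<chi> i j. (mat 1 :: real^'m^'m) $ i $ Transposition.transpose k l j"
  have mult: "?P *v y = (\<chi> i. y $ Transposition.transpose k l i)" for y
  proof -
    have "(\<Sum>j\<in>UNIV. (if i = Transposition.transpose k l j then 1 else 0) * y $ j) =
        (\<Sum>j\<in>UNIV. if j = Transposition.transpose k l i then y $ j else 0)" for i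
      by (intro sum.cong) (auto simp: Transposition.transpose_def)
    then show ?thesis by (simp add: vec_eq_iff matrix_vector_mult_def mat_def)
  qed
  have "\<bar>det ?P\<bar> = 1"
    using det_permute_columns[OF permutes_swap_id[of k UNIV l], of "mat 1 :: real^'m^'m"]
    by (simp add: sign_swap_id)
  then show ?case using 4 nn_integral_lborel_transpose[of h k l] by (simp add: mult)
next
  case (5 k l)
  let ?P = "\<chi> i j. (of_bool (i = k \<and> j = l \<or> i = j) :: real)"
  have mult: "?P *v y = y + (y \<bullet> axis l 1) *\<^sub>R axis k 1" for y :: "real^'m"
  proof -
    have "(\<Sum>j\<in>UNIV. of_bool (i = k \<and> j = l \<or> i = j) * y $ j) =
        (\<Sum>j\<in>UNIV. if j = i then y $ j else 0) + (\<Sum>j\<in>UNIV. if j = l then (if i = k then y $ j else 0) else 0)" for i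
      unfolding sum.distrib[symmetric] by (intro sum.cong) (use 5(1) in auto)
    then show ?thesis by (simp add: vec_eq_iff matrix_vector_mult_def inner_axis) (simp add: axis_def)
  qed
  have "det ?P = det (\<chi> i. if i = k then row k (mat 1) + 1 *s row l (mat 1) else row i (mat 1) :: real^'m^'m)"
    by (rule arg_cong[of _ _ det]) (use 5(1) in \<open>auto simp: vec_eq_iff row_def mat_def\<close>)
  also have "\<dots> = 1"
    by (subst det_row_operation[OF 5(1)]) simp
  finally have det: "det ?P = 1" .
  show ?case
    unfolding mult det
    using 5 nn_integral_lborel_shear[of "axis l 1 :: real^'m" "axis k 1" h]
    by (simp add: axis_eq_axis)
qed

text \<open>Integration begins at the smallest index: with the later coordinates fixed,
  \<open>x k\<close> occurs only in the factor \<open>g k\<close>, and there only up to a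
  translation. In effect the map from samples to residuals is unitriangular and preserves Lebesgue
  measure. Index \<open>n\<close> carries the constant \<open>z\<close>, which only the last factor
  sees.\<close>

lemma nn_integral_PiM_innovations:
  fixes g :: "nat \<Rightarrow> 'b::euclidean_space \<Rightarrow> ennreal" and r :: "nat \<Rightarrow> real"
  assumes g [measurable]: "\<And>i. g i \<in> borel_measurable borel" and k: "k \<le> n"
  shows "(\<integral>\<^sup>+x. (\<Prod>i\<in>{k..<n}. g i (x i - r i *\<^sub>R (x(n := z)) (Suc i))) \<partial>(\<Pi>\<^sub>M i\<in>{k..<n}. lborel)) =
    (\<Prod>i\<in>{k..<n}. \<integral>\<^sup>+y. g i y \<partial>lborel)"
  using k
proof (induction k rule: inc_induct)
  case base
  interpret product_sigma_finite "\<lambda>_::nat. lborel :: 'b measure"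
    by standard
  show ?case by (simp add: PiM_empty)
next
  case (step k)
  interpret product_sigma_finite "\<lambda>_::nat. lborel :: 'b measure"
    by standard
  have ins: "{k..<n} = insert k {Suc k..<n}" using step by auto
  have meas: "(\<lambda>x. \<Prod>i\<in>K. g i (x i - r i *\<^sub>R (x(n := z)) (Suc i))) \<in> borel_measurable (Pi\<^sub>M {j..<n} (\<lambda>_. lborel))"
    if "K \<subseteq> {j..<n}" for K j
  proof (rule borel_measurable_prod_ennreal)
    fix i assume "i \<in> K"
    then have i [measurable]: "i \<in> {j..<n}" using that by auto
    show "(\<lambda>x. g i (x i - r i *\<^sub>R (x(n := z)) (Suc i))) \<in> borel_measurable (Pi\<^sub>M {j..<n} (\<lambda>_. lborel))"
    proof (cases "Suc i = n")
      case True
      then show ?thesis by simp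
    next
      case False
      then have [measurable]: "Suc i \<in> {j..<n}" using i by auto
      show ?thesis using False by simp
    qed
  qed
  have "(\<integral>\<^sup>+x. (\<Prod>i\<in>{k..<n}. g i (x i - r i *\<^sub>R (x(n := z)) (Suc i))) \<partial>(\<Pi>\<^sub>M i\<in>{k..<n}. lborel)) =
      (\<integral>\<^sup>+x. \<integral>\<^sup>+y. (\<Prod>i\<in>insert k {Suc k..<n}. g i ((x(k := y)) i - r i *\<^sub>R (x(k := y, n := z)) (Suc i))) \<partial>lborel
        \<partial>(\<Pi>\<^sub>M i\<in>{Suc k..<n}. lborel))"
    unfolding ins by (rule product_nn_integral_insert) (use meas[of "insert k {Suc k..<n}" k] ins in auto)
  also have "\<dots> = (\<integral>\<^sup>+x. (\<integral>\<^sup>+y. g k (y - r k *\<^sub>R (x(n := z)) (Suc k)) *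
        (\<Prod>i\<in>{Suc k..<n}. g i (x i - r i *\<^sub>R (x(n := z)) (Suc i))) \<partial>lborel) \<partial>(\<Pi>\<^sub>M i\<in>{Suc k..<n}. lborel))"
    using step by (intro nn_integral_cong) (auto intro!: prod.cong arg_cong2[where f = "(*)"])
  also have "\<dots> = (\<integral>\<^sup>+x. (\<integral>\<^sup>+y. g k y \<partial>lborel) *
        (\<Prod>i\<in>{Suc k..<n}. g i (x i - r i *\<^sub>R (x(n := z)) (Suc i))) \<partial>(\<Pi>\<^sub>M i\<in>{Suc k..<n}. lborel))"
    by (simp add: nn_integral_multc nn_integral_lborel_minus)
  also have "\<dots> = (\<integral>\<^sup>+y. g k y \<partial>lborel) * (\<Prod>i\<in>{Suc k..<n}. \<integral>\<^sup>+y. g i y \<partial>lborel)"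
    using meas[of "{Suc k..<n}" "Suc k"] step.IH by (simp add: nn_integral_cmult)
  also have "\<dots> = (\<Prod>i\<in>{k..<n}. \<integral>\<^sup>+y. g i y \<partial>lborel)"
    unfolding ins by simp
  finally show ?case .
qed

section \<open>Residuals of a bridge sample\<close>

text \<open>The left inverse \<open>U\<close> carries the common image measure back to both
  originals. This allows the law of a sample to be checked after whitening, where it is a
  product.\<close>

lemma measure_eq_if_distr_eq:
  assumes s1: "sets N1 = sets S" and s2: "sets N2 = sets S"
    and W: "W \<in> measurable S V" and U: "U \<in> measurable V S"
    and inv: "\<And>x. x \<in> space S \<Longrightarrow> U (W x) = x"
    and eq: "distr N1 V W = distr N2 V W"
  shows "N1 = N2"
proof -
  have *: "distr (distr N V W) S U = N" if sN: "sets N = sets S" for N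
  proof -
    have sp: "space N = space S" using sets_eq_imp_space_eq[OF sN] .
    have W': "W \<in> measurable N V" using W measurable_cong_sets[OF sN refl] by blast
    have "distr (distr N V W) S U = distr N S (U \<circ> W)"
      by (rule distr_distr[OF U W'])
    also have "\<dots> = distr N N (\<lambda>x. x)"
      by (rule distr_cong) (use inv sN sp in auto)
    also have "\<dots> = N" by (rule distr_id2) simp
    finally show ?thesis .
  qed
  show ?thesis using *[OF s1] *[OF s2] eq by metis
qed

definition gauss_density :: "'b::euclidean_space \<Rightarrow> real" where
  "gauss_density y = (2 * pi) powr (- real DIM('b) / 2) * exp (- (norm y)\<^sup>2 / 2)"

lemma gauss_density_eq_prod: "gauss_density y = (\<Prod>b\<in>Basis. std_normal_density (y \<bullet> b))"
proof -
  have "(\<Prod>b\<in>Basis. std_normal_density (y \<bullet> b)) =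
      (1 / sqrt (2 * pi)) ^ DIM('a) * (\<Prod>b\<in>Basis. exp (- (y \<bullet> b)\<^sup>2 / 2))"
    by (simp add: std_normal_density_def prod_dividef power_divide)
  also have "(\<Prod>b\<in>Basis. exp (- (y \<bullet> b)\<^sup>2 / 2)) = exp (- (norm y)\<^sup>2 / 2)"
    by (subst norm_eq_sqrt_inner, subst (2) euclidean_inner)
      (simp add: exp_sum[symmetric] sum_nonneg power2_eq_square sum_negf sum_divide_distrib)
  also have "(1 / sqrt (2 * pi)) ^ DIM('a) = (2 * pi) powr (- real DIM('a) / 2)"
  proof -
    have "1 / sqrt (2 * pi) = (2 * pi) powr (- 1 / 2)"
      by (simp add: powr_minus_divide powr_half_sqrt)
    then show ?thesis by (simp only:) (simp add: powr_power)
  qed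
  finally show ?thesis by (simp add: gauss_density_def)
qed

lemma gauss_density_pos: "0 < gauss_density y"
  by (simp add: gauss_density_def)

lemma continuous_gauss_density [continuous_intros]:
  "continuous_on A f \<Longrightarrow> continuous_on A (\<lambda>x. gauss_density (f x))"
  unfolding gauss_density_def by (intro continuous_intros) auto

lemma borel_measurable_gauss_density [measurable]: "gauss_density \<in> borel_measurable borel"
  unfolding gauss_density_def by measurable

lemma std_gauss_eq_density: "std_gauss = density lborel (\<lambda>y. ennreal (gauss_density y))"
  unfolding std_gauss_def gauss_density_eq_prod by (simp add: prod_ennreal)

lemma det_scaleR: "det (c *\<^sub>R (A :: real^'m^'m)) = c ^ CARD('m) * det A"
  unfolding det_def by (simp add: sum_distrib_left prod.distrib mult_ac)

locale sampling_times =
  fixes n :: nat and t :: "nat \<Rightarrow> real" and xn :: "real^'m"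
  assumes n: "2 \<le> n"
    and t_pos: "0 < t 1"
    and t_less: "\<And>i. 1 \<le> i \<Longrightarrow> i < n \<Longrightarrow> t i < t (i + 1)"
begin

declare One_nat_def [simp del]

lemma t_less_Suc: "1 \<le> i \<Longrightarrow> i < n \<Longrightarrow> t i < t (Suc i)"
  using t_less[of i] by (simp only: Suc_eq_plus1)

lemma t_mono: "1 \<le> i \<Longrightarrow> i \<le> j \<Longrightarrow> j \<le> n \<Longrightarrow> t i \<le> t j"
proof (induction j)
  case (Suc j)
  then show ?case using t_less_Suc[of j] by (cases "i = Suc j") auto
qed simp

lemma t_gt_0: "1 \<le> i \<Longrightarrow> i \<le> n \<Longrightarrow> 0 < t i"
  using t_mono[of 1 i] t_pos by simp

text \<open>Samples are extensional on \<open>{1..<n}\<close>; the update at \<open>n\<close>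
  supplies the known vector, which only the residual with index n - 1 uses.\<close>

definition innov :: "(nat \<Rightarrow> real^'m) \<Rightarrow> nat \<Rightarrow> real^'m" where
  "innov x i = x i - (t i / t (Suc i)) *\<^sub>R (x(n := xn)) (Suc i)"

definition bscale :: "nat \<Rightarrow> real" where
  "bscale i = sqrt (t i * (t (Suc i) - t i) / t (Suc i))"

lemma bscale_pos: "1 \<le> i \<Longrightarrow> i < n \<Longrightarrow> 0 < bscale i"
  using t_gt_0[of i] t_gt_0[of "Suc i"] t_less_Suc[of i] by (simp add: bscale_def)

definition whiten :: "real^'m^'m \<Rightarrow> (nat \<Rightarrow> real^'m) \<Rightarrow> nat \<Rightarrow> real^'m" where
  "whiten Q x = (\<lambda>i\<in>{1..<n}. (1 / bscale i) *\<^sub>R (Q *v innov x i))"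

text \<open>The residual y_j divided by t_j is x_j / t_j - x_{j+1} / t_{j+1}. Summing from i to n -
  1 telescopes and recovers x_i from x_n and the residuals; for \<open>R\<close> inverse to
  \<open>Q\<close>, the vector \<open>bscale j *\<^sub>R (R *v w j)\<close> is y_j.\<close>

definition unwhiten :: "real^'m^'m \<Rightarrow> (nat \<Rightarrow> real^'m) \<Rightarrow> nat \<Rightarrow> real^'m" where
  "unwhiten R w = (\<lambda>i\<in>{1..<n}. t i *\<^sub>R
     ((1 / t n) *\<^sub>R xn + (\<Sum>j\<in>{i..<n}. (1 / t j) *\<^sub>R (bscale j *\<^sub>R (R *v w j)))))"

text \<open>Two matrices that whiten the same alpha differ by an orthogonal factor on the left,
  which changes neither the absolute determinant nor the norms; so the value depends on alpha
  alone.\<close>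

definition bridge_density :: "real^'m^'m \<Rightarrow> (nat \<Rightarrow> real^'m) \<Rightarrow> real" where
  "bridge_density Q x =
     (\<Prod>i\<in>{1..<n}. \<bar>det ((1 / bscale i) *\<^sub>R Q)\<bar> * gauss_density (((1 / bscale i) *\<^sub>R Q) *v innov x i))"

lemma unwhiten_whiten:
  assumes RQ: "R ** Q = mat 1" and x: "x \<in> extensional {1..<n}"
  shows "unwhiten R (whiten Q x) = x"
proof
  fix i
  show "unwhiten R (whiten Q x) i = x i"
  proof (cases "i \<in> {1..<n}")
    case True
    define z where "z j = (1 / t j) *\<^sub>R (x(n := xn)) j" for j
    have "(\<Sum>j\<in>{i..<n}. (1 / t j) *\<^sub>R (bscale j *\<^sub>R (R *v whiten Q x j))) = (\<Sum>j\<in>{i..<n}. z j - z (Suc j))"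
    proof (rule sum.cong[OF refl])
      fix j assume "j \<in> {i..<n}"
      then have j: "1 \<le> j" "j < n" using True by auto
      have "bscale j *\<^sub>R (R *v whiten Q x j) = innov x j"
        using j bscale_pos[of j]
        by (simp add: whiten_def matrix_vector_mult_scaleR matrix_vector_mul_assoc RQ)
      then show "(1 / t j) *\<^sub>R (bscale j *\<^sub>R (R *v whiten Q x j)) = z j - z (Suc j)"
        using j t_gt_0[of j] by (simp add: innov_def z_def scaleR_diff_right)
    qed
    also have "\<dots> = z i - z n"
      using True sum_Suc_diff'[of i n "\<lambda>j. - z j"] by simp
    finally show ?thesis
      using True t_gt_0[of i] by (simp add: unwhiten_def z_def)
  qed (use x in \<open>auto simp: unwhiten_def extensional_def\<close>)
qed

lemma space_sample_space: "space (sample_space n :: (nat \<Rightarrow> real^'m) measure) = extensional {1..<n}"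
  by (auto simp: sample_space_def space_PiM PiE_def)

lemma sets_sample_space [measurable_cong]: "sets (sample_space n) = sets (Pi\<^sub>M {1..<n} (\<lambda>_. borel :: (real^'m) measure))"
  unfolding sample_space_def by (rule sets_PiM_cong) auto

lemma measurable_innov [measurable]:
  "i \<in> {1..<n} \<Longrightarrow> (\<lambda>x. innov x i) \<in> borel_measurable (Pi\<^sub>M {1..<n} (\<lambda>_. borel))"
  unfolding innov_def by (cases "Suc i = n") auto

lemma measurable_whiten [measurable]: "whiten Q \<in> measurable (sample_space n) (Pi\<^sub>M {1..<n} (\<lambda>_. borel))"
  unfolding whiten_def by measurable

lemma measurable_unwhiten: "unwhiten R \<in> measurable (Pi\<^sub>M {1..<n} (\<lambda>_. borel)) (sample_space n)"
proof -
  have "unwhiten R \<in> measurable (Pi\<^sub>M {1..<n} (\<lambda>_. borel)) (Pi\<^sub>M {1..<n} (\<lambda>_. borel))"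
    unfolding unwhiten_def
  proof (intro measurable_restrict borel_measurable_scaleR borel_measurable_add borel_measurable_sum borel_measurable_const)
    fix i j assume "i \<in> {1..<n}" "j \<in> {i..<n}"
    then have [measurable]: "j \<in> {1..<n}" by auto
    show "(\<lambda>x. R *v x j) \<in> borel_measurable (Pi\<^sub>M {1..<n} (\<lambda>_. borel))" by simp
  qed
  then show ?thesis by (simp cong: measurable_cong_sets add: sets_sample_space)
qed

lemma measurable_bridge_density [measurable]: "bridge_density Q \<in> borel_measurable (sample_space n)"
  unfolding bridge_density_def by measurable

lemma bridge_density_nonneg: "0 \<le> bridge_density Q x"
  unfolding bridge_density_def by (intro prod_nonneg ballI mult_nonneg_nonneg abs_ge_zero less_imp_le[OF gauss_density_pos])

text \<open>On a product of sets, density and indicator both split into one factor per residual.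
  \<open>nn_integral_PiM_innovations\<close> separates the integrals, and the linear substitution by
  \<open>P i\<close> turns each into a standard Gaussian probability.\<close>

lemma distr_whiten_bridge_density:
  assumes Q: "det Q \<noteq> 0"
  shows "distr (density (sample_space n) (\<lambda>x. ennreal (bridge_density Q x))) (Pi\<^sub>M {1..<n} (\<lambda>_. borel)) (whiten Q) =
    Pi\<^sub>M {1..<n} (\<lambda>_. std_gauss)" (is "?D = _")
proof -
  interpret product_sigma_finite "\<lambda>_::nat. std_gauss :: (real^'m) measure"
    by standard
  show ?thesis
  proof (rule PiM_eqI)
    show "sets ?D = sets (Pi\<^sub>M {1..<n} (\<lambda>_. std_gauss))"
      by (simp, rule sets_PiM_cong) auto
    fix A :: "nat \<Rightarrow> (real^'m) set"
    assume A: "\<And>i. i \<in> {1..<n} \<Longrightarrow> A i \<in> sets std_gauss"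
    define P where "P i = (1 / bscale i) *\<^sub>R Q" for i
    define D where "D i = (if i \<in> {1..<n} then A i else {})" for i
    have D [measurable]: "D i \<in> sets borel" for i using A by (simp add: D_def)
    define g where "g i y = ennreal (\<bar>det (P i)\<bar> * gauss_density (P i *v y)) * indicator (D i) (P i *v y)" for i y
    have PiD: "Pi\<^sub>E {1..<n} A = Pi\<^sub>E {1..<n} D" by (rule PiE_cong) (simp add: D_def)
    have [measurable]: "Pi\<^sub>E {1..<n} D \<in> sets (Pi\<^sub>M {1..<n} (\<lambda>_. borel))"
      by (intro sets_PiM_I_finite) auto
    have whiten: "whiten Q x = (\<lambda>i\<in>{1..<n}. P i *v innov x i)" for x
      by (simp add: whiten_def P_def scaleR_matrix_vector_assoc)
    have "emeasure ?D (Pi\<^sub>E {1..<n} A) =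
        (\<integral>\<^sup>+x. ennreal (bridge_density Q x) * indicator (Pi\<^sub>E {1..<n} D) (whiten Q x) \<partial>sample_space n)"
      unfolding PiD
    proof -
      have [measurable]: "whiten Q -` Pi\<^sub>E {1..<n} D \<inter> space (sample_space n) \<in> sets (sample_space n)"
        by (rule measurable_sets[OF measurable_whiten]) measurable
      show "emeasure ?D (Pi\<^sub>E {1..<n} D) =
          (\<integral>\<^sup>+x. ennreal (bridge_density Q x) * indicator (Pi\<^sub>E {1..<n} D) (whiten Q x) \<partial>sample_space n)"
        by (subst emeasure_distr, simp, simp, simp only: space_density, subst emeasure_density, simp, simp)
          (rule nn_integral_cong, simp add: indicator_def)
    qed
    also have "\<dots> = (\<integral>\<^sup>+x. (\<Prod>i\<in>{1..<n}. g i (x i - (t i / t (Suc i)) *\<^sub>R (x(n := xn)) (Suc i))) \<partial>sample_space n)"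
    proof (rule nn_integral_cong)
      fix x :: "nat \<Rightarrow> real^'m"
      have "indicator (Pi\<^sub>E {1..<n} D) (whiten Q x) = (\<Prod>i\<in>{1..<n}. indicator (D i) (P i *v innov x i) :: ennreal)"
      proof (cases "\<forall>i\<in>{1..<n}. P i *v innov x i \<in> D i")
        case True
        then have "whiten Q x \<in> Pi\<^sub>E {1..<n} D" unfolding whiten by auto
        then show ?thesis using True by simp
      next
        case False
        then obtain i where i: "i \<in> {1..<n}" "P i *v innov x i \<notin> D i" by blast
        then have "whiten Q x \<notin> Pi\<^sub>E {1..<n} D" unfolding whiten by (force simp: PiE_iff)
        moreover have "(\<Prod>i\<in>{1..<n}. indicator (D i) (P i *v innov x i) :: ennreal) = 0"
          using i by (intro prod_zero bexI[of _ i]) auto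
        ultimately show ?thesis by simp
      qed
      moreover have "ennreal (bridge_density Q x) =
          (\<Prod>i\<in>{1..<n}. ennreal (\<bar>det (P i)\<bar> * gauss_density (P i *v innov x i)))"
        unfolding bridge_density_def P_def
        by (intro prod_ennreal[symmetric] mult_nonneg_nonneg abs_ge_zero less_imp_le[OF gauss_density_pos])
      ultimately show "ennreal (bridge_density Q x) * indicator (Pi\<^sub>E {1..<n} D) (whiten Q x) =
          (\<Prod>i\<in>{1..<n}. g i (x i - (t i / t (Suc i)) *\<^sub>R (x(n := xn)) (Suc i)))"
        by (simp only: g_def prod.distrib innov_def)
    qed
    also have "\<dots> = (\<Prod>i\<in>{1..<n}. \<integral>\<^sup>+y. g i y \<partial>lborel)"
      unfolding sample_space_def
      by (rule nn_integral_PiM_innovations) (use n in \<open>auto simp: g_def\<close>)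
    also have "\<dots> = (\<Prod>i\<in>{1..<n}. emeasure std_gauss (A i))"
    proof (rule prod.cong[OF refl])
      fix i assume i: "i \<in> {1..<n}"
      have "det (P i) \<noteq> 0"
        using i Q bscale_pos[of i] by (simp add: P_def det_scaleR)
      have "(\<integral>\<^sup>+y. g i y \<partial>lborel) =
          (\<integral>\<^sup>+y. ennreal \<bar>det (P i)\<bar> * (ennreal (gauss_density (P i *v y)) * indicator (D i) (P i *v y)) \<partial>lborel)"
        by (intro nn_integral_cong)
          (simp add: g_def ennreal_mult less_imp_le[OF gauss_density_pos] mult.assoc)
      also have "\<dots> = (\<integral>\<^sup>+y. ennreal (gauss_density y) * indicator (D i) y \<partial>lborel)"
        by (rule nn_integral_lborel_matrix[OF \<open>det (P i) \<noteq> 0\<close>]) simp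
      also have "\<dots> = emeasure std_gauss (A i)"
        unfolding std_gauss_eq_density using i D[of i] by (subst emeasure_density) (auto simp: D_def)
      finally show "(\<integral>\<^sup>+y. g i y \<partial>lborel) = emeasure std_gauss (A i)" .
    qed
    finally show "emeasure ?D (Pi\<^sub>E {1..<n} A) = (\<Prod>i\<in>{1..<n}. emeasure std_gauss (A i))" .
  qed simp
qed

text \<open>The law of the sample and the candidate have the same image under
  \<open>whiten Q\<close>, and \<open>unwhiten R\<close> undoes that map.\<close>

theorem sample_law_density:
  assumes RQ: "R ** Q = mat 1" and X: "X \<in> measurable M (sample_space n)"
    and law: "distr M (Pi\<^sub>M {1..<n} (\<lambda>_. borel)) (\<lambda>\<omega>. whiten Q (X \<omega>)) = Pi\<^sub>M {1..<n} (\<lambda>_. std_gauss)"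
  shows "distr M (sample_space n) X = density (sample_space n) (\<lambda>x. ennreal (bridge_density Q x))"
proof (rule measure_eq_if_distr_eq)
  have "det R * det Q = 1" using det_mul[of R Q] by (simp add: RQ)
  then have "det Q \<noteq> 0" by auto
  have "distr (distr M (sample_space n) X) (Pi\<^sub>M {1..<n} (\<lambda>_. borel)) (whiten Q) =
      distr M (Pi\<^sub>M {1..<n} (\<lambda>_. borel)) (whiten Q \<circ> X)"
    by (rule distr_distr[OF measurable_whiten X])
  also have "\<dots> = Pi\<^sub>M {1..<n} (\<lambda>_. std_gauss)"
    unfolding comp_def by (rule law)
  also have "\<dots> = distr (density (sample_space n) (\<lambda>x. ennreal (bridge_density Q x))) (Pi\<^sub>M {1..<n} (\<lambda>_. borel)) (whiten Q)"
    by (rule distr_whiten_bridge_density[OF \<open>det Q \<noteq> 0\<close>, symmetric])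
  finally show "distr (distr M (sample_space n) X) (Pi\<^sub>M {1..<n} (\<lambda>_. borel)) (whiten Q) =
      distr (density (sample_space n) (\<lambda>x. ennreal (bridge_density Q x))) (Pi\<^sub>M {1..<n} (\<lambda>_. borel)) (whiten Q)" .
next
  show "unwhiten R (whiten Q x) = x" if "x \<in> space (sample_space n)" for x
    using unwhiten_whiten[OF RQ] that by (simp add: space_sample_space)
qed (rule sets_distr sets_density measurable_whiten measurable_unwhiten)+

end

section \<open>Moments of normal variables and matrix-valued covariances\<close>

text \<open>The parameters hidden in \<open>normal_rv\<close> are identified as mean and variance,
  so the characteristic function follows from moments alone. Point masses form a separate case;
  otherwise the variable is standardised and the standard characteristic function is taken at
  \<sigma>.\<close>

lemma normal_rv_moments:
  assumes prob: "prob_space M" and Y: "normal_rv M Y"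
  shows "integrable M Y" and "integrable M (\<lambda>\<omega>. (Y \<omega>)\<^sup>2)"
    and "(LINT \<omega>|M. Y \<omega>) = a \<Longrightarrow> (LINT \<omega>|M. (Y \<omega> - a)\<^sup>2) = v \<Longrightarrow>
      (CLINT \<omega>|M. cis (Y \<omega>)) = cis a * complex_of_real (exp (- v / 2))"
proof -
  interpret prob_space M by fact
  have Ym [measurable]: "Y \<in> borel_measurable M" using Y by (simp add: normal_rv_def)
  have lb: "distr M lborel f = distr M borel f" for f :: "'a \<Rightarrow> real"
    by (rule distr_cong) auto
  obtain \<mu> \<sigma> where \<sigma>: "0 \<le> \<sigma>" and D: "distr M borel Y =
      (if \<sigma> = 0 then return borel \<mu> else density lborel (\<lambda>y. ennreal (normal_density \<mu> \<sigma> y)))"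
    using Y by (auto simp: normal_rv_def)
  have "integrable M Y \<and> integrable M (\<lambda>\<omega>. (Y \<omega>)\<^sup>2) \<and> ((LINT \<omega>|M. Y \<omega>) = a \<longrightarrow>
      (LINT \<omega>|M. (Y \<omega> - a)\<^sup>2) = v \<longrightarrow> (CLINT \<omega>|M. cis (Y \<omega>)) = cis a * complex_of_real (exp (- v / 2)))"
  proof (cases "\<sigma> = 0")
    case True
    have "AE y in distr M borel Y. y = \<mu>"
      unfolding D using True by (simp add: AE_return)
    then have ae: "AE \<omega> in M. Y \<omega> = \<mu>" by (subst (asm) AE_distr_iff) auto
    have i1: "integrable M Y"
      by (rule integrable_cong_AE[THEN iffD2, of _ _ "\<lambda>_. \<mu>"]) (use ae in auto)
    have i2: "integrable M (\<lambda>\<omega>. (Y \<omega>)\<^sup>2)"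
      by (rule integrable_cong_AE[THEN iffD2, of _ _ "\<lambda>_. \<mu>\<^sup>2"]) (use ae in auto)
    have e: "(LINT \<omega>|M. Y \<omega>) = \<mu>"
      using integral_cong_AE[of Y M "\<lambda>_. \<mu>"] ae by (simp add: prob_space)
    have v: "(LINT \<omega>|M. (Y \<omega> - \<mu>)\<^sup>2) = 0"
      using integral_cong_AE[of "\<lambda>\<omega>. (Y \<omega> - \<mu>)\<^sup>2" M "\<lambda>_. 0"] ae by auto
    have "(CLINT \<omega>|M. cis (Y \<omega>)) = (CLINT \<omega>|M. cis \<mu>)"
      by (rule integral_cong_AE) (use ae in \<open>auto simp: cis_conv_exp\<close>)
    then have "(CLINT \<omega>|M. cis (Y \<omega>)) = cis \<mu>" by (simp add: prob_space)
    then show ?thesis using i1 i2 e v by auto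
  next
    case False
    then have pos: "0 < \<sigma>" using \<sigma> by simp
    have dist: "distributed M lborel Y (\<lambda>y. ennreal (normal_density \<mu> \<sigma> y))"
      using D False lb[of Y] by (simp add: distributed_def)
    have e: "expectation Y = \<mu>" by (rule normal_distributed_expectation[OF pos dist])
    have v: "(LINT \<omega>|M. (Y \<omega> - \<mu>)\<^sup>2) = \<sigma>\<^sup>2"
      using normal_distributed_variance[OF pos dist] e by simp
    have int: "integrable M (\<lambda>\<omega>. (Y \<omega> - \<mu>) ^ k)" for k
      using distributed_integrable[OF dist, of "\<lambda>x. (x - \<mu>) ^ k"] integrable_normal_moment[OF pos, of \<mu> k]
      by simp
    have i1: "integrable M Y"
      using Bochner_Integration.integrable_add[OF int[of 1] integrable_const[of \<mu>]] by simp
    have "(\<lambda>\<omega>. (Y \<omega>)\<^sup>2) = (\<lambda>\<omega>. (Y \<omega> - \<mu>)\<^sup>2 + (2 * \<mu> * Y \<omega> - \<mu>\<^sup>2))"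
      by (simp add: power2_eq_square algebra_simps)
    moreover have "integrable M (\<lambda>\<omega>. (Y \<omega> - \<mu>)\<^sup>2 + (2 * \<mu> * Y \<omega> - \<mu>\<^sup>2))"
      using int[of 2] i1 by (intro Bochner_Integration.integrable_add Bochner_Integration.integrable_diff) auto
    ultimately have i2: "integrable M (\<lambda>\<omega>. (Y \<omega>)\<^sup>2)" by (simp only:)
    have std: "distributed M lborel (\<lambda>\<omega>. (Y \<omega> - \<mu>) / \<sigma>) std_normal_density"
      using normal_standard_normal_convert[OF pos] dist by simp
    then have std': "distr M borel (\<lambda>\<omega>. (Y \<omega> - \<mu>) / \<sigma>) = std_normal_distribution"
      using lb[of "\<lambda>\<omega>. (Y \<omega> - \<mu>) / \<sigma>"] by (simp add: distributed_def)
    have "char (distr M borel (\<lambda>\<omega>. (Y \<omega> - \<mu>) / \<sigma>)) \<sigma> = (CLINT \<omega>|M. iexp (\<sigma> * ((Y \<omega> - \<mu>) / \<sigma>)))"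
      unfolding char_def by (subst integral_distr) auto
    then have c: "(CLINT \<omega>|M. cis (Y \<omega> - \<mu>)) = complex_of_real (exp (- \<sigma>\<^sup>2 / 2))"
      unfolding std' char_std_normal_distribution using pos by (simp add: cis_conv_exp)
    have "(CLINT \<omega>|M. cis (Y \<omega>)) = (CLINT \<omega>|M. cis \<mu> * cis (Y \<omega> - \<mu>))"
      by (simp add: cis_mult)
    also have "\<dots> = cis \<mu> * (CLINT \<omega>|M. cis (Y \<omega> - \<mu>))"
      by (rule integral_mult_right_zero)
    finally show ?thesis using i1 i2 e v c by auto
  qed
  then show "integrable M Y" and "integrable M (\<lambda>\<omega>. (Y \<omega>)\<^sup>2)"
    and "(LINT \<omega>|M. Y \<omega>) = a \<Longrightarrow> (LINT \<omega>|M. (Y \<omega> - a)\<^sup>2) = v \<Longrightarrow>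
      (CLINT \<omega>|M. cis (Y \<omega>)) = cis a * complex_of_real (exp (- v / 2))"
    by blast+
qed

lemma integrable_mult_if_squares:
  fixes f g :: "'a \<Rightarrow> real"
  assumes [measurable]: "f \<in> borel_measurable M" "g \<in> borel_measurable M"
    and f: "integrable M (\<lambda>\<omega>. (f \<omega>)\<^sup>2)" and g: "integrable M (\<lambda>\<omega>. (g \<omega>)\<^sup>2)"
  shows "integrable M (\<lambda>\<omega>. f \<omega> * g \<omega>)"
proof (rule Bochner_Integration.integrable_bound)
  show "integrable M (\<lambda>\<omega>. (f \<omega>)\<^sup>2 + (g \<omega>)\<^sup>2)" using f g by simp
  have "\<bar>a * b\<bar> \<le> a\<^sup>2 + b\<^sup>2" for a b :: real
    using sum_squares_bound[of a b] sum_squares_bound[of a "- b"]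
      zero_le_power2[of a] zero_le_power2[of b] by (simp add: abs_if del: zero_le_power2)
  then show "AE \<omega> in M. norm (f \<omega> * g \<omega>) \<le> norm ((f \<omega>)\<^sup>2 + (g \<omega>)\<^sup>2)" by simp
qed simp

lemma inner_outer: "a \<bullet> (outer v w *v b) = (a \<bullet> v) * (b \<bullet> w)"
  unfolding outer_def matrix_vector_mult_def inner_vec_def
  by (simp add: sum_distrib_left sum_distrib_right mult_ac sum_product) (rule sum.swap)

text \<open>Turns the matrix-valued covariance hypothesis into scalar covariances: the expansion in
  matrix units makes \<open>outer\<close> integrable, and testing a matrix with two vectors is
  bounded and linear.\<close>

lemma inner_integral_outer:
  fixes V W :: "'a \<Rightarrow> real^'m"
  assumes int: "\<And>k l. integrable M (\<lambda>\<omega>. V \<omega> $ k * W \<omega> $ l)"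
  shows "a \<bullet> ((\<integral>\<omega>. outer (V \<omega>) (W \<omega>) \<partial>M) *v b) = (LINT \<omega>|M. (a \<bullet> V \<omega>) * (b \<bullet> W \<omega>))"
proof -
  have "outer v w = (\<Sum>k\<in>UNIV. \<Sum>l\<in>UNIV. (v $ k * w $ l) *\<^sub>R (axis k (axis l 1)))" for v w :: "real^'m"
  proof (simp only: vec_eq_iff, intro allI)
    fix i j
    have "(\<Sum>k\<in>UNIV. \<Sum>l\<in>UNIV. (v $ k * w $ l) *\<^sub>R (axis k (axis l 1))) $ i $ j =
        (\<Sum>k\<in>UNIV. \<Sum>l\<in>UNIV. v $ k * w $ l * (axis k (axis l 1) :: real^'m^'m) $ i $ j)"
      by simp
    also have "\<dots> = (\<Sum>k\<in>UNIV. if k = i then v $ k * w $ j else 0)"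
    proof (rule sum.cong[OF refl])
      fix k
      have "(\<Sum>l\<in>UNIV. v $ k * w $ l * (axis k (axis l 1) :: real^'m^'m) $ i $ j) =
          (\<Sum>l\<in>UNIV. if l = j then (if k = i then v $ k * w $ l else 0) else 0)"
        by (rule sum.cong[OF refl]) (simp add: axis_def)
      then show "(\<Sum>l\<in>UNIV. v $ k * w $ l * (axis k (axis l 1) :: real^'m^'m) $ i $ j) =
          (if k = i then v $ k * w $ j else 0)"
        by simp
    qed
    finally show "outer v w $ i $ j = (\<Sum>k\<in>UNIV. \<Sum>l\<in>UNIV. (v $ k * w $ l) *\<^sub>R (axis k (axis l 1))) $ i $ j"
      by (simp add: outer_def)
  qed
  then have "integrable M (\<lambda>\<omega>. outer (V \<omega>) (W \<omega>))"
    by (simp only:) (intro Bochner_Integration.integrable_sum integrable_scaleR_left int)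
  moreover have "bounded_linear (\<lambda>A :: real^'m^'m. a \<bullet> (A *v b))"
    by (rule linear_conv_bounded_linear[THEN iffD1], rule linearI)
      (auto simp: matrix_vector_mult_add_rdistrib inner_add_right scaleR_matrix_vector_assoc[symmetric])
  ultimately show ?thesis
    using integral_bounded_linear[of "\<lambda>A :: real^'m^'m. a \<bullet> (A *v b)" M "\<lambda>\<omega>. outer (V \<omega>) (W \<omega>)"]
    by (simp add: inner_outer)
qed

lemma integrable_euclideanI:
  fixes f :: "'a \<Rightarrow> 'b::euclidean_space"
  assumes "\<And>a. integrable M (\<lambda>\<omega>. a \<bullet> f \<omega>)"
  shows "integrable M f"
proof -
  have "integrable M (\<lambda>\<omega>. \<Sum>b\<in>Basis. (b \<bullet> f \<omega>) *\<^sub>R b)"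
    by (intro Bochner_Integration.integrable_sum integrable_scaleR_left assms)
  then show ?thesis by (simp only: inner_commute[of _ "f _"] euclidean_representation)
qed

section \<open>Covariances of the residuals\<close>

context sampling_times
begin

text \<open>The kernel of the scalar Brownian bridge on [0, t_n]. Both cases of the covariance
  hypothesis are this kernel times alpha, since multiples of the identity commute with
  alpha.\<close>

definition bridge_cov :: "nat \<Rightarrow> nat \<Rightarrow> real" where
  "bridge_cov i j = min (t i) (t j) * (1 - max (t i) (t j) / t n)"

lemma bridge_cov_ordered: "1 \<le> i \<Longrightarrow> i \<le> j \<Longrightarrow> j \<le> n \<Longrightarrow> bridge_cov i j = t i * (1 - t j / t n)"
  using t_mono[of i j] by (simp add: bridge_cov_def)

lemma bridge_cov_commute: "bridge_cov i j = bridge_cov j i"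
  by (simp add: bridge_cov_def min.commute max.commute)

text \<open>At times t_k and later the kernel is t_k times a function of the later time, so
  multiplying its value at index k + 1 by t_k / t_{k+1} gives its value at index k. Hence a residual
  is uncorrelated with all later samples, and so with all later residuals.\<close>

lemma innov_cov:
  assumes i: "i \<in> {1..<n}" and j: "j \<in> {1..<n}"
  defines "r \<equiv> \<lambda>i. t i / t (Suc i)"
  shows "bridge_cov i j - r i * bridge_cov (Suc i) j - r j * bridge_cov i (Suc j) +
      r i * r j * bridge_cov (Suc i) (Suc j) = (if i = j then (bscale i)\<^sup>2 else 0)"
proof -
  have pos: "0 < t i" "0 < t (Suc i)" "0 < t j" "0 < t (Suc j)" "0 < t n"
    using i j n t_gt_0 by auto
  have lt: "bridge_cov k l - r k * bridge_cov (Suc k) l - r l * bridge_cov k (Suc l) +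
      r k * r l * bridge_cov (Suc k) (Suc l) = 0" if "k \<in> {1..<n}" "l \<in> {1..<n}" "k < l" for k l
  proof -
    have "r k * bridge_cov (Suc k) l = bridge_cov k l" "r k * bridge_cov (Suc k) (Suc l) = bridge_cov k (Suc l)"
      using that t_gt_0[of "Suc k"] by (simp_all add: bridge_cov_ordered r_def)
    moreover from this(2) have "r k * r l * bridge_cov (Suc k) (Suc l) = r l * bridge_cov k (Suc l)"
      by (simp add: mult.commute mult.left_commute)
    ultimately show ?thesis by simp
  qed
  show ?thesis
  proof (cases i j rule: linorder_cases)
    case less
    then show ?thesis using lt[OF i j] by simp
  next
    case greater
    then show ?thesis using lt[OF j i]
      by (simp add: bridge_cov_commute[of j] bridge_cov_commute[of "Suc j"] mult.commute algebra_simps)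
  next
    case equal
    have "(bscale i)\<^sup>2 = t i * (t (Suc i) - t i) / t (Suc i)"
      using pos i t_less_Suc[of i] by (simp add: bscale_def)
    moreover have "bridge_cov i i = t i * (1 - t i / t n)" "bridge_cov i (Suc i) = t i * (1 - t (Suc i) / t n)"
      "bridge_cov (Suc i) i = t i * (1 - t (Suc i) / t n)"
      "bridge_cov (Suc i) (Suc i) = t (Suc i) * (1 - t (Suc i) / t n)"
      using i by (simp_all add: bridge_cov_ordered bridge_cov_commute[of "Suc i" i])
    ultimately show ?thesis
      using pos by (simp only: equal[symmetric] r_def) (simp add: field_simps)
  qed
qed

lemma inj_on_t: "inj_on t {1..<n}"
proof (rule linorder_inj_onI)
  fix i j assume "i < j" "i \<in> {1..<n}" "j \<in> {1..<n}"
  then show "t i \<noteq> t j" using t_less_Suc[of i] t_mono[of "Suc i" j] by auto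
qed auto

text \<open>Summation by parts. The term shifted past the last index vanishes by
  \<open>z n = 0\<close>; index 1 has no predecessor, whence the case distinction.\<close>

lemma sum_inner_innov:
  fixes z :: "nat \<Rightarrow> real^'m"
  assumes "z n = 0"
  shows "(\<Sum>i\<in>{1..<n}. e i \<bullet> (z i - r i *\<^sub>R z (Suc i))) =
    (\<Sum>i\<in>{1..<n}. (e i - (if i = 1 then 0 else r (i - 1) *\<^sub>R e (i - 1))) \<bullet> z i)"
proof -
  let ?g = "\<lambda>i. (r (i - 1) *\<^sub>R e (i - 1)) \<bullet> z i"
  let ?h = "\<lambda>i. if i = 1 then 0 else ?g i"
  have "(\<Sum>i\<in>{1..<n}. (r i *\<^sub>R e i) \<bullet> z (Suc i)) = (\<Sum>i\<in>{1..<n}. ?g (Suc i))" by simp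
  also have "\<dots> = (\<Sum>i\<in>{Suc 1..<Suc n}. ?g i)" by (rule sum.shift_bounds_Suc_ivl[symmetric])
  also have "\<dots> = (\<Sum>i\<in>{1..<Suc n}. ?h i)"
    by (rule sum.mono_neutral_cong_left) auto
  also have "\<dots> = (\<Sum>i\<in>{1..<n}. ?h i)"
    using n assms by simp
  finally have "(\<Sum>i\<in>{1..<n}. (r i *\<^sub>R e i) \<bullet> z (Suc i)) = (\<Sum>i\<in>{1..<n}. ?h i)" .
  moreover have "(\<Sum>i\<in>{1..<n}. e i \<bullet> (z i - r i *\<^sub>R z (Suc i))) =
      (\<Sum>i\<in>{1..<n}. e i \<bullet> z i) - (\<Sum>i\<in>{1..<n}. (r i *\<^sub>R e i) \<bullet> z (Suc i))"
    by (simp add: inner_diff_right sum_subtractf)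
  moreover have "(\<Sum>i\<in>{1..<n}. (e i - (if i = 1 then 0 else r (i - 1) *\<^sub>R e (i - 1))) \<bullet> z i) =
      (\<Sum>i\<in>{1..<n}. e i \<bullet> z i) - (\<Sum>i\<in>{1..<n}. ?h i)"
    unfolding sum_subtractf[symmetric] by (intro sum.cong) (auto simp: inner_diff_left)
  ultimately show ?thesis by simp
qed

end

section \<open>Law of the sample of a Gaussian bridge\<close>

locale gaussian_bridge = sampling_times n t xn
  for n t and xn :: "real^'m" +
  fixes M :: "'a measure" and B :: "real \<Rightarrow> 'a \<Rightarrow> real^'m" and \<alpha> :: "real^'m^'m"
  assumes gaussian: "gaussian_process M {0..t n} B"
    and mean: "\<And>u. u \<in> {0..t n} \<Longrightarrow> (\<integral>\<omega>. B u \<omega> \<partial>M) = (u / t n) *\<^sub>R xn"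
    and cov: "\<And>u s. u \<in> {0..t n} \<Longrightarrow> s \<in> {0..t n} \<Longrightarrow>
      (\<integral>\<omega>. outer (B u \<omega> - (\<integral>\<omega>'. B u \<omega>' \<partial>M)) (B s \<omega> - (\<integral>\<omega>'. B s \<omega>' \<partial>M)) \<partial>M) =
        (if s \<le> u then (mat 1 - (u / t n) *\<^sub>R mat 1) ** (s *\<^sub>R \<alpha>)
         else (u *\<^sub>R \<alpha>) ** (mat 1 - (s / t n) *\<^sub>R mat 1))"
begin

sublocale prob_space M
  using gaussian by (simp add: gaussian_process_def)

lemma measurable_B [measurable]: "u \<in> {0..t n} \<Longrightarrow> B u \<in> borel_measurable M"
  using gaussian by (simp add: gaussian_process_def)

lemma t_in: "i \<in> {1..<n} \<Longrightarrow> t i \<in> {0..t n}"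
  using t_gt_0[of i] t_mono[of i n] by simp

text \<open>\<open>gaussian_process\<close> attaches coefficients to times; injectivity of
  \<open>t\<close> allows coefficients attached to indices to be transported.\<close>

lemma normal_rv_sum: "normal_rv M (\<lambda>\<omega>. \<Sum>i\<in>{1..<n}. c i \<bullet> B (t i) \<omega>)"
proof -
  have gp: "normal_rv M (\<lambda>\<omega>. \<Sum>u\<in>F. c' u \<bullet> B u \<omega>)" if "finite F" "F \<subseteq> {0..t n}" for F c'
    using gaussian that by (simp add: gaussian_process_def)
  have "normal_rv M (\<lambda>\<omega>. \<Sum>u\<in>t ` {1..<n}. c (the_inv_into {1..<n} t u) \<bullet> B u \<omega>)"
    by (rule gp[of "t ` {1..<n}" "\<lambda>u. c (the_inv_into {1..<n} t u)"]) (use t_in in blast)+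
  also have "(\<lambda>\<omega>. \<Sum>u\<in>t ` {1..<n}. c (the_inv_into {1..<n} t u) \<bullet> B u \<omega>) =
      (\<lambda>\<omega>. \<Sum>i\<in>{1..<n}. c i \<bullet> B (t i) \<omega>)"
    by (rule ext, subst sum.reindex[OF inj_on_t])
      (auto simp: the_inv_into_f_f[OF inj_on_t] intro!: sum.cong)
  finally show ?thesis .
qed

lemma normal_rv_inner:
  assumes i: "i \<in> {1..<n}"
  shows "normal_rv M (\<lambda>\<omega>. a \<bullet> B (t i) \<omega>)"
proof -
  have "(\<Sum>j\<in>{1..<n}. (if j = i then a else 0) \<bullet> B (t j) \<omega>) = a \<bullet> B (t i) \<omega>" for \<omega>
    using i by (simp add: if_distrib[of "\<lambda>x. x \<bullet> _"] cong: if_cong)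
  then show ?thesis using normal_rv_sum[of "\<lambda>j. if j = i then a else 0"] by simp
qed

lemma integrable_B: "i \<in> {1..<n} \<Longrightarrow> integrable M (B (t i))"
  by (rule integrable_euclideanI) (rule normal_rv_moments(1)[OF prob_space_axioms normal_rv_inner])

text \<open>At index \<open>n\<close> the known vector takes the place of the process, so the
  deviation there is 0. This agrees with \<open>bridge_cov\<close>, which vanishes if one index is
  \<open>n\<close>, and keeps the covariance formula uniform.\<close>

definition centred :: "nat \<Rightarrow> 'a \<Rightarrow> real^'m" where
  "centred i \<omega> = (if i < n then B (t i) \<omega> - (t i / t n) *\<^sub>R xn else 0)"

lemma measurable_centred [measurable]: "i \<in> {1..n} \<Longrightarrow> centred i \<in> borel_measurable M"
  unfolding centred_def using measurable_B[OF t_in[of i]] by (cases "i < n") auto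

lemma integrable_centred_square:
  assumes i: "i \<in> {1..n}"
  shows "integrable M (\<lambda>\<omega>. (a \<bullet> centred i \<omega>)\<^sup>2)"
proof (cases "i < n")
  case True
  then have i': "i \<in> {1..<n}" using i by simp
  let ?m = "a \<bullet> ((t i / t n) *\<^sub>R xn)"
  have "integrable M (\<lambda>\<omega>. (a \<bullet> B (t i) \<omega>)\<^sup>2 - 2 * ?m * (a \<bullet> B (t i) \<omega>) + ?m\<^sup>2)"
    using normal_rv_moments(1,2)[OF prob_space_axioms normal_rv_inner[OF i', of a]]
    by (intro Bochner_Integration.integrable_add Bochner_Integration.integrable_diff integrable_mult_right) auto
  moreover have "(\<lambda>\<omega>. (a \<bullet> centred i \<omega>)\<^sup>2) = (\<lambda>\<omega>. (a \<bullet> B (t i) \<omega>)\<^sup>2 - 2 * ?m * (a \<bullet> B (t i) \<omega>) + ?m\<^sup>2)"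
    using True by (simp add: centred_def inner_diff_right power2_diff algebra_simps)
  ultimately show ?thesis by (simp only:)
qed (simp add: centred_def)

lemma integrable_centred_mult:
  "i \<in> {1..n} \<Longrightarrow> j \<in> {1..n} \<Longrightarrow> integrable M (\<lambda>\<omega>. (a \<bullet> centred i \<omega>) * (b \<bullet> centred j \<omega>))"
  by (intro integrable_mult_if_squares integrable_centred_square) auto

lemma scaled_identity_mult:
  fixes A :: "real^'m^'m"
  shows "(mat 1 - c *\<^sub>R mat 1) ** A = (1 - c) *\<^sub>R A" "A ** (mat 1 - c *\<^sub>R mat 1) = (1 - c) *\<^sub>R A"
proof -
  have "mat 1 - c *\<^sub>R mat 1 = (1 - c) *\<^sub>R (mat 1 :: real^'m^'m)"
    by (simp add: scaleR_left_diff_distrib)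
  then show "(mat 1 - c *\<^sub>R mat 1) ** A = (1 - c) *\<^sub>R A" "A ** (mat 1 - c *\<^sub>R mat 1) = (1 - c) *\<^sub>R A"
    by (simp_all only: scalar_matrix_assoc[symmetric] matrix_scalar_ac matrix_mul_lid matrix_mul_rid)
qed

lemma cov_centred:
  assumes i: "i \<in> {1..n}" and j: "j \<in> {1..n}"
  shows "(LINT \<omega>|M. (a \<bullet> centred i \<omega>) * (b \<bullet> centred j \<omega>)) = bridge_cov i j * (a \<bullet> (\<alpha> *v b))"
proof (cases "i < n \<and> j < n")
  case True
  then have i': "i \<in> {1..<n}" and j': "j \<in> {1..<n}" using i j by auto
  have pos: "0 < t n" using t_gt_0[of n] n by simp
  have c: "centred k = (\<lambda>\<omega>. B (t k) \<omega> - (\<integral>\<omega>'. B (t k) \<omega>' \<partial>M))" if "k \<in> {1..<n}" for k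
    using that by (simp add: centred_def fun_eq_iff mean[OF t_in])
  have int: "integrable M (\<lambda>\<omega>. centred i \<omega> $ k * centred j \<omega> $ l)" for k l
    using integrable_centred_mult[OF i j, of "axis k 1" "axis l 1"] by (simp add: inner_axis')
  have "(LINT \<omega>|M. (a \<bullet> centred i \<omega>) * (b \<bullet> centred j \<omega>)) =
      a \<bullet> ((\<integral>\<omega>. outer (centred i \<omega>) (centred j \<omega>) \<partial>M) *v b)"
    by (rule inner_integral_outer[OF int, symmetric])
  also have "(\<integral>\<omega>. outer (centred i \<omega>) (centred j \<omega>) \<partial>M) =
      (if t j \<le> t i then (1 - t i / t n) *\<^sub>R (t j *\<^sub>R \<alpha>) else (1 - t j / t n) *\<^sub>R (t i *\<^sub>R \<alpha>))"
    using cov[OF t_in[OF i'] t_in[OF j']] by (simp only: c[OF i'] c[OF j'] scaled_identity_mult)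
  also have "\<dots> = bridge_cov i j *\<^sub>R \<alpha>"
    by (simp add: bridge_cov_def min_def max_def mult.commute)
  finally show ?thesis by (simp add: scaleR_matrix_vector_assoc[symmetric])
next
  case False
  then have "i = n \<or> j = n" using i j by auto
  then have "bridge_cov i j = 0"
    using bridge_cov_ordered[of i n] bridge_cov_ordered[of j n] bridge_cov_commute[of n j] i j t_gt_0[of n]
    by auto
  then show ?thesis using False by (auto simp: centred_def)
qed

text \<open>The mean is proportional to time, so the weight t_i / t_{i+1} makes the two means
  cancel.\<close>

lemma innov_sample:
  assumes i: "i \<in> {1..<n}"
  shows "innov (sample n t B \<omega>) i = centred i \<omega> - (t i / t (Suc i)) *\<^sub>R centred (Suc i) \<omega>"
proof -
  have "0 < t (Suc i)" "0 < t n" using i n t_gt_0 by auto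
  then show ?thesis
    using i by (cases "Suc i = n") (auto simp: innov_def sample_def centred_def scaleR_diff_right)
qed

lemma cov_innov:
  assumes i: "i \<in> {1..<n}" and j: "j \<in> {1..<n}"
  shows "integrable M (\<lambda>\<omega>. (a \<bullet> innov (sample n t B \<omega>) i) * (b \<bullet> innov (sample n t B \<omega>) j))"
    and "(LINT \<omega>|M. (a \<bullet> innov (sample n t B \<omega>) i) * (b \<bullet> innov (sample n t B \<omega>) j)) =
      (if i = j then (bscale i)\<^sup>2 else 0) * (a \<bullet> (\<alpha> *v b))"
proof -
  define r where "r i = t i / t (Suc i)" for i
  have mem: "i \<in> {1..n}" "Suc i \<in> {1..n}" "j \<in> {1..n}" "Suc j \<in> {1..n}" using i j by auto
  have eq: "(\<lambda>\<omega>. (a \<bullet> innov (sample n t B \<omega>) i) * (b \<bullet> innov (sample n t B \<omega>) j)) =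
    (\<lambda>\<omega>. (a \<bullet> centred i \<omega>) * (b \<bullet> centred j \<omega>) - r i * ((a \<bullet> centred (Suc i) \<omega>) * (b \<bullet> centred j \<omega>)) -
      r j * ((a \<bullet> centred i \<omega>) * (b \<bullet> centred (Suc j) \<omega>)) +
      r i * r j * ((a \<bullet> centred (Suc i) \<omega>) * (b \<bullet> centred (Suc j) \<omega>)))"
    by (simp only: innov_sample[OF i] innov_sample[OF j]) (simp add: r_def[symmetric] inner_diff_right algebra_simps)
  show "integrable M (\<lambda>\<omega>. (a \<bullet> innov (sample n t B \<omega>) i) * (b \<bullet> innov (sample n t B \<omega>) j))"
    unfolding eq by (intro Bochner_Integration.integrable_add Bochner_Integration.integrable_diff
        integrable_mult_right integrable_centred_mult mem)
  have "(LINT \<omega>|M. (a \<bullet> innov (sample n t B \<omega>) i) * (b \<bullet> innov (sample n t B \<omega>) j)) =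
      (bridge_cov i j - r i * bridge_cov (Suc i) j - r j * bridge_cov i (Suc j) +
      r i * r j * bridge_cov (Suc i) (Suc j)) * (a \<bullet> (\<alpha> *v b))"
    unfolding eq
    by (simp add: integrable_centred_mult[OF mem(1,3)] integrable_centred_mult[OF mem(2,3)]
        integrable_centred_mult[OF mem(1,4)] integrable_centred_mult[OF mem(2,4)]
        cov_centred[OF mem(1,3)] cov_centred[OF mem(2,3)] cov_centred[OF mem(1,4)] cov_centred[OF mem(2,4)])
      (simp add: algebra_simps)
  then show "(LINT \<omega>|M. (a \<bullet> innov (sample n t B \<omega>) i) * (b \<bullet> innov (sample n t B \<omega>) j)) =
      (if i = j then (bscale i)\<^sup>2 else 0) * (a \<bullet> (\<alpha> *v b))"
    unfolding r_def innov_cov[OF i j] .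
qed

lemma measurable_sample [measurable]: "sample n t B \<in> measurable M (sample_space n)"
  unfolding sample_def sample_space_def using measurable_B[OF t_in] by (intro measurable_restrict) auto

text \<open>A combination of whitened residuals is, after summation by parts, a combination of the
  values of the process minus its mean, hence a centred normal variable. As the residuals are
  uncorrelated and \<open>Q\<close> whitens \<alpha>, its variance is the sum of the squared norms
  of the test vectors, and \<open>std_gauss_lawI\<close> applies.\<close>

theorem law_whiten_sample:
  assumes Q: "Q ** \<alpha> ** transpose Q = mat 1"
  shows "distr M (Pi\<^sub>M {1..<n} (\<lambda>_. borel)) (\<lambda>\<omega>. whiten Q (sample n t B \<omega>)) = Pi\<^sub>M {1..<n} (\<lambda>_. std_gauss)"
proof -
  define W where "W i \<omega> = (1 / bscale i) *\<^sub>R (Q *v innov (sample n t B \<omega>) i)" for i \<omega>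
  have [measurable]: "W i \<in> borel_measurable M" if "i \<in> {1..<n}" for i
    unfolding W_def using that innov_sample[OF that] by simp
  have ch: "(CLINT \<omega>|M. cis (\<Sum>i\<in>{1..<n}. d i \<bullet> W i \<omega>)) =
      complex_of_real (\<Prod>i\<in>{1..<n}. exp (- (norm (d i))\<^sup>2 / 2))" for d :: "nat \<Rightarrow> real^'m"
  proof -
    \<comment> \<open>The adjoint of the scaled \<open>Q\<close> moves the test vectors from
      whitened to raw residuals.\<close>
    define e where "e i = (1 / bscale i) *\<^sub>R (transpose Q *v d i)" for i
    define r where "r i = t i / t (Suc i)" for i
    \<comment> \<open>The coefficient of \<open>B (t i)\<close>: residual i contributes
      \<open>e i\<close>, and residual i - 1 contributes through the multiple of its successor that
      it subtracts.\<close>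
    define c where "c i = e i - (if i = 1 then 0 else r (i - 1) *\<^sub>R e (i - 1))" for i
    define m where "m = (\<Sum>i\<in>{1..<n}. c i \<bullet> ((t i / t n) *\<^sub>R xn))"
    define Y where "Y \<omega> = (\<Sum>i\<in>{1..<n}. c i \<bullet> B (t i) \<omega>)" for \<omega>
    have dW: "d i \<bullet> W i \<omega> = e i \<bullet> innov (sample n t B \<omega>) i" for i \<omega>
      by (simp add: W_def e_def transpose_matrix_vector dot_lmul_matrix)
    have U: "(\<Sum>i\<in>{1..<n}. d i \<bullet> W i \<omega>) = Y \<omega> - m" for \<omega>
    proof -
      have "(\<Sum>i\<in>{1..<n}. d i \<bullet> W i \<omega>) =
          (\<Sum>i\<in>{1..<n}. e i \<bullet> (centred i \<omega> - r i *\<^sub>R centred (Suc i) \<omega>))"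
        by (intro sum.cong) (auto simp: dW innov_sample r_def)
      also have "\<dots> = (\<Sum>i\<in>{1..<n}. c i \<bullet> centred i \<omega>)"
        unfolding c_def by (rule sum_inner_innov) (simp add: centred_def)
      also have "\<dots> = Y \<omega> - m"
        unfolding Y_def m_def sum_subtractf[symmetric]
        by (intro sum.cong) (auto simp: centred_def inner_diff_right)
      finally show ?thesis .
    qed
    have EY: "(LINT \<omega>|M. Y \<omega>) = m"
    proof -
      have "(LINT \<omega>|M. c i \<bullet> B (t i) \<omega>) = c i \<bullet> ((t i / t n) *\<^sub>R xn)" if i: "i \<in> {1..<n}" for i
        using integral_inner_right[of "c i" M "B (t i)"] integrable_B[OF i] mean[OF t_in[OF i]] by simp
      then show ?thesis
        unfolding Y_def m_def
        by (subst Bochner_Integration.integral_sum)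
          (auto intro: normal_rv_moments(1)[OF prob_space_axioms normal_rv_inner])
    qed
    have "(LINT \<omega>|M. (Y \<omega> - m)\<^sup>2) = (LINT \<omega>|M. (\<Sum>i\<in>{1..<n}. \<Sum>j\<in>{1..<n}.
        (e i \<bullet> innov (sample n t B \<omega>) i) * (e j \<bullet> innov (sample n t B \<omega>) j)))"
      by (simp only: U[symmetric] dW power2_eq_square sum_product)
    also have "\<dots> = (\<Sum>i\<in>{1..<n}. \<Sum>j\<in>{1..<n}.
        (if i = j then (bscale i)\<^sup>2 else 0) * (e i \<bullet> (\<alpha> *v e j)))"
      by (simp only: cov_innov Bochner_Integration.integral_sum Bochner_Integration.integrable_sum cong: sum.cong)
    also have "\<dots> = (\<Sum>i\<in>{1..<n}. (norm (d i))\<^sup>2)"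
    proof (rule sum.cong[OF refl])
      fix i assume i: "i \<in> {1..<n}"
      have "(\<Sum>j\<in>{1..<n}. (if i = j then (bscale i)\<^sup>2 else 0) * (e i \<bullet> (\<alpha> *v e j))) =
          (\<Sum>j\<in>{1..<n}. if i = j then (bscale i)\<^sup>2 * (e i \<bullet> (\<alpha> *v e j)) else 0)"
        by (intro sum.cong) auto
      also have "\<dots> = (bscale i)\<^sup>2 * (e i \<bullet> (\<alpha> *v e i))"
        using i by simp
      also have "\<dots> = (transpose Q *v d i) \<bullet> (\<alpha> *v (transpose Q *v d i))"
        using bscale_pos[of i] i by (simp add: e_def matrix_vector_mult_scaleR power2_eq_square)
      also have "\<dots> = d i \<bullet> ((Q ** \<alpha> ** transpose Q) *v d i)"
        by (simp add: transpose_matrix_vector[of Q "d i"] dot_lmul_matrix matrix_vector_mul_assoc[symmetric])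
      also have "\<dots> = (norm (d i))\<^sup>2"
        by (simp add: Q power2_norm_eq_inner)
      finally show "(\<Sum>j\<in>{1..<n}. (if i = j then (bscale i)\<^sup>2 else 0) * (e i \<bullet> (\<alpha> *v e j))) = (norm (d i))\<^sup>2" .
    qed
    finally have VY: "(LINT \<omega>|M. (Y \<omega> - m)\<^sup>2) = (\<Sum>i\<in>{1..<n}. (norm (d i))\<^sup>2)" .
    have "(CLINT \<omega>|M. cis (\<Sum>i\<in>{1..<n}. d i \<bullet> W i \<omega>)) = (CLINT \<omega>|M. cis (- m) * cis (Y \<omega>))"
      by (simp only: U cis_mult) simp
    also have "\<dots> = cis (- m) * (CLINT \<omega>|M. cis (Y \<omega>))"
      by (rule integral_mult_right_zero)
    also have "(CLINT \<omega>|M. cis (Y \<omega>)) = cis m * complex_of_real (exp (- (\<Sum>i\<in>{1..<n}. (norm (d i))\<^sup>2) / 2))"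
      by (rule normal_rv_moments(3)[OF prob_space_axioms _ EY VY]) (simp add: Y_def[abs_def] normal_rv_sum)
    also have "cis (- m) * (cis m * complex_of_real (exp (- (\<Sum>i\<in>{1..<n}. (norm (d i))\<^sup>2) / 2))) =
        complex_of_real (exp (- (\<Sum>i\<in>{1..<n}. (norm (d i))\<^sup>2) / 2))"
      by (simp add: mult.assoc[symmetric] cis_mult)
    also have "exp (- (\<Sum>i\<in>{1..<n}. (norm (d i))\<^sup>2) / 2) = (\<Prod>i\<in>{1..<n}. exp (- (norm (d i))\<^sup>2 / 2))"
      by (simp add: exp_sum[symmetric] sum_negf sum_divide_distrib)
    finally show ?thesis .
  qed
  have "distr M (Pi\<^sub>M {1..<n} (\<lambda>_. borel)) (\<lambda>\<omega>. \<lambda>i\<in>{1..<n}. W i \<omega>) = Pi\<^sub>M {1..<n} (\<lambda>_. std_gauss)"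
    by (rule std_gauss_lawI[OF prob_space_axioms _ _ ch]) auto
  then show ?thesis by (simp add: W_def whiten_def)
qed

theorem sample_law_eq_density:
  assumes Q: "Q ** \<alpha> ** transpose Q = mat 1"
  shows "sample_law M n t B = density (sample_space n) (\<lambda>x. ennreal (bridge_density Q x))"
  unfolding sample_law_def
proof (rule sample_law_density[OF _ measurable_sample law_whiten_sample[OF Q]])
  show "(\<alpha> ** transpose Q) ** Q = mat 1"
    using Q matrix_left_right_inverse[of Q "\<alpha> ** transpose Q"] by (simp add: matrix_mul_assoc)
qed

end

section \<open>Continuous densities\<close>

lemma emeasure_lborel_open_pos:
  fixes X :: "'b::euclidean_space set"
  assumes "open X" "X \<noteq> {}"
  shows "emeasure lborel X \<noteq> 0"
proof
  assume "emeasure lborel X = 0"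
  then have "X \<in> null_sets lborel" using assms by auto
  then have "negligible X"
    by (simp add: negligible_iff_null_sets null_sets_completionI)
  then show False using open_not_negligible assms by blast
qed

text \<open>If two continuous densities differ at a point, they differ on a product of open sets
  around it, which has positive measure; but densities of one measure agree almost
  everywhere.\<close>

theorem continuous_density_unique:
  fixes f g :: "('i \<Rightarrow> 'b::euclidean_space) \<Rightarrow> real" and I :: "'i set"
  defines "S \<equiv> Pi\<^sub>M I (\<lambda>_. lborel)"
  assumes I: "finite I"
    and cont: "continuous_on (space S) f" "continuous_on (space S) g"
    and meas: "(\<lambda>x. ennreal (f x)) \<in> borel_measurable S" "(\<lambda>x. ennreal (g x)) \<in> borel_measurable S"
    and nonneg: "\<And>x. x \<in> space S \<Longrightarrow> 0 \<le> f x" "\<And>x. x \<in> space S \<Longrightarrow> 0 \<le> g x"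
    and eq: "density S (\<lambda>x. ennreal (f x)) = density S (\<lambda>x. ennreal (g x))"
    and x: "x \<in> space S"
  shows "f x = g x"
proof (rule ccontr)
  assume neq: "f x \<noteq> g x"
  interpret product_sigma_finite "\<lambda>_::'i. lborel :: 'b measure"
    by standard
  have space_S: "space S = extensional I" by (auto simp: S_def space_PiM PiE_def)
  have ae: "AE y in S. ennreal (f y) = ennreal (g y)"
    using sigma_finite_measure.density_unique[OF sigma_finite[OF I], of "\<lambda>x. ennreal (f x)" "\<lambda>x. ennreal (g x)"]
      meas eq unfolding S_def by simp
  have "openin (top_of_set (space S)) (space S \<inter> (\<lambda>y. f y - g y) -` (- {0}))"
    by (intro continuous_openin_preimage_gen continuous_intros cont)
  then obtain U where U: "open U" "space S \<inter> (\<lambda>y. f y - g y) -` (- {0}) = space S \<inter> U"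
    by (auto simp: openin_open)
  then have "x \<in> U" using x neq by auto
  then obtain X where X: "x \<in> Pi\<^sub>E UNIV X" "\<And>i. open (X i)" "Pi\<^sub>E UNIV X \<subseteq> U"
    using product_topology_open_contains_basis[of "\<lambda>_. euclidean" UNIV U x] U(1)
    by (auto simp: open_fun_def)
  have xX: "x i \<in> X i" for i using X(1) by (auto simp: PiE_iff)
  have E: "Pi\<^sub>E I X \<in> sets S"
    unfolding S_def using I X(2) by (intro sets_PiM_I_finite) auto
  \<comment> \<open>The topology is that of all functions, so the neighbourhood also constrains
    coordinates outside \<open>I\<close>. There every extensional function takes the same value as
    \<open>x\<close>, so only the factors in \<open>I\<close> matter.\<close>
  have sub: "y \<in> space S \<and> y \<in> U" if y: "y \<in> Pi\<^sub>E I X" for y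
  proof -
    have "y i \<in> X i" for i
      using y xX[of i] x by (cases "i \<in> I") (auto simp: PiE_iff space_S extensional_def)
    then show ?thesis using X(3) y by (auto simp: PiE_iff space_S)
  qed
  have "AE y in S. y \<notin> Pi\<^sub>E I X"
    using ae AE_space
  proof eventually_elim
    case (elim y)
    have "f y = g y" using elim nonneg[of y] by simp
    then have "y \<notin> space S \<inter> (\<lambda>y. f y - g y) -` (- {0})" by simp
    then show ?case using sub[of y] U(2) by blast
  qed
  then have "emeasure S (Pi\<^sub>E I X) = 0"
    using AE_iff_measurable[OF E, of "\<lambda>y. y \<notin> Pi\<^sub>E I X"] sets.sets_into_space[OF E] by auto
  moreover have "emeasure S (Pi\<^sub>E I X) = (\<Prod>i\<in>I. emeasure lborel (X i))"
    unfolding S_def using I X(2) by (intro emeasure_PiM) auto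
  ultimately have "\<exists>i\<in>I. emeasure lborel (X i) = 0"
    using I by simp
  then show False using emeasure_lborel_open_pos X(2) xX by blast
qed

section \<open>Simultaneous diagonalization and maximum likelihood\<close>

lemma congruence_component:
  "(Q ** A ** transpose Q) $ i $ j = Q $ i \<bullet> (A *v (Q $ j))" for Q A :: "real^'m^'m"
proof -
  have "Q $ i \<bullet> (A *v (Q $ j)) = (\<Sum>k\<in>UNIV. \<Sum>l\<in>UNIV. Q $ i $ k * A $ k $ l * Q $ j $ l)"
    by (simp add: inner_vec_def matrix_vector_mult_def sum_distrib_left mult_ac)
  also have "\<dots> = (\<Sum>l\<in>UNIV. \<Sum>k\<in>UNIV. Q $ i $ k * A $ k $ l * Q $ j $ l)"
    by (rule sum.swap)
  also have "\<dots> = (Q ** A ** transpose Q) $ i $ j"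
    by (simp add: matrix_matrix_mult_def transpose_def sum_distrib_right)
  finally show ?thesis ..
qed

lemma symmetric_inner:
  "transpose A = A \<Longrightarrow> v \<bullet> (A *v w) = w \<bullet> (A *v v)" for A :: "real^'m^'m"
  by (metis dot_lmul_matrix inner_commute transpose_matrix_vector)

lemma quadratic_nonneg_imp_linear_zero:
  fixes b c :: real
  assumes "\<And>\<epsilon>. 0 \<le> 2 * \<epsilon> * b + \<epsilon>\<^sup>2 * c" and c: "0 \<le> c"
  shows "b = 0"
proof (rule ccontr)
  assume "b \<noteq> 0"
  \<comment> \<open>At -b / u the quadratic is (b / u)^2 (c - 2 u), which is negative once u > c /
    2; adding 1 keeps u positive when c = 0.\<close>
  define u where "u = c + 1"
  have u: "0 < u" "c - 2 * u < 0" using c by (simp_all add: u_def)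
  have "0 \<le> 2 * (- b / u) * b + (- b / u)\<^sup>2 * c" by (rule assms)
  also have "\<dots> = (b / u)\<^sup>2 * (c - 2 * u)"
    using u by (simp add: field_simps power2_eq_square)
  also have "\<dots> < 0"
    using u \<open>b \<noteq> 0\<close> by (intro mult_pos_neg) auto
  finally show False by simp
qed

text \<open>Each new vector maximises the Rayleigh quotient of \<open>S\<close> relative to \<open>A\<close> among the vectors
  that are \<open>A\<close>-orthogonal to the previous ones; the first-order condition is the last clause.\<close>

lemma simultaneous_orthogonal_vectors:
  fixes A S :: "real^'m^'m"
  assumes A: "sym_pos_def A" and S: "transpose S = S"
  shows "k \<le> CARD('m) \<Longrightarrow> \<exists>q :: nat \<Rightarrow> real^'m.
    (\<forall>i<k. \<forall>j<k. q i \<bullet> (A *v q j) = (if i = j then 1 else 0)) \<and>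
    (\<forall>i<k. \<forall>j<k. i \<noteq> j \<longrightarrow> q i \<bullet> (S *v q j) = 0) \<and>
    (\<forall>v. (\<forall>i<k. v \<bullet> (A *v q i) = 0) \<longrightarrow> (\<forall>i<k. v \<bullet> (S *v q i) = 0))"
proof (induction k)
  case 0
  then show ?case by simp
next
  case (Suc k)
  obtain q :: "nat \<Rightarrow> real^'m" where
    q: "\<forall>i<k. \<forall>j<k. q i \<bullet> (A *v q j) = (if i = j then 1 else 0)"
      "\<forall>i<k. \<forall>j<k. i \<noteq> j \<longrightarrow> q i \<bullet> (S *v q j) = 0"
      "\<forall>v. (\<forall>i<k. v \<bullet> (A *v q i) = 0) \<longrightarrow> (\<forall>i<k. v \<bullet> (S *v q i) = 0)"
    using Suc.IH[OF Suc_leD[OF Suc.prems]] by (elim exE conjE) (rule that)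
  note qA = q(1)[rule_format] and qS = q(2)[rule_format]
  have qV: "v \<bullet> (S *v q i) = 0" if "\<forall>i<k. v \<bullet> (A *v q i) = 0" "i < k" for v i
    using q(3) that by blast
  have A_sym: "transpose A = A" and A_pos: "v \<noteq> 0 \<Longrightarrow> 0 < v \<bullet> (A *v v)" for v
    using A by (auto simp: sym_pos_def_def)
  define V where "V = {v. \<forall>i<k. v \<bullet> (A *v q i) = 0}"
  have V_scale: "c *\<^sub>R v \<in> V" if "v \<in> V" for c v using that by (simp add: V_def)
  have V_add: "v + w \<in> V" if "v \<in> V" "w \<in> V" for v w using that by (simp add: V_def inner_add_left)
  \<comment> \<open>Fewer vectors than the dimension leave room for a nonzero vector orthogonal to
    all \<open>A *v q i\<close>; so the unit vectors in \<open>V\<close> form a nonempty compact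
    set.\<close>
  have "dim ((\<lambda>i. A *v q i) ` {..<k}) \<le> card ((\<lambda>i. A *v q i) ` {..<k})"
    by (rule dim_le_card') simp
  also have "\<dots> \<le> k" using card_image_le[of "{..<k}" "\<lambda>i. A *v q i"] by simp
  finally have "dim ((\<lambda>i. A *v q i) ` {..<k}) < DIM(real^'m)" using Suc.prems by simp
  then obtain v1 where v1: "v1 \<noteq> 0" "\<And>y. y \<in> span ((\<lambda>i. A *v q i) ` {..<k}) \<Longrightarrow> orthogonal v1 y"
    using orthogonal_to_subspace_exists by blast
  have "v1 \<in> V"
    using v1(2) by (auto simp: V_def orthogonal_def intro!: span_base)
  then have "(1 / norm v1) *\<^sub>R v1 \<in> V \<inter> sphere 0 1"
    using v1(1) V_scale by simp
  then have ne: "V \<inter> sphere 0 1 \<noteq> {}" by blast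
  have "V = (\<Inter>i\<in>{..<k}. {v. v \<bullet> (A *v q i) = 0})" by (auto simp: V_def)
  then have "closed V" by (auto intro!: closed_INT closed_Collect_eq continuous_intros)
  then have comp: "compact (V \<inter> sphere 0 1)" by (simp add: closed_Int_compact)
  define R where "R v = (v \<bullet> (S *v v)) / (v \<bullet> (A *v v))" for v
  have nz: "\<forall>v\<in>V \<inter> sphere 0 1. v \<bullet> (A *v v) \<noteq> 0"
  proof
    fix v assume "v \<in> V \<inter> sphere 0 1"
    then show "v \<bullet> (A *v v) \<noteq> 0" using A_pos[of v] by (cases "v = 0") auto
  qed
  have "continuous_on (V \<inter> sphere 0 1) R"
    unfolding R_def by (intro continuous_intros matrix_vector_mult_linear_continuous_on nz)
  then obtain v0 where "v0 \<in> V \<inter> sphere 0 1" "\<forall>v\<in>V \<inter> sphere 0 1. R v \<le> R v0"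
    using continuous_attains_sup[OF comp ne] by blast
  then have v0: "v0 \<in> V" "norm v0 = 1" and max: "\<And>v. v \<in> V \<Longrightarrow> norm v = 1 \<Longrightarrow> R v \<le> R v0"
    by auto
  have v0_pos: "0 < v0 \<bullet> (A *v v0)" using A_pos[of v0] v0(2) by (cases "v0 = 0") simp_all
  \<comment> \<open>\<open>g\<close> clears the denominator of the Rayleigh quotient. On
    \<open>V\<close> it is nonnegative, by homogeneity, and it vanishes at \<open>v0\<close>;
    minimality there gives the first-order condition without differentiating a quotient.\<close>
  define g where "g v = R v0 * (v \<bullet> (A *v v)) - v \<bullet> (S *v v)" for v
  have g_nonneg: "0 \<le> g v" if "v \<in> V" for v
  proof (cases "v = 0")
    case False
    have "R ((1 / norm v) *\<^sub>R v) \<le> R v0" using that False by (intro max V_scale) auto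
    moreover have "R ((1 / norm v) *\<^sub>R v) = R v"
      using False by (simp add: R_def matrix_vector_mult_scaleR)
    ultimately have "R v \<le> R v0" by (simp only:)
    then show ?thesis using A_pos[OF False] by (simp add: R_def[of v] g_def pos_divide_le_eq)
  qed (simp add: g_def)
  have first_order: "v \<bullet> (S *v v0) = R v0 * (v \<bullet> (A *v v0))" if "v \<in> V" for v
  proof -
    have "0 \<le> 2 * \<epsilon> * (R v0 * (v \<bullet> (A *v v0)) - v \<bullet> (S *v v0)) + \<epsilon>\<^sup>2 * g v" for \<epsilon>
    proof -
      have "0 \<le> g (v0 + \<epsilon> *\<^sub>R v)" using v0 that by (intro g_nonneg V_add V_scale)
      also have "\<dots> = g v0 + 2 * \<epsilon> * (R v0 * (v \<bullet> (A *v v0)) - v \<bullet> (S *v v0)) + \<epsilon>\<^sup>2 * g v"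
        by (simp add: g_def matrix_vector_right_distrib matrix_vector_mult_scaleR inner_add_left inner_add_right
            symmetric_inner[OF A_sym, of v0 v] symmetric_inner[OF S, of v0 v] power2_eq_square algebra_simps)
      also have "g v0 = 0" using v0_pos by (simp add: g_def R_def)
      finally show ?thesis by simp
    qed
    then show ?thesis using quadratic_nonneg_imp_linear_zero g_nonneg[OF that] by fastforce
  qed
  define q' where "q' = q(k := (1 / sqrt (v0 \<bullet> (A *v v0))) *\<^sub>R v0)"
  have q'_k: "q' k = (1 / sqrt (v0 \<bullet> (A *v v0))) *\<^sub>R v0" and q'_less: "i < k \<Longrightarrow> q' i = q i" for i
    by (simp_all add: q'_def)
  have kA: "q' k \<bullet> (A *v q' i) = 0" "q' i \<bullet> (A *v q' k) = 0"
    and kS: "q' k \<bullet> (S *v q' i) = 0" "q' i \<bullet> (S *v q' k) = 0" if i: "i < k" for i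
  proof -
    have "v0 \<bullet> (A *v q i) = 0" "v0 \<bullet> (S *v q i) = 0"
      using v0(1) i qV[of v0 i] by (auto simp: V_def)
    then show "q' k \<bullet> (A *v q' i) = 0" "q' k \<bullet> (S *v q' i) = 0"
      using i by (simp_all add: q'_k q'_less)
    then show "q' i \<bullet> (A *v q' k) = 0" "q' i \<bullet> (S *v q' k) = 0"
      using symmetric_inner[OF A_sym] symmetric_inner[OF S] by metis+
  qed
  have kk: "q' k \<bullet> (A *v q' k) = 1"
    using v0_pos by (simp add: q'_k matrix_vector_mult_scaleR)
  show ?case
  proof (intro exI[of _ q'] conjI allI impI)
    fix i j assume "i < Suc k" "j < Suc k"
    then show "q' i \<bullet> (A *v q' j) = (if i = j then 1 else 0)"
      using kA kk qA[of i j] by (auto simp: less_Suc_eq q'_less)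
  next
    fix i j assume "i < Suc k" "j < Suc k" "i \<noteq> j"
    then show "q' i \<bullet> (S *v q' j) = 0"
      using kS qS[of i j] by (auto simp: less_Suc_eq q'_less)
  next
    fix v i assume v: "\<forall>i<Suc k. v \<bullet> (A *v q' i) = 0" and i: "i < Suc k"
    have vV: "v \<in> V" using v by (auto simp: V_def less_Suc_eq q'_less)
    show "v \<bullet> (S *v q' i) = 0"
    proof (cases "i = k")
      case True
      have "v \<bullet> (A *v v0) = 0"
        using v[rule_format, of k] v0_pos by (simp add: q'_k matrix_vector_mult_scaleR)
      then show ?thesis
        using True first_order[OF vV] by (simp add: q'_k matrix_vector_mult_scaleR)
    next
      case False
      then show ?thesis using i vV qV[of v i] by (simp add: V_def q'_less)
    qed
  qed
qed

theorem simultaneous_diagonalization: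
  fixes A S :: "real^'m^'m"
  assumes A: "sym_pos_def A" and S: "transpose S = S"
  obtains Q :: "real^'m^'m" and d where "Q ** A ** transpose Q = mat 1"
    and "Q ** S ** transpose Q = (\<chi> i j. if i = j then d i else 0)"
proof -
  obtain q :: "nat \<Rightarrow> real^'m" where
    q: "\<forall>i<CARD('m). \<forall>j<CARD('m). q i \<bullet> (A *v q j) = (if i = j then 1 else 0)"
      "\<forall>i<CARD('m). \<forall>j<CARD('m). i \<noteq> j \<longrightarrow> q i \<bullet> (S *v q j) = 0"
    using simultaneous_orthogonal_vectors[OF A S order_refl] by (elim exE conjE) (rule that)
  note qA = q(1)[rule_format] and qS = q(2)[rule_format]
  obtain h :: "'m \<Rightarrow> nat" where h: "bij_betw h UNIV {0..<CARD('m)}"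
    using ex_bij_betw_finite_nat[of "UNIV :: 'm set"] by auto
  have lt: "h i < CARD('m)" for i using h by (auto simp: bij_betw_def)
  have inj: "h i = h j \<longleftrightarrow> i = j" for i j using h by (auto simp: bij_betw_def inj_on_def)
  define Q :: "real^'m^'m" where "Q = (\<chi> i. q (h i))"
  show thesis
  proof (rule that[of Q "\<lambda>i. q (h i) \<bullet> (S *v q (h i))"])
    show "Q ** A ** transpose Q = mat 1"
      by (simp add: vec_eq_iff congruence_component mat_def) (simp add: Q_def qA lt inj)
    show "Q ** S ** transpose Q = (\<chi> i j. if i = j then q (h i) \<bullet> (S *v q (h i)) else 0)"
      by (simp add: vec_eq_iff congruence_component) (simp add: Q_def qS lt inj)
  qed
qed

text \<open>The value \<open>s\<close> maximises s^N exp(- s^2 d / 2), whose critical point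
  satisfies s^2 d = N. With u = d / N, both claims become ln u <= u - 1 and its equality
  case.\<close>

lemma exp_le_scaled:
  fixes d :: real
  assumes d: "0 < d" and N: "0 < N"
  defines "s \<equiv> sqrt (real N / d)"
  shows "exp (- d / 2) \<le> s ^ N * exp (- (s\<^sup>2 * d) / 2)"
    and "s ^ N * exp (- (s\<^sup>2 * d) / 2) \<le> exp (- d / 2) \<Longrightarrow> d = real N"
proof -
  define u where "u = d / real N"
  have u: "0 < u" using d N by (simp add: u_def)
  have s: "0 < s" using d N by (simp add: s_def)
  have s2: "s\<^sup>2 * d = real N" using d N by (simp add: s_def)
  have "ln s = - (ln u / 2)"
    using d N by (simp add: s_def u_def ln_sqrt ln_div field_simps)
  then have "s = exp (- (ln u / 2))" using s by (metis exp_ln)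
  then have "s ^ N = exp (- (real N * (ln u / 2)))"
    using exp_of_nat_mult[of N "- (ln u / 2)"] by simp
  then have eq: "s ^ N * exp (- (s\<^sup>2 * d) / 2) = exp (- (real N * ln u + real N) / 2)"
    by (simp only: s2) (simp add: exp_add[symmetric] field_simps)
  have d': "d = real N * u" using N by (simp add: u_def)
  have "real N * ln u \<le> real N * (u - 1)" using ln_le_minus_one[OF u] N by (intro mult_left_mono) auto
  then show "exp (- d / 2) \<le> s ^ N * exp (- (s\<^sup>2 * d) / 2)"
    unfolding eq by (simp add: d' algebra_simps)
  assume "s ^ N * exp (- (s\<^sup>2 * d) / 2) \<le> exp (- d / 2)"
  then have "real N * (u - 1) \<le> real N * ln u"
    unfolding eq by (simp add: d' algebra_simps)
  then have "u - 1 \<le> ln u" using N by simp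
  then have "u = 1" using ln_le_minus_one[OF u] ln_eq_minus_one[OF u] by linarith
  then show "d = real N" by (simp add: d')
qed

text \<open>The witness is the inverse of P^T P, written as R R^T with \<open>R\<close> inverse to
  \<open>P\<close>. Every invertible matrix thus whitens some parameter, so rows can be rescaled
  without leaving the parameter set.\<close>

lemma invertible_congruence_sym_pos_def:
  fixes P :: "real^'m^'m"
  assumes "det P \<noteq> 0"
  obtains \<beta> where "sym_pos_def \<beta>" "P ** \<beta> ** transpose P = mat 1"
proof -
  obtain R where R: "P ** R = mat 1" "R ** P = mat 1"
    using assms invertible_det_nz[of P] by (auto simp: invertible_def)
  have nz: "transpose R *v v \<noteq> 0" if "v \<noteq> 0" for v
  proof
    assume "transpose R *v v = 0"
    then have "transpose P *v (transpose R *v v) = 0" by simp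
    then have "transpose (R ** P) *v v = 0"
      by (simp only: matrix_vector_mul_assoc matrix_transpose_mul)
    then show False using that by (simp add: R)
  qed
  have "sym_pos_def (R ** transpose R)"
    unfolding sym_pos_def_def
  proof (intro conjI allI impI)
    show "transpose (R ** transpose R) = R ** transpose R" by (simp add: matrix_transpose_mul)
    fix v :: "real^'m" assume "v \<noteq> 0"
    have "v \<bullet> ((R ** transpose R) *v v) = (transpose R *v v) \<bullet> (transpose R *v v)"
      by (simp add: matrix_vector_mul_assoc[symmetric] dot_lmul_matrix[symmetric] transpose_matrix_vector)
    then show "0 < v \<bullet> ((R ** transpose R) *v v)" using nz[OF \<open>v \<noteq> 0\<close>] by simp
  qed
  moreover have "P ** (R ** transpose R) ** transpose P = (P ** R) ** transpose (P ** R)"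
    by (simp add: matrix_transpose_mul matrix_mul_assoc)
  ultimately show thesis using that R by simp
qed

lemma det_scaled_rows:
  "det (\<chi> k. c k *\<^sub>R (Q $ k)) = prod c UNIV * det (Q :: real^'m^'m)"
  using det_rows_mul[of c "\<lambda>k. Q $ k"] by (simp add: scalar_mult_eq_scaleR)

lemma det_nonzero_if_congruent_identity:
  fixes \<alpha> :: "real^'m^'m"
  assumes "Q ** \<alpha> ** transpose Q = mat 1"
  shows "det Q \<noteq> 0"
proof
  assume "det Q = 0"
  then have "det (Q ** \<alpha> ** transpose Q) = 0" by (simp add: det_mul)
  then show False by (simp add: assms)
qed

text \<open>At a maximiser, rescaling one row of a diagonalising \<open>Q\<close> yields
  competitors, and these force every d_k to equal \<open>N\<close>. Conversely, if S = N alpha, the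
  matrix that diagonalises for an arbitrary competitor becomes a whitening matrix of alpha once all
  its rows are rescaled optimally.\<close>

theorem ml_estimates_gaussian:
  fixes S :: "real^'m^'m" and L :: "real^'m^'m \<Rightarrow> real" and N :: nat
  assumes K: "0 < K" and N: "0 < N" and S: "transpose S = S" and S_nonneg: "\<And>v. 0 \<le> v \<bullet> (S *v v)"
    and L: "\<And>\<alpha> Q. sym_pos_def \<alpha> \<Longrightarrow> Q ** \<alpha> ** transpose Q = mat 1 \<Longrightarrow>
      L \<alpha> = K * \<bar>det Q\<bar> ^ N * exp (- (\<Sum>k\<in>UNIV. Q $ k \<bullet> (S *v (Q $ k))) / 2)"
  shows "{\<alpha>. sym_pos_def \<alpha> \<and> (\<forall>\<alpha>'. sym_pos_def \<alpha>' \<longrightarrow> L \<alpha>' \<le> L \<alpha>)} = {(1 / real N) *\<^sub>R S} \<inter> {\<alpha>. sym_pos_def \<alpha>}"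
proof -
  \<comment> \<open>The likelihood after row k of \<open>Q\<close> is multiplied by
    \<open>c k\<close>, up to the common factor K |det Q|^N: the determinant supplies
    \<open>c k ^ N\<close>, the trace the square times \<open>d k\<close>.\<close>
  define F where "F d c = (\<Prod>k\<in>UNIV. c k ^ N * exp (- ((c k)\<^sup>2 * d k) / 2))" for d c :: "'m \<Rightarrow> real"
  have F_split: "F d (\<lambda>j. if j = k then s else 1) =
      s ^ N * exp (- (s\<^sup>2 * d k) / 2) * (\<Prod>j\<in>UNIV - {k}. exp (- d j / 2))" for d k s
    unfolding F_def by (subst prod.remove[of UNIV k]) (auto intro!: prod.cong)
  have scaled: "Q ** S ** transpose Q = (\<chi> i j. if i = j then d i else 0) \<Longrightarrow> sym_pos_def \<beta> \<Longrightarrow>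
      (\<chi> k. c k *\<^sub>R (Q $ k)) ** \<beta> ** transpose (\<chi> k. c k *\<^sub>R (Q $ k)) = mat 1 \<Longrightarrow> (\<And>k. 0 < c k) \<Longrightarrow>
      L \<beta> = K * \<bar>det Q\<bar> ^ N * F d c" for Q d \<beta> and c :: "'m \<Rightarrow> real"
  proof -
    assume diag: "Q ** S ** transpose Q = (\<chi> i j. if i = j then d i else 0)" and \<beta>: "sym_pos_def \<beta>"
      and Qc: "(\<chi> k. c k *\<^sub>R (Q $ k)) ** \<beta> ** transpose (\<chi> k. c k *\<^sub>R (Q $ k)) = mat 1" and c: "\<And>k. 0 < c k"
    have d: "Q $ k \<bullet> (S *v (Q $ k)) = d k" for k
      using congruence_component[of Q S k k] by (simp add: diag)
    have abs: "\<bar>prod c UNIV\<bar> = prod c UNIV" using c by (simp add: prod_pos less_imp_le)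
    have "exp (- (\<Sum>k\<in>UNIV. (c k)\<^sup>2 * d k) / 2) = (\<Prod>k\<in>UNIV. exp (- ((c k)\<^sup>2 * d k) / 2))"
      by (simp add: exp_sum[symmetric] sum_negf sum_divide_distrib)
    moreover have "L \<beta> = K * \<bar>prod c UNIV * det Q\<bar> ^ N * exp (- (\<Sum>k\<in>UNIV. (c k)\<^sup>2 * d k) / 2)"
      using L[OF \<beta> Qc] by (simp add: det_scaled_rows matrix_vector_mult_scaleR d power2_eq_square mult.assoc)
    ultimately show ?thesis
      by (simp add: F_def abs_mult abs power_mult_distrib prod_power_distrib[symmetric] prod.distrib mult_ac)
  qed
  have one: "(\<chi> k. 1 *\<^sub>R (Q $ k)) = Q" for Q :: "real^'m^'m" by (simp add: vec_eq_iff)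
  show ?thesis
  proof (intro equalityI subsetI)
    fix \<alpha> assume "\<alpha> \<in> {\<alpha>. sym_pos_def \<alpha> \<and> (\<forall>\<alpha>'. sym_pos_def \<alpha>' \<longrightarrow> L \<alpha>' \<le> L \<alpha>)}"
    then have \<alpha>: "sym_pos_def \<alpha>" and max: "\<And>\<alpha>'. sym_pos_def \<alpha>' \<Longrightarrow> L \<alpha>' \<le> L \<alpha>" by auto
    obtain Q :: "real^'m^'m" and d where Q: "Q ** \<alpha> ** transpose Q = mat 1"
      and diag: "Q ** S ** transpose Q = (\<chi> i j. if i = j then d i else 0)"
      by (rule simultaneous_diagonalization[OF \<alpha> S])
    have dk: "Q $ k \<bullet> (S *v (Q $ k)) = d k" for k
      using congruence_component[of Q S k k] by (simp add: diag)
    have pos: "0 < K * \<bar>det Q\<bar> ^ N" using K det_nonzero_if_congruent_identity[OF Q] by simp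
    \<comment> \<open>Only row \<open>k\<close> changes, so the factors of the other rows cancel
      from the comparison.\<close>
    have gain: "s ^ N * exp (- (s\<^sup>2 * d k) / 2) \<le> exp (- d k / 2)" if s: "0 < s" for s k
    proof -
      let ?c = "\<lambda>j. if j = k then s else 1"
      have "prod ?c UNIV \<noteq> 0" using s by simp
      then have "det (\<chi> k. ?c k *\<^sub>R (Q $ k)) \<noteq> 0"
        unfolding det_scaled_rows using det_nonzero_if_congruent_identity[OF Q] by simp
      then obtain \<beta> where \<beta>: "sym_pos_def \<beta>"
        "(\<chi> k. ?c k *\<^sub>R (Q $ k)) ** \<beta> ** transpose (\<chi> k. ?c k *\<^sub>R (Q $ k)) = mat 1"
        using invertible_congruence_sym_pos_def by blast
      have "L \<beta> = K * \<bar>det Q\<bar> ^ N * F d ?c"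
        by (rule scaled[OF diag \<beta>]) (use s in simp)
      \<comment> \<open>Rescaling by 1, written as an \<open>if\<close> so that
        \<open>F_split\<close> applies to this side too.\<close>
      moreover have "L \<alpha> = K * \<bar>det Q\<bar> ^ N * F d (\<lambda>j. if j = k then 1 else 1)"
        by (rule scaled[OF diag \<alpha>]) (simp_all add: one Q)
      ultimately have "F d ?c \<le> F d (\<lambda>j. if j = k then 1 else 1)"
        using max[OF \<beta>(1)] pos by (simp only: mult_le_cancel_left_pos)
      moreover have "0 < (\<Prod>j\<in>UNIV - {k}. exp (- d j / 2))" by (intro prod_pos) simp
      ultimately show ?thesis
        unfolding F_split by (simp add: mult_le_cancel_right_pos)
    qed
    have dN: "d k = real N" for k
    proof -
      have "0 \<le> d k" using S_nonneg[of "Q $ k"] by (simp add: dk)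
      \<comment> \<open>If \<open>d k\<close> were 0, the exponential would not penalise row
        \<open>k\<close>, and doubling that row would multiply the likelihood by 2^N.\<close>
      moreover have "d k \<noteq> 0"
      proof
        assume "d k = 0"
        then have "(2::real) ^ N \<le> 1" using gain[of 2 k] by simp
        then show False using one_less_power[OF _ N, of "2::real"] by linarith
      qed
      ultimately have "0 < d k" by simp
      \<comment> \<open>\<open>gain\<close> is tested at the optimal factor; that even this factor
        gains nothing is the equality case.\<close>
      then show ?thesis by (rule exp_le_scaled(2)[OF _ N gain]) (use \<open>0 < d k\<close> N in simp)
    qed
    have "Q ** S ** transpose Q = real N *\<^sub>R (Q ** \<alpha> ** transpose Q)"
      unfolding Q diag by (simp add: vec_eq_iff mat_def dN)
    then have QSQ: "Q ** S ** transpose Q = Q ** (real N *\<^sub>R \<alpha>) ** transpose Q"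
      by (simp add: scalar_matrix_assoc matrix_scalar_ac)
    have "invertible Q" using det_nonzero_if_congruent_identity[OF Q] by (simp add: invertible_det_nz)
    then obtain R where R: "R ** Q = mat 1" "Q ** R = mat 1" by (auto simp: invertible_def)
    have cancel: "R ** (Q ** X ** transpose Q) ** transpose R = X" for X
    proof -
      have "R ** (Q ** X ** transpose Q) ** transpose R = (R ** Q) ** X ** transpose (R ** Q)"
        by (simp add: matrix_transpose_mul matrix_mul_assoc)
      then show ?thesis by (simp add: R)
    qed
    have "S = real N *\<^sub>R \<alpha>" using arg_cong[OF QSQ, of "\<lambda>X. R ** X ** transpose R"] by (simp only: cancel)
    then show "\<alpha> \<in> {(1 / real N) *\<^sub>R S} \<inter> {\<alpha>. sym_pos_def \<alpha>}" using \<alpha> N by simp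
  next
    fix \<alpha> assume "\<alpha> \<in> {(1 / real N) *\<^sub>R S} \<inter> {\<alpha>. sym_pos_def \<alpha>}"
    then have \<alpha>: "sym_pos_def \<alpha>" and S_eq: "S = real N *\<^sub>R \<alpha>" using N by auto
    have "L \<alpha>' \<le> L \<alpha>" if \<alpha>': "sym_pos_def \<alpha>'" for \<alpha>'
    proof -
      obtain Q :: "real^'m^'m" and d where Q: "Q ** \<alpha>' ** transpose Q = mat 1"
        and diag: "Q ** S ** transpose Q = (\<chi> i j. if i = j then d i else 0)"
        by (rule simultaneous_diagonalization[OF \<alpha>' S])
      have comp: "real N * (Q $ i \<bullet> (\<alpha> *v (Q $ j))) = (if i = j then d i else 0)" for i j
        using congruence_component[of Q S i j] unfolding diag
        by (simp add: S_eq scaleR_matrix_vector_assoc[symmetric])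
      have d_pos: "0 < d k" for k
      proof -
        have "Q $ k \<noteq> 0"
        proof
          assume "Q $ k = 0"
          then have "(Q ** \<alpha>' ** transpose Q) $ k $ k = 0" by (simp add: congruence_component)
          then show False by (simp add: Q mat_def)
        qed
        then have "0 < Q $ k \<bullet> (\<alpha> *v (Q $ k))" using \<alpha> by (simp add: sym_pos_def_def)
        then show ?thesis using comp[of k k] N by (metis mult_pos_pos of_nat_0_less_iff)
      qed
      \<comment> \<open>As S = N alpha, the matrix Q alpha Q^T is diagonal with entries
        \<open>d k / real N\<close>. These factors normalise it to the identity, and they are also
        the optimal ones of \<open>exp_le_scaled\<close>.\<close>
      define c where "c k = sqrt (real N / d k)" for k
      have c_pos: "0 < c k" for k using d_pos[of k] N by (simp add: c_def)
      have "(\<chi> k. c k *\<^sub>R (Q $ k)) ** \<alpha> ** transpose (\<chi> k. c k *\<^sub>R (Q $ k)) = mat 1"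
      proof (simp only: vec_eq_iff, intro allI)
        fix i j
        have "((\<chi> k. c k *\<^sub>R (Q $ k)) ** \<alpha> ** transpose (\<chi> k. c k *\<^sub>R (Q $ k))) $ i $ j =
            c i * c j * (Q $ i \<bullet> (\<alpha> *v (Q $ j)))"
          by (simp add: congruence_component matrix_vector_mult_scaleR)
        also have "\<dots> = c i * c j * ((if i = j then d i else 0) / real N)"
          using comp[of i j] N by (simp add: field_simps)
        also have "\<dots> = mat 1 $ i $ j"
          using d_pos[of i] N by (auto simp: mat_def c_def)
        finally show "((\<chi> k. c k *\<^sub>R (Q $ k)) ** \<alpha> ** transpose (\<chi> k. c k *\<^sub>R (Q $ k))) $ i $ j = mat 1 $ i $ j" .
      qed
      then have "L \<alpha> = K * \<bar>det Q\<bar> ^ N * F d c"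
        by (rule scaled[OF diag \<alpha>]) (rule c_pos)
      moreover have "L \<alpha>' = K * \<bar>det Q\<bar> ^ N * F d (\<lambda>_. 1)"
        by (rule scaled[OF diag \<alpha>']) (simp_all add: one Q)
      moreover have "F d (\<lambda>_. 1) \<le> F d c"
        unfolding F_def c_def using exp_le_scaled(1)[OF d_pos N] by (intro prod_mono) auto
      ultimately show ?thesis using K by (simp add: mult_left_mono)
    qed
    then show "\<alpha> \<in> {\<alpha>. sym_pos_def \<alpha> \<and> (\<forall>\<alpha>'. sym_pos_def \<alpha>' \<longrightarrow> L \<alpha>' \<le> L \<alpha>)}" using \<alpha> by simp
  qed
qed

section \<open>Likelihood of a bridge sample in terms of its scatter matrix\<close>

context sampling_times
begin

definition scatter :: "(nat \<Rightarrow> real^'m) \<Rightarrow> real^'m^'m" where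
  "scatter x = (\<Sum>i\<in>{1..<n}. (1 / (bscale i)\<^sup>2) *\<^sub>R outer (innov x i) (innov x i))"

lemma inner_scatter:
  "v \<bullet> (scatter x *v w) = (\<Sum>i\<in>{1..<n}. (1 / (bscale i)\<^sup>2) * ((v \<bullet> innov x i) * (w \<bullet> innov x i)))"
proof -
  have "scatter x *v w = (\<Sum>i\<in>{1..<n}. ((1 / (bscale i)\<^sup>2) *\<^sub>R outer (innov x i) (innov x i)) *v w)"
    unfolding scatter_def
    by (induction rule: infinite_finite_induct[of _ "{1..<n}"]) (auto simp: matrix_vector_mult_add_rdistrib)
  then show ?thesis
    by (simp add: inner_sum_right scaleR_matrix_vector_assoc[symmetric] inner_outer)
qed

lemma transpose_scatter: "transpose (scatter x) = scatter x"
  by (simp add: scatter_def transpose_def vec_eq_iff outer_def mult.commute)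

text \<open>The vector t_{i+1} x_i - t_i x_{i+1} is t_{i+1} times the residual, and t_{i+1}^2 turns
  the weight of the estimator into 1 / s_i^2.\<close>

lemma alpha_hat_eq_scatter: "alpha_hat n t (x(n := xn)) = (1 / real (n - 1)) *\<^sub>R scatter x"
proof -
  have "(1 / (t i * t (i + 1) * (t (i + 1) - t i))) *\<^sub>R
      outer (t (i + 1) *\<^sub>R (x(n := xn)) i - t i *\<^sub>R (x(n := xn)) (i + 1)) (t (i + 1) *\<^sub>R (x(n := xn)) i - t i *\<^sub>R (x(n := xn)) (i + 1)) =
      (1 / (bscale i)\<^sup>2) *\<^sub>R outer (innov x i) (innov x i)" if i: "i \<in> {1..<n}" for i
  proof -
    have pos: "0 < t i" "0 < t (Suc i)" "0 < t (Suc i) - t i"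
      using i t_gt_0[of i] t_gt_0[of "Suc i"] t_less_Suc[of i] by auto
    have s2: "(bscale i)\<^sup>2 = t i * (t (Suc i) - t i) / t (Suc i)"
      using pos by (simp add: bscale_def)
    have "t (i + 1) *\<^sub>R (x(n := xn)) i - t i *\<^sub>R (x(n := xn)) (i + 1) = t (Suc i) *\<^sub>R innov x i"
      using i pos by (simp add: innov_def scaleR_diff_right Suc_eq_plus1[symmetric] del: Suc_eq_plus1)
    moreover have "outer (t (Suc i) *\<^sub>R v) (t (Suc i) *\<^sub>R v) = (t (Suc i))\<^sup>2 *\<^sub>R outer v v" for v :: "real^'m"
      by (simp add: outer_def vec_eq_iff power2_eq_square)
    moreover have "1 / (t i * t (Suc i) * (t (Suc i) - t i)) * (t (Suc i))\<^sup>2 = 1 / (bscale i)\<^sup>2"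
    proof -
      have "1 / (a * b * c) * b\<^sup>2 = 1 / (a * c / b)" if "0 < a" "0 < b" "0 < c" for a b c :: real
        using that by (simp add: field_simps power2_eq_square)
      then show ?thesis unfolding s2 using pos by blast
    qed
    ultimately show ?thesis by (simp only: scaleR_scaleR) (simp add: Suc_eq_plus1[symmetric] del: Suc_eq_plus1)
  qed
  then have "(\<Sum>i\<in>{1..<n}. (1 / (t i * t (i + 1) * (t (i + 1) - t i))) *\<^sub>R
      outer (t (i + 1) *\<^sub>R (x(n := xn)) i - t i *\<^sub>R (x(n := xn)) (i + 1)) (t (i + 1) *\<^sub>R (x(n := xn)) i - t i *\<^sub>R (x(n := xn)) (i + 1))) =
      scatter x"
    unfolding scatter_def by (rule sum.cong[OF refl])
  moreover have "{1..n - 1} = {1..<n}" using n by auto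
  moreover have "real n - 1 = real (n - 1)" using n by (simp add: of_nat_diff)
  ultimately show ?thesis by (simp only: alpha_hat_def)
qed

definition density_const :: real where
  "density_const = (\<Prod>i\<in>{1..<n}. (1 / bscale i) ^ CARD('m) * (2 * pi) powr (- real CARD('m) / 2))"

lemma density_const_pos: "0 < density_const"
  unfolding density_const_def using bscale_pos by (intro prod_pos) auto

text \<open>The exponent is a double sum over residuals and rows of \<open>Q\<close>; exchanging the
  two sums leaves the sample only inside \<open>scatter\<close>.\<close>

lemma bridge_density_eq_scatter:
  "bridge_density Q x = density_const * \<bar>det Q\<bar> ^ (n - 1) * exp (- (\<Sum>k\<in>UNIV. Q $ k \<bullet> (scatter x *v (Q $ k))) / 2)"
proof -
  define e where "e i = (norm (((1 / bscale i) *\<^sub>R Q) *v innov x i))\<^sup>2" for i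
  have e: "e i = (\<Sum>k\<in>UNIV. (1 / (bscale i)\<^sup>2) * ((Q $ k \<bullet> innov x i) * (Q $ k \<bullet> innov x i)))" for i
  proof -
    have "(((1 / bscale i) *\<^sub>R Q) *v innov x i) $ k = (1 / bscale i) * (Q $ k \<bullet> innov x i)" for k
      by (simp add: scaleR_matrix_vector_assoc[symmetric] matrix_vector_mul_component)
    then have "e i = (\<Sum>k\<in>UNIV. ((1 / bscale i) * (Q $ k \<bullet> innov x i))\<^sup>2)"
      unfolding e_def power2_norm_eq_inner
      by (subst inner_vec_def) (simp only: inner_real_def power2_eq_square)
    then show ?thesis by (simp add: power2_eq_square mult_ac)
  qed
  have "(\<Sum>k\<in>UNIV. Q $ k \<bullet> (scatter x *v (Q $ k))) = (\<Sum>i\<in>{1..<n}. e i)"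
    unfolding inner_scatter e by (rule sum.swap)
  moreover have "exp (- (\<Sum>i\<in>{1..<n}. e i) / 2) = (\<Prod>i\<in>{1..<n}. exp (- e i / 2))"
    by (simp add: exp_sum[symmetric] sum_negf sum_divide_distrib)
  moreover have "bridge_density Q x = (\<Prod>i\<in>{1..<n}. ((1 / bscale i) ^ CARD('m) * (2 * pi) powr (- real CARD('m) / 2)) *
      \<bar>det Q\<bar> * exp (- e i / 2))"
    unfolding bridge_density_def
  proof (rule prod.cong[OF refl])
    fix i assume "i \<in> {1..<n}"
    then have "0 < bscale i" using bscale_pos[of i] by simp
    then show "\<bar>det ((1 / bscale i) *\<^sub>R Q)\<bar> * gauss_density (((1 / bscale i) *\<^sub>R Q) *v innov x i) =
        (1 / bscale i) ^ CARD('m) * (2 * pi) powr (- real CARD('m) / 2) * \<bar>det Q\<bar> * exp (- e i / 2)"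
      by (simp add: gauss_density_def det_scaleR abs_mult e_def power_abs)
  qed
  ultimately show ?thesis
    by (simp only: prod.distrib density_const_def prod_constant) (simp add: mult_ac)
qed

theorem ml_estimates_bridge:
  assumes L: "\<And>\<alpha> Q. sym_pos_def \<alpha> \<Longrightarrow> Q ** \<alpha> ** transpose Q = mat 1 \<Longrightarrow> L \<alpha> x = bridge_density Q x"
  shows "ml_estimates {\<alpha>. sym_pos_def \<alpha>} L x = {alpha_hat n t (x(n := xn))} \<inter> {\<alpha>. sym_pos_def \<alpha>}"
proof -
  have "0 \<le> v \<bullet> (scatter x *v v)" for v
    unfolding inner_scatter by (intro sum_nonneg mult_nonneg_nonneg[OF _ zero_le_square]) simp
  then have "{\<alpha>. sym_pos_def \<alpha> \<and> (\<forall>\<alpha>'. sym_pos_def \<alpha>' \<longrightarrow> L \<alpha>' x \<le> L \<alpha> x)} =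
      {(1 / real (n - 1)) *\<^sub>R scatter x} \<inter> {\<alpha>. sym_pos_def \<alpha>}"
    using n by (intro ml_estimates_gaussian[OF density_const_pos])
      (auto simp: transpose_scatter L bridge_density_eq_scatter)
  then show ?thesis by (simp add: ml_estimates_def alpha_hat_eq_scatter)
qed

end

section \<open>Sufficiency\<close>

text \<open>The easy half of the Fisher--Neyman factorization criterion: the likelihood ratio with respect to
  a reference parameter is measurable with respect to \<open>T\<close>, so it can be moved in and out of the
  conditional expectation.\<close>

theorem sufficient_statisticI:
  fixes T :: "'x \<Rightarrow> 'y" and h :: "'p \<Rightarrow> 'y \<Rightarrow> real"
  assumes T [measurable]: "T \<in> measurable S N" and \<theta>0: "\<theta>0 \<in> \<Theta>"
    and h [measurable]: "\<And>\<theta>. \<theta> \<in> \<Theta> \<Longrightarrow> h \<theta> \<in> borel_measurable N"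
    and h_pos: "\<And>\<theta> y. \<theta> \<in> \<Theta> \<Longrightarrow> 0 < h \<theta> y"
    and P: "\<And>\<theta>. \<theta> \<in> \<Theta> \<Longrightarrow> P \<theta> = density S (\<lambda>x. ennreal (h \<theta> (T x)))"
    and prob: "\<And>\<theta>. \<theta> \<in> \<Theta> \<Longrightarrow> prob_space (P \<theta>)"
  shows "sufficient_statistic \<Theta> P S N T"
  unfolding sufficient_statistic_def
proof (intro conjI ballI T)
  fix A assume A [measurable]: "A \<in> sets S"
  define F where "F = vimage_algebra (space S) T N"
  have sub_S: "sets F \<subseteq> sets S"
    unfolding F_def by (subst sets_vimage_algebra2) (use T in \<open>auto simp: measurable_def\<close>)
  have sub: "subalgebra (P \<theta>) F" if "\<theta> \<in> \<Theta>" for \<theta>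
    using sub_S by (simp add: subalgebra_def P[OF that] F_def)
  have TF [measurable]: "T \<in> measurable F N"
    unfolding F_def by (rule measurable_vimage_algebra1) (use T in \<open>auto simp: measurable_def\<close>)
  interpret P0: prob_space "P \<theta>0" by (rule prob[OF \<theta>0])
  interpret P0: finite_measure_subalgebra "P \<theta>0" F
    by (simp add: finite_measure_subalgebra_def P0.finite_measure_axioms finite_measure_subalgebra_axioms_def sub \<theta>0)
  \<comment> \<open>The conditional probability under the reference parameter is the candidate for
    the common version.\<close>
  define g where "g = real_cond_exp (P \<theta>0) F (indicator A)"
  have gF [measurable]: "g \<in> borel_measurable F" by (simp add: g_def)
  have gS [measurable]: "g \<in> borel_measurable S"
    using sub_S gF by (intro measurable_from_subalg[of S F]) (auto simp: subalgebra_def F_def)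
  show "\<exists>g\<in>borel_measurable (vimage_algebra (space S) T N). \<forall>\<theta>\<in>\<Theta>.
      AE x in P \<theta>. real_cond_exp (P \<theta>) (vimage_algebra (space S) T N) (indicator A) x = g x"
    unfolding F_def[symmetric]
  proof (rule bexI[OF _ gF], rule ballI)
    fix \<theta> assume \<theta>: "\<theta> \<in> \<Theta>"
    interpret P1: prob_space "P \<theta>" by (rule prob[OF \<theta>])
    interpret P1: finite_measure_subalgebra "P \<theta>" F
      by (simp add: finite_measure_subalgebra_def P1.finite_measure_axioms finite_measure_subalgebra_axioms_def sub \<theta>)
    note [measurable] = h[OF \<theta>] h[OF \<theta>0]
    define \<rho> where "\<rho> x = h \<theta> (T x) / h \<theta>0 (T x)" for x
    have \<rho>F [measurable]: "\<rho> \<in> borel_measurable F" unfolding \<rho>_def by measurable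
    have \<rho>S [measurable]: "\<rho> \<in> borel_measurable S" unfolding \<rho>_def by measurable
    have \<rho>_pos: "0 < \<rho> x" for x by (simp add: \<rho>_def h_pos \<theta> \<theta>0)
    have sets_P0 [measurable_cong]: "sets (P \<theta>0) = sets S" and sets_P1 [measurable_cong]: "sets (P \<theta>) = sets S"
      by (simp_all add: P \<theta> \<theta>0)
    have "density (P \<theta>0) (\<lambda>x. ennreal (\<rho> x)) = density S (\<lambda>x. ennreal (h \<theta>0 (T x)) * ennreal (\<rho> x))"
      unfolding P[OF \<theta>0] by (rule density_density_eq) simp_all
    also have "\<dots> = P \<theta>"
      unfolding P[OF \<theta>] \<rho>_def
      by (intro arg_cong[of _ _ "density S"] ext)
        (simp add: ennreal_mult'[symmetric] less_imp_le[OF h_pos[OF \<theta>0]] less_imp_neq[OF h_pos[OF \<theta>0], symmetric])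
    finally have P\<rho>: "P \<theta> = density (P \<theta>0) (\<lambda>x. ennreal (\<rho> x))" ..
    have lint: "(LINT x|P \<theta>. f x) = (LINT x|P \<theta>0. \<rho> x * f x)"
      and integrable: "integrable (P \<theta>) f \<longleftrightarrow> integrable (P \<theta>0) (\<lambda>x. \<rho> x * f x)"
      if [measurable]: "f \<in> borel_measurable S" for f :: "'x \<Rightarrow> real"
      unfolding P\<rho> using \<rho>_pos
      by (simp_all add: integral_density integrable_density less_imp_le)
    have int_ind: "integrable (P \<theta>0) (\<lambda>x. \<rho> x * (indicator B x * indicator A x))" if [measurable]: "B \<in> sets S" for B
    proof -
      have "integrable (P \<theta>) (\<lambda>x. indicator B x * indicator A x :: real)"
        by (rule P1.integrable_const_bound[of _ 1]) (auto simp: indicator_def)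
      then show ?thesis by (subst (asm) integrable) auto
    qed
    \<comment> \<open>\<rho> times the indicator of \<open>B\<close> is measurable with respect to
      \<open>F\<close> and so passes through the conditional expectation under the reference
      parameter. Since \<rho> is the density of \<open>P \<theta>\<close>, this says that
      \<open>g\<close> has the right integral over \<open>B\<close> under
      \<open>P \<theta>\<close>.\<close>
    have cond: "integrable (P \<theta>0) (\<lambda>x. \<rho> x * (indicator B x * g x))"
      "(LINT x|P \<theta>0. \<rho> x * (indicator B x * g x)) = (LINT x|P \<theta>0. \<rho> x * (indicator B x * indicator A x))"
      if B: "B \<in> sets F" for B
    proof -
      have [measurable]: "B \<in> sets S" "B \<in> sets F" using B sub_S by auto
      have "(\<lambda>x. \<rho> x * indicator B x) \<in> borel_measurable F" by measurable
      moreover have "integrable (P \<theta>0) (\<lambda>x. \<rho> x * indicator B x * indicator A x)"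
        using int_ind[of B] by (simp add: mult.assoc)
      moreover have "indicator A \<in> borel_measurable (P \<theta>0)" by measurable
      ultimately show "integrable (P \<theta>0) (\<lambda>x. \<rho> x * (indicator B x * g x))"
        "(LINT x|P \<theta>0. \<rho> x * (indicator B x * g x)) = (LINT x|P \<theta>0. \<rho> x * (indicator B x * indicator A x))"
        using P0.real_cond_exp_intg[of "\<lambda>x. \<rho> x * indicator B x" "indicator A"]
        by (simp_all add: g_def mult.assoc)
    qed
    show "AE x in P \<theta>. real_cond_exp (P \<theta>) F (indicator A) x = g x"
    proof (rule P1.real_cond_exp_charact)
      fix B assume B: "B \<in> sets F"
      then have [measurable]: "B \<in> sets S" using sub_S by auto
      show "(LINT x:B|P \<theta>. indicator A x) = (LINT x:B|P \<theta>. g x)"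
        unfolding set_lebesgue_integral_def real_scaleR_def
        by (simp add: lint cond(2)[OF B])
    next
      show "integrable (P \<theta>) (indicator A :: 'x \<Rightarrow> real)"
        by (rule P1.integrable_const_bound[of _ 1]) (auto simp: indicator_def)
      \<comment> \<open>With the whole space as \<open>B\<close>, the first part of
        \<open>cond\<close> is the integrability of \<open>g\<close> under the new
        parameter.\<close>
      have "space S \<in> sets F" by (metis F_def sets.top space_vimage_algebra)
      then have "integrable (P \<theta>0) (\<lambda>x. \<rho> x * (indicator (space S) x * g x))" by (rule cond(1))
      then have "integrable (P \<theta>0) (\<lambda>x. \<rho> x * g x)"
        by (rule Bochner_Integration.integrable_cong[THEN iffD1, rotated -1])
          (auto simp: P[OF \<theta>0])
      then show "integrable (P \<theta>) g" by (subst integrable) auto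
    qed (rule gF)
  qed
qed

section \<open>Almost sure positive definiteness\<close>

lemma AE_std_gauss_hyperplane:
  fixes a :: "'b::euclidean_space"
  assumes "a \<noteq> 0"
  shows "AE x in std_gauss. a \<bullet> x \<noteq> 0"
proof -
  have closed: "closed {x. a \<bullet> x = 0}" by (rule closed_hyperplane)
  have "negligible {x. a \<bullet> x = 0}" by (rule negligible_hyperplane) (use assms in simp)
  then have "{x. a \<bullet> x = 0} \<in> null_sets lebesgue" by (simp add: negligible_iff_null_sets)
  then have "{x. a \<bullet> x = 0} \<in> null_sets lborel"
    using borel_closed[OF closed] by (subst (asm) null_sets_completion_iff) auto
  then have "AE x in lborel. a \<bullet> x \<noteq> 0" by (rule AE_I') auto
  then show ?thesis
    unfolding std_gauss_eq_density by (subst AE_density) auto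
qed

text \<open>The vector \<open>a\<close> consists of the cofactors along row \<open>j\<close> and
  depends on the other rows only.\<close>

lemma det_row_linear:
  fixes c :: "'m::finite \<Rightarrow> real^'m"
  shows "\<exists>a. \<forall>y. det (\<chi> k. if k = j then y else c k) = a \<bullet> y"
proof -
  define D where "D y = det (\<chi> k. if k = j then y else c k)" for y
  have lin: "linear D"
  proof (rule linearI)
    fix y z r
    show "D (y + z) = D y + D z" unfolding D_def by (rule det_row_add)
    show "D (r *\<^sub>R y) = r *\<^sub>R D y"
      using det_row_mul[of j r "\<lambda>_. y" c] by (simp only: D_def scalar_mult_eq_scaleR real_scaleR_def)
  qed
  have "D y = (\<Sum>b\<in>Basis. D b *\<^sub>R b) \<bullet> y" for y
  proof -
    have "D y = D (\<Sum>b\<in>Basis. (y \<bullet> b) *\<^sub>R b)" by (simp only: euclidean_representation)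
    also have "\<dots> = (\<Sum>b\<in>Basis. (y \<bullet> b) *\<^sub>R D b)"
      by (simp only: linear_sum[OF lin] linear_scale[OF lin])
    also have "\<dots> = (\<Sum>b\<in>Basis. D b *\<^sub>R b) \<bullet> y"
      unfolding inner_sum_left by (intro sum.cong) (simp_all add: inner_commute[of y])
    finally show ?thesis .
  qed
  then show ?thesis unfolding D_def by blast
qed

text \<open>The rows of the identity matrix are replaced by random vectors one at a time. With the
  earlier rows fixed, the determinant is a nonzero linear functional of the new row, whose kernel is
  a hyperplane and hence a null set.\<close>

lemma AE_std_gauss_det:
  fixes \<sigma> :: "'m::finite \<Rightarrow> 'i"
  assumes \<sigma>: "inj \<sigma>" and J: "finite J"
  shows "AE w in Pi\<^sub>M (\<sigma> ` J) (\<lambda>_. std_gauss :: (real^'m) measure).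
    det (\<chi> k. if k \<in> J then w (\<sigma> k) else axis k 1) \<noteq> 0"
  using J
proof (induction J)
  case empty
  have "(\<chi> k. axis k 1) = (mat 1 :: real^'m^'m)" by (simp add: vec_eq_iff axis_def mat_def)
  then show ?case by simp
next
  case (insert j J)
  interpret product_sigma_finite "\<lambda>_::'i. std_gauss :: (real^'m) measure"
    by standard
  define D where "D K w = det (\<chi> k. if k \<in> K then w (\<sigma> k) else axis k 1 :: real^'m^'m)" for K and w :: "'i \<Rightarrow> real^'m"
  have meas [measurable]: "D K \<in> borel_measurable (Pi\<^sub>M (\<sigma> ` K) (\<lambda>_. std_gauss))" for K
  proof -
    have "(\<lambda>w. (\<chi> k. if k \<in> K then w (\<sigma> k) else axis k 1 :: real^'m^'m) $ k $ l) \<in>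
        borel_measurable (Pi\<^sub>M (\<sigma> ` K) (\<lambda>_. std_gauss))" for k l
    proof (cases "k \<in> K")
      case True
      then have "(\<lambda>w. w (\<sigma> k)) \<in> measurable (Pi\<^sub>M (\<sigma> ` K) (\<lambda>_. std_gauss)) (std_gauss :: (real^'m) measure)"
        by (intro measurable_component_singleton) auto
      then have component: "(\<lambda>w. w (\<sigma> k)) \<in> borel_measurable (Pi\<^sub>M (\<sigma> ` K) (\<lambda>_. std_gauss :: (real^'m) measure))"
        by (subst (asm) measurable_cong_sets[OF refl sets_std_gauss])
      have nth: "(\<lambda>x :: real^'m. x $ l) \<in> borel_measurable borel"
        by (intro borel_measurable_continuous_onI continuous_intros)
      show ?thesis using measurable_compose[OF component nth] True by simp
    qed simp
    then show ?thesis unfolding D_def det_def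
      by (intro borel_measurable_sum borel_measurable_times borel_measurable_prod borel_measurable_const)
  qed
  have j: "\<sigma> j \<notin> \<sigma> ` J" "finite (\<sigma> ` J)" using insert \<sigma> by (auto simp: inj_def)
  have slice: "AE y in std_gauss. D (insert j J) (w(\<sigma> j := y)) \<noteq> 0" if w: "D J w \<noteq> 0" for w
  proof -
    obtain a where a: "\<And>y. det (\<chi> k. if k = j then y else (if k \<in> J then w (\<sigma> k) else axis k 1)) = a \<bullet> y"
      using det_row_linear[of j "\<lambda>k. if k \<in> J then w (\<sigma> k) else axis k 1"] by auto
    have "(if k \<in> insert j J then (w(\<sigma> j := y)) (\<sigma> k) else axis k 1) =
        (if k = j then y else (if k \<in> J then w (\<sigma> k) else axis k 1))" for k y
      using \<sigma> by (auto simp: inj_def)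
    then have ins: "D (insert j J) (w(\<sigma> j := y)) = a \<bullet> y" for y
      unfolding D_def a[symmetric] by (simp only:)
    \<comment> \<open>Putting the unit vector back into row \<open>j\<close> restores the previous
      determinant, which is nonzero; so \<open>a\<close> is nonzero.\<close>
    have "(if k = j then axis j 1 else (if k \<in> J then w (\<sigma> k) else axis k 1)) =
        (if k \<in> J then w (\<sigma> k) else axis k 1)" for k
      using insert.hyps by auto
    then have "D J w = a \<bullet> axis j 1" unfolding D_def a[symmetric] by (simp only:)
    then have "a \<noteq> 0" using w by auto
    then show ?thesis unfolding ins by (rule AE_std_gauss_hyperplane)
  qed
  have inner: "(\<integral>\<^sup>+y. indicator {w. D (insert j J) w = 0} (w(\<sigma> j := y)) \<partial>std_gauss) = 0" if "D J w \<noteq> 0" for w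
  proof -
    have "(\<integral>\<^sup>+y. indicator {w. D (insert j J) w = 0} (w(\<sigma> j := y)) \<partial>std_gauss) =
        (\<integral>\<^sup>+y. 0 \<partial>(std_gauss :: (real^'m) measure))"
      by (rule nn_integral_cong_AE, rule eventually_mono[OF slice[OF that]]) simp
    then show ?thesis by simp
  qed
  have ae: "AE w in Pi\<^sub>M (\<sigma> ` J) (\<lambda>_. std_gauss). D J w \<noteq> 0"
    using insert.IH by (simp add: D_def)
  have indicator_eq: "(indicator {w. D (insert j J) w = 0} :: _ \<Rightarrow> ennreal) = (\<lambda>w. indicator {0} (D (insert j J) w))"
    by (auto simp: indicator_def fun_eq_iff)
  have ind: "(indicator {w. D (insert j J) w = 0} :: _ \<Rightarrow> ennreal) \<in>
      borel_measurable (Pi\<^sub>M (insert (\<sigma> j) (\<sigma> ` J)) (\<lambda>_. std_gauss))"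
    unfolding indicator_eq image_insert[symmetric] by measurable
  have "(\<integral>\<^sup>+w. indicator {w. D (insert j J) w = 0} w \<partial>(Pi\<^sub>M (insert (\<sigma> j) (\<sigma> ` J)) (\<lambda>_. std_gauss))) =
      (\<integral>\<^sup>+w. \<integral>\<^sup>+y. indicator {w. D (insert j J) w = 0} (w(\<sigma> j := y)) \<partial>std_gauss \<partial>(Pi\<^sub>M (\<sigma> ` J) (\<lambda>_. std_gauss)))"
    by (rule product_nn_integral_insert[OF j(2,1) ind])
  also have "\<dots> = (\<integral>\<^sup>+w. 0 \<partial>(Pi\<^sub>M (\<sigma> ` J) (\<lambda>_. std_gauss :: (real^'m) measure)))"
    by (rule nn_integral_cong_AE, rule eventually_mono[OF ae]) (rule inner)
  finally have "AE w in Pi\<^sub>M (insert (\<sigma> j) (\<sigma> ` J)) (\<lambda>_. std_gauss). indicator {w. D (insert j J) w = 0} w = (0 :: ennreal)"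
    using nn_integral_0_iff_AE[OF ind] by simp
  then have "AE w in Pi\<^sub>M (\<sigma> ` insert j J) (\<lambda>_. std_gauss). D (insert j J) w \<noteq> 0"
    unfolding image_insert by (rule eventually_mono) (simp add: indicator_def split: if_splits)
  then show ?case unfolding D_def .
qed

text \<open>As many vectors as the dimension, picked by the injection \<sigma>, almost surely form
  an invertible matrix; only 0 is orthogonal to all its rows.\<close>

lemma AE_std_gauss_span:
  assumes I: "finite (I :: 'i set)" and card: "CARD('m) \<le> card I"
  shows "AE w in Pi\<^sub>M I (\<lambda>_. std_gauss :: (real^'m) measure). \<forall>v. (\<forall>i\<in>I. v \<bullet> w i = 0) \<longrightarrow> v = 0"
proof -
  obtain \<sigma> :: "'m \<Rightarrow> 'i" where \<sigma>: "inj \<sigma>" "range \<sigma> \<subseteq> I"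
    using card_le_inj[OF finite_class.finite_UNIV I card] by auto
  interpret product_prob_space "\<lambda>_::'i. std_gauss :: (real^'m) measure" I
    by standard
  have "AE w in Pi\<^sub>M (range \<sigma>) (\<lambda>_. std_gauss :: (real^'m) measure). det (\<chi> k. w (\<sigma> k)) \<noteq> 0"
    using AE_std_gauss_det[OF \<sigma>(1) finite_class.finite_UNIV] by simp
  then have "AE w in distr (Pi\<^sub>M I (\<lambda>_. std_gauss)) (Pi\<^sub>M (range \<sigma>) (\<lambda>_. std_gauss :: (real^'m) measure))
      (\<lambda>f. restrict f (range \<sigma>)). det (\<chi> k. w (\<sigma> k)) \<noteq> 0"
    by (subst distr_restrict[OF \<sigma>(2) I, symmetric])
  then have "AE w in Pi\<^sub>M I (\<lambda>_. std_gauss :: (real^'m) measure). det (\<chi> k. restrict w (range \<sigma>) (\<sigma> k)) \<noteq> 0"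
    by (rule AE_distrD[rotated]) (rule measurable_restrict_subset[OF \<sigma>(2)])
  then show ?thesis
  proof eventually_elim
    case (elim w)
    show ?case
    proof (intro allI impI)
      fix v assume v: "\<forall>i\<in>I. v \<bullet> w i = 0"
      let ?A = "(\<chi> k. w (\<sigma> k)) :: real^'m^'m"
      have "?A *v v = 0"
        using v \<sigma>(2) by (auto simp: vec_eq_iff matrix_vector_mul_component inner_commute)
      moreover have "invertible ?A" using elim by (simp add: invertible_det_nz)
      ultimately show "v = 0" by (metis invertible_def matrix_vector_mul_assoc matrix_vector_mul_lid matrix_vector_mult_0_right)
    qed
  qed
qed

context sampling_times
begin

text \<open>A vector on which the quadratic form of the scatter matrix vanishes is orthogonal to
  every residual. The transposed inverse of \<open>Q\<close> maps it to a vector orthogonal to all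
  whitened residuals, which almost surely span the space.\<close>

lemma AE_alpha_hat_sym_pos_def:
  assumes Q: "det Q \<noteq> 0" and card: "CARD('m) \<le> n - 1"
  shows "AE x in density (sample_space n) (\<lambda>x. ennreal (bridge_density Q x)). sym_pos_def (alpha_hat n t (x(n := xn)))"
proof -
  have "AE w in Pi\<^sub>M {1..<n} (\<lambda>_. std_gauss :: (real^'m) measure). \<forall>v. (\<forall>i\<in>{1..<n}. v \<bullet> w i = 0) \<longrightarrow> v = 0"
    by (rule AE_std_gauss_span) (use card in auto)
  then have "AE x in density (sample_space n) (\<lambda>x. ennreal (bridge_density Q x)).
      \<forall>v. (\<forall>i\<in>{1..<n}. v \<bullet> whiten Q x i = 0) \<longrightarrow> v = 0"
    unfolding distr_whiten_bridge_density[OF Q, symmetric] by (rule AE_distrD[rotated]) simp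
  then show ?thesis
  proof eventually_elim
    case (elim x)
    have "0 < v \<bullet> (scatter x *v v)" if v: "v \<noteq> 0" for v
    proof (rule ccontr)
      assume "\<not> 0 < v \<bullet> (scatter x *v v)"
      then have "(\<Sum>i\<in>{1..<n}. (1 / (bscale i)\<^sup>2) * ((v \<bullet> innov x i) * (v \<bullet> innov x i))) \<le> 0"
        by (simp add: inner_scatter)
      moreover have nn: "0 \<le> (1 / (bscale i)\<^sup>2) * ((v \<bullet> innov x i) * (v \<bullet> innov x i))" for i
        by (intro mult_nonneg_nonneg[OF _ zero_le_square]) simp
      ultimately have "(\<Sum>i\<in>{1..<n}. (1 / (bscale i)\<^sup>2) * ((v \<bullet> innov x i) * (v \<bullet> innov x i))) = 0"
        by (intro antisym sum_nonneg)
      then have "\<forall>i\<in>{1..<n}. (1 / (bscale i)\<^sup>2) * ((v \<bullet> innov x i) * (v \<bullet> innov x i)) = 0"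
        by (subst (asm) sum_nonneg_eq_0_iff) (use nn in auto)
      then have zero: "v \<bullet> innov x i = 0" if "i \<in> {1..<n}" for i
        using that bscale_pos[of i] by auto
      obtain R where R: "Q ** R = mat 1" "R ** Q = mat 1"
        using Q invertible_det_nz[of Q] by (auto simp: invertible_def)
      have "(transpose R *v v) \<bullet> whiten Q x i = 0" if i: "i \<in> {1..<n}" for i
        using i zero[OF i]
        by (simp add: whiten_def transpose_matrix_vector dot_lmul_matrix matrix_vector_mul_assoc R)
      then have "transpose R *v v = 0" using elim by blast
      then have "transpose Q *v (transpose R *v v) = 0" by simp
      then have "transpose (R ** Q) *v v = 0"
        by (simp only: matrix_vector_mul_assoc matrix_transpose_mul)
      then show False using v by (simp add: R)
    qed
    moreover have "transpose ((1 / real (n - 1)) *\<^sub>R scatter x) = (1 / real (n - 1)) *\<^sub>R scatter x"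
      using transpose_scatter[of x] by (simp add: transpose_def vec_eq_iff)
    ultimately show ?case
      using n by (simp add: sym_pos_def_def alpha_hat_eq_scatter scaleR_matrix_vector_assoc[symmetric])
  qed
qed


lemma continuous_on_bridge_density: "continuous_on A (bridge_density Q)"
proof -
  have coord: "continuous_on A (\<lambda>x :: nat \<Rightarrow> real^'m. x i)" for i
    by (rule continuous_on_subset[OF continuous_on_product_coordinates]) simp
  have innov: "continuous_on A (\<lambda>x. innov x i)" for i
    unfolding innov_def using coord by (cases "Suc i = n") (auto intro!: continuous_intros)
  have mv: "continuous_on A (\<lambda>x. P *v innov x i)" for P :: "real^'m^'m" and i
    using continuous_on_compose[OF innov linear_continuous_on[of "(*v) P"]] by (simp add: comp_def)
  show ?thesis
    unfolding bridge_density_def by (intro continuous_intros mv)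
qed

lemma measurable_alpha_hat: "(\<lambda>x. alpha_hat n t (x(n := xn))) \<in> borel_measurable (sample_space n)"
proof -
  have outer: "(\<lambda>v :: real^'m. outer v v) \<in> borel_measurable borel"
    unfolding outer_def by (intro borel_measurable_continuous_onI continuous_intros)
  have innov: "(\<lambda>x. innov x i) \<in> borel_measurable (sample_space n)" if "i \<in> {1..<n}" for i
    using measurable_innov[OF that] by (subst measurable_cong_sets[OF sets_sample_space refl])
  show ?thesis
    unfolding alpha_hat_eq_scatter scatter_def
    by (intro borel_measurable_scaleR borel_measurable_sum borel_measurable_const measurable_compose[OF innov outer])
qed

end

section \<open>Identification of the likelihood and conclusion\<close>

lemma exists_whitening:
  fixes \<alpha> :: "real^'m^'m"
  assumes "sym_pos_def \<alpha>"
  shows "\<exists>Q :: real^'m^'m. Q ** \<alpha> ** transpose Q = mat 1"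
  using simultaneous_diagonalization[OF assms, of \<alpha>] assms by (metis sym_pos_def_def)

context gaussian_bridge
begin

text \<open>\<open>bridge_density Q\<close> witnesses the choice in \<open>joint_density\<close>,
  and continuous densities of one law agree at every point of the sample space.\<close>

lemma joint_density_eq:
  assumes Q: "Q ** \<alpha> ** transpose Q = mat 1" and x: "x \<in> space (sample_space n)"
  shows "joint_density M n t B x = bridge_density Q x"
proof -
  let ?P = "\<lambda>f. continuous_on (space (sample_space n)) f \<and> (\<forall>x\<in>space (sample_space n). 0 \<le> f x) \<and>
    distributed M (sample_space n) (sample n t B) (\<lambda>x. ennreal (f x))"
  have P: "?P (bridge_density Q)"
    using sample_law_eq_density[OF Q]
    by (simp add: continuous_on_bridge_density bridge_density_nonneg distributed_def sample_law_def)
  then have J: "?P (joint_density M n t B)"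
    unfolding joint_density_def by (rule someI[of ?P])
  show ?thesis
    by (rule continuous_density_unique[of "{1..<n}", folded sample_space_def])
      (use P J x in \<open>auto simp: distributed_def\<close>)
qed

end

text \<open>Maximisation is over positive definite matrices, so at a sample with singular estimator
  the set of estimates is empty; the second conjunct covers this case as well. If n - 1 is less than
  the dimension, this happens at every sample, since the estimator is a sum of n - 1 matrices of
  rank at most one; hence the condition in the third conjunct.\<close>

theorem lemma3:
  fixes n :: nat and t :: "nat \<Rightarrow> real" and xn :: "real^'m"
    and M :: "real^'m^'m \<Rightarrow> 'a measure"
    and B :: "real^'m^'m \<Rightarrow> real \<Rightarrow> 'a \<Rightarrow> real^'m"
  defines "\<Theta> \<equiv> {\<alpha>. sym_pos_def \<alpha>}"
    and "T \<equiv> \<lambda>x. alpha_hat n t (x(n := xn))"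
    and "L \<equiv> \<lambda>\<alpha>. joint_density (M \<alpha>) n t (B \<alpha>)"
  assumes n: "2 \<le> n"
    and t_pos: "0 < t 1"
    and t_less: "\<And>i. 1 \<le> i \<Longrightarrow> i < n \<Longrightarrow> t i < t (i + 1)"
    and gaussian: "\<And>\<alpha>. \<alpha> \<in> \<Theta> \<Longrightarrow> gaussian_process (M \<alpha>) {0..t n} (B \<alpha>)"
    and mean: "\<And>\<alpha> u. \<alpha> \<in> \<Theta> \<Longrightarrow> u \<in> {0..t n} \<Longrightarrow>
      (\<integral>\<omega>. B \<alpha> u \<omega> \<partial>M \<alpha>) = (u / t n) *\<^sub>R xn"
    and cov: "\<And>\<alpha> u s. \<alpha> \<in> \<Theta> \<Longrightarrow> u \<in> {0..t n} \<Longrightarrow> s \<in> {0..t n} \<Longrightarrow>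
      (\<integral>\<omega>. outer (B \<alpha> u \<omega> - (\<integral>\<omega>'. B \<alpha> u \<omega>' \<partial>M \<alpha>)) (B \<alpha> s \<omega> - (\<integral>\<omega>'. B \<alpha> s \<omega>' \<partial>M \<alpha>)) \<partial>M \<alpha>) =
        (if s \<le> u then (mat 1 - (u / t n) *\<^sub>R mat 1) ** (s *\<^sub>R \<alpha>)
         else (u *\<^sub>R \<alpha>) ** (mat 1 - (s / t n) *\<^sub>R mat 1))"
  shows "sufficient_statistic \<Theta> (\<lambda>\<alpha>. sample_law (M \<alpha>) n t (B \<alpha>)) (sample_space n) borel T \<and>
    (\<forall>x\<in>space (sample_space n). ml_estimates \<Theta> L x = {T x} \<inter> \<Theta>) \<and>
    (CARD('m) \<le> n - 1 \<longrightarrow>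
       (\<forall>\<alpha>\<in>\<Theta>. AE x in sample_law (M \<alpha>) n t (B \<alpha>). ml_estimates \<Theta> L x = {T x}))"
proof -
  interpret sampling_times n t xn
    by unfold_locales (fact n t_pos t_less)+
  have bridge: "gaussian_bridge n t xn (M \<alpha>) (B \<alpha>) \<alpha>" if "\<alpha> \<in> \<Theta>" for \<alpha>
    by unfold_locales (use gaussian mean cov that in auto)
  obtain Q :: "real^'m^'m \<Rightarrow> real^'m^'m" where Q: "\<And>\<alpha>. \<alpha> \<in> \<Theta> \<Longrightarrow> Q \<alpha> ** \<alpha> ** transpose (Q \<alpha>) = mat 1"
    using exists_whitening unfolding \<Theta>_def by (metis mem_Collect_eq)
  have law: "sample_law (M \<alpha>) n t (B \<alpha>) = density (sample_space n) (\<lambda>x. ennreal (bridge_density (Q \<alpha>) x))"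
    if "\<alpha> \<in> \<Theta>" for \<alpha>
    by (rule gaussian_bridge.sample_law_eq_density[OF bridge[OF that] Q[OF that]])
  have ml: "ml_estimates \<Theta> L x = {T x} \<inter> \<Theta>" if x: "x \<in> space (sample_space n)" for x
    unfolding \<Theta>_def T_def
    by (rule ml_estimates_bridge)
      (use gaussian_bridge.joint_density_eq[OF bridge _ x] in \<open>simp add: \<Theta>_def L_def\<close>)
  \<comment> \<open>The scatter matrix in the density is replaced by n - 1 times the argument, so
    the whole density factors through the estimator, for every parameter.\<close>
  define h where "h \<alpha> \<beta> = density_const * \<bar>det (Q \<alpha>)\<bar> ^ (n - 1) *
    exp (- (\<Sum>k\<in>UNIV. Q \<alpha> $ k \<bullet> (real (n - 1) *\<^sub>R (\<beta> *v (Q \<alpha> $ k)))) / 2)" for \<alpha> \<beta>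
  have h_T: "bridge_density (Q \<alpha>) x = h \<alpha> (T x)" for \<alpha> x
    using n by (simp add: bridge_density_eq_scatter h_def T_def alpha_hat_eq_scatter scaleR_matrix_vector_assoc[symmetric])
  have "sufficient_statistic \<Theta> (\<lambda>\<alpha>. sample_law (M \<alpha>) n t (B \<alpha>)) (sample_space n) borel T"
  proof (rule sufficient_statisticI)
    show "T \<in> borel_measurable (sample_space n)"
      unfolding T_def by (rule measurable_alpha_hat)
    show "mat 1 \<in> \<Theta>"
      by (simp add: \<Theta>_def sym_pos_def_def)
    fix \<alpha> assume \<alpha>: "\<alpha> \<in> \<Theta>"
    have "continuous_on UNIV (\<lambda>\<beta> :: real^'m^'m. \<beta> *v v)" for v :: "real^'m"
      unfolding matrix_vector_mult_def by (intro continuous_intros)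
    then show "h \<alpha> \<in> borel_measurable borel"
      unfolding h_def by (intro borel_measurable_continuous_onI continuous_intros) auto
    show "0 < h \<alpha> \<beta>" for \<beta>
      using density_const_pos det_nonzero_if_congruent_identity[OF Q[OF \<alpha>]] by (simp add: h_def)
    show "sample_law (M \<alpha>) n t (B \<alpha>) = density (sample_space n) (\<lambda>x. ennreal (h \<alpha> (T x)))"
      using law[OF \<alpha>] by (simp add: h_T)
    interpret gaussian_bridge n t xn "M \<alpha>" "B \<alpha>" \<alpha> by (rule bridge[OF \<alpha>])
    show "prob_space (sample_law (M \<alpha>) n t (B \<alpha>))"
      unfolding sample_law_def by (rule prob_space_distr) (rule measurable_sample)
  qed
  moreover have "AE x in sample_law (M \<alpha>) n t (B \<alpha>). ml_estimates \<Theta> L x = {T x}"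
    if card: "CARD('m) \<le> n - 1" and \<alpha>: "\<alpha> \<in> \<Theta>" for \<alpha>
  proof -
    have "AE x in sample_law (M \<alpha>) n t (B \<alpha>). T x \<in> \<Theta>"
      unfolding law[OF \<alpha>] T_def \<Theta>_def mem_Collect_eq
      by (rule AE_alpha_hat_sym_pos_def[OF det_nonzero_if_congruent_identity[OF Q[OF \<alpha>]] card])
    then show ?thesis
      using AE_space
    proof eventually_elim
      case (elim x)
      then have "x \<in> space (sample_space n)" by (simp add: sample_law_def)
      then show ?case using ml elim by auto
    qed
  qed
  ultimately show ?thesis using ml by blast
qed

end
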